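(* Let $n=2$, let $\lambda_1(s)<\lambda_2(s)$ for all $s\in I$, and let $T_t:\Omega\to\Omega_t$ be conformal at $t$ $(t\in I)$. Assume, furthermore, that $$\frac{\partial^2a_t}{\partial t^2}\ge0\quad\text{in }\Omega.$$ Then it holds that $$\frac{d^2}{dt^2}\frac1{\lambda_1(t)}\ge0 .$$
   Context: $\Omega\subset\mathbb{R}^n$ is a bounded Lipschitz domain whose boundary is divided into two relatively open sets $\gamma_0,\gamma_1$ with $\overline{\gamma_0}\cup\overline{\gamma_1}=\partial\Omega$ and $\overline{\gamma_0}\cap\overline{\gamma_1}=\emptyset$. Let $X=L^2(\Omega)$ and $V=\{v\in H^1(\Omega): v|_{\gamma_0}=0\}$ (trace sense), with the $H^1$ norm $\|\cdot\|$ on $V$. $T_t:\Omega\to\Omega_t=T_t(\Omega)$, $t\in I=(-\varepsilon_0,\varepsilon_0)$, is a family of bi-Lipschitz homeomorphisms, with $T_tx$ continuous in $t$ uniformly in $x\in\Omega$, which is twice continuously differentiable in the following sense: $T_tx$ is twice differentiable in $t$ for every $x\in\Omega$; for $0\le\ell\le2$ the maps $\partial_t^\ell DT_t$ and $\partial_t^\ell (DT_t)^{-1}$ from $\Omega$ to the real $n\times n$ matrices are bounded uniformly in $(x,t)$; and they are continuous in $t$ as maps from $I$ into $L^\infty(\Omega)$. Here $DT_t$ is the Jacobi matrix of $T_t$. Put $a_t=\det DT_t$ and $Q_t=(DT_t)^{-1}\bigl((DT_t)^{-1}\bigr)^T$. $T_t$ is called conformal if $(DT_t)^{-1}\bigl((DT_t)^{-1}\bigr)^T=\frac1{\alpha_t}E$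 holds with a scalar field $\alpha_t>0$ ($E$ the unit matrix); it is moreover assumed that the orthogonal matrix $F_t=\alpha_t^{-1/2}DT_t$ satisfies $\det F_t=1$, so that $a_t=\alpha_t^{n/2}$. $\lambda_j(t)$ is the $j$-th eigenvalue (counted with multiplicity) of $-\Delta u=\lambda u$ in $\Omega_t$, $u=0$ on $T_t(\gamma_0)$, $\partial u/\partial\nu=0$ on $T_t(\gamma_1)$ ($\nu$ the outer unit normal), understood in weak form; equivalently, of the problem: $u\in V$, $B_t(u,u)=1$, $A_t(u,v)=\lambda B_t(u,v)$ for all $v\in V$, where $$A_t(u,v)=\int_\Omega (\nabla u)^TQ_t\nabla v\,a_t\,dx,\qquad B_t(u,v)=\int_\Omega uv\,a_t\,dx.$$ Standing assumption: $A_t$ is coercive on $V$, i.e. there is $\delta>0$ with $A_t(u,u)\ge\delta\|u\|^2$ for all $u\in V$, $t\in I$, so that $\lambda_1(t)>0$. *)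

theory Defs
  imports "HOL-Analysis.Analysis" "HOL-Library.Extended_Nat"
begin

section \<open>Domains\<close>

text \<open>
  Near each boundary point the domain is the strict epigraph, in some direction \<open>e\<close>, of a Lipschitz
  function of the component orthogonal to \<open>e\<close>.
\<close>

definition lipschitz_domain :: "(real^'n) set \<Rightarrow> bool" where
  "lipschitz_domain \<Omega> \<longleftrightarrow>
     \<Omega> \<noteq> {} \<and> open \<Omega> \<and> connected \<Omega> \<and> bounded \<Omega> \<and>
     (\<forall>x\<in>frontier \<Omega>. \<exists>U e g L. open U \<and> x \<in> U \<and> norm e = 1 \<and> L-lipschitz_on UNIV g \<and>
        \<Omega> \<inter> U = {y \<in> U. y \<bullet> e > (g (y - (y \<bullet> e) *\<^sub>R e) :: real)})"

definition boundary_partition ::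
    "(real^'n) set \<Rightarrow> (real^'n) set \<Rightarrow> (real^'n) set \<Rightarrow> bool" where
  "boundary_partition \<Omega> \<gamma>0 \<gamma>1 \<longleftrightarrow>
     openin (top_of_set (frontier \<Omega>)) \<gamma>0 \<and> openin (top_of_set (frontier \<Omega>)) \<gamma>1 \<and>
     closure \<gamma>0 \<union> closure \<gamma>1 = frontier \<Omega> \<and> closure \<gamma>0 \<inter> closure \<gamma>1 = {}"


section \<open>Sobolev space and traces\<close>

definition L2 :: "(real^'n) set \<Rightarrow> (real^'n \<Rightarrow> 'b::euclidean_space) set" where
  "L2 \<Omega> = {f \<in> borel_measurable (lebesgue_on \<Omega>).
             integrable (lebesgue_on \<Omega>) (\<lambda>x. (norm (f x))\<^sup>2)}"

definition C1_grad :: "(real^'n \<Rightarrow> real) \<Rightarrow> (real^'n \<Rightarrow> real^'n) \<Rightarrow> bool" where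
  "C1_grad \<phi> \<psi> \<longleftrightarrow> (\<forall>x. GDERIV \<phi> x :> \<psi> x) \<and> continuous_on UNIV \<psi>"

text \<open>
  Weak gradient, tested against compactly supported functions of class \<open>C\<^sup>1\<close>; by mollification,
  smooth test functions give the same notion.
\<close>

definition weak_gradient ::
    "(real^'n) set \<Rightarrow> (real^'n \<Rightarrow> real) \<Rightarrow> (real^'n \<Rightarrow> real^'n) \<Rightarrow> bool" where
  "weak_gradient \<Omega> u G \<longleftrightarrow> u \<in> L2 \<Omega> \<and> G \<in> L2 \<Omega> \<and>
     (\<forall>\<phi> \<psi>. C1_grad \<phi> \<psi> \<and> compact (closure {x. \<phi> x \<noteq> 0}) \<and> closure {x. \<phi> x \<noteq> 0} \<subseteq> \<Omega> \<longrightarrow>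
        (LINT x|lebesgue_on \<Omega>. u x *\<^sub>R \<psi> x) = - (LINT x|lebesgue_on \<Omega>. \<phi> x *\<^sub>R G x))"

definition H1 :: "(real^'n) set \<Rightarrow> (real^'n \<Rightarrow> real) set" where
  "H1 \<Omega> = {u. \<exists>G. weak_gradient \<Omega> u G}"

text \<open>Elements of \<open>H1 \<Omega>\<close> are representatives; the chosen gradient is unique almost everywhere.\<close>

definition grad :: "(real^'n) set \<Rightarrow> (real^'n \<Rightarrow> real) \<Rightarrow> real^'n \<Rightarrow> real^'n" where
  "grad \<Omega> u = (SOME G. weak_gradient \<Omega> u G)"

definition H1_norm :: "(real^'n) set \<Rightarrow> (real^'n \<Rightarrow> real) \<Rightarrow> real" where
  "H1_norm \<Omega> u = sqrt ((LINT x|lebesgue_on \<Omega>. (u x)\<^sup>2) +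
                        (LINT x|lebesgue_on \<Omega>. (norm (grad \<Omega> u x))\<^sup>2))"

text \<open>
  The \<open>d\<close>-dimensional Hausdorff measure, normalised to agree with Lebesgue measure. Covers are
  restricted to bounded sets because \<^const>\<open>diameter\<close> is unspecified on unbounded ones, and empty
  members must contribute nothing also when \<open>d = 0\<close>.
\<close>

definition hausdorff_content :: "nat \<Rightarrow> real \<Rightarrow> (real^'n) set \<Rightarrow> ennreal" where
  "hausdorff_content d \<delta> A =
     (INF C \<in> {C :: nat \<Rightarrow> (real^'n) set. A \<subseteq> (\<Union>i. C i) \<and>
                  (\<forall>i. bounded (C i) \<and> diameter (C i) \<le> \<delta>)}.
        \<Sum>i. if C i = {} then 0 else ennreal (unit_ball_vol (real d) * (diameter (C i) / 2) ^ d))"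

definition hausdorff_measure :: "nat \<Rightarrow> (real^'n) measure" where
  "hausdorff_measure d = measure_of UNIV (sets borel) (\<lambda>A. SUP \<delta>\<in>{0<..}. hausdorff_content d \<delta> A)"

definition surface_measure :: "(real^'n) measure" where
  "surface_measure = hausdorff_measure (CARD('n) - 1)"

text \<open>
  On a boundary part \<open>\<gamma>\<close> the trace is the continuous extension to \<open>H\<^sup>1\<close> of the restriction
  \<open>\<phi> \<mapsto> \<phi>|\<gamma>\<close>, with values in \<open>L\<^sup>2(\<gamma>)\<close>, from the dense subspace of functions of class \<open>C\<^sup>1\<close> up to
  the boundary.
\<close>

definition has_trace ::
    "(real^'n) set \<Rightarrow> (real^'n) set \<Rightarrow> (real^'n \<Rightarrow> real) \<Rightarrow> (real^'n \<Rightarrow> real) \<Rightarrow> bool" where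
  "has_trace \<Omega> \<gamma> u g \<longleftrightarrow> u \<in> H1 \<Omega> \<and> g \<in> borel_measurable borel \<and>
     (\<exists>\<phi> :: nat \<Rightarrow> real^'n \<Rightarrow> real.
        (\<forall>k. \<exists>\<psi>. C1_grad (\<phi> k) \<psi>) \<and>
        (\<lambda>k. H1_norm \<Omega> (\<lambda>x. \<phi> k x - u x)) \<longlonglongrightarrow> 0 \<and>
        (\<lambda>k. \<integral>\<^sup>+x\<in>\<gamma>. ennreal ((\<phi> k x - g x)\<^sup>2) \<partial>surface_measure) \<longlonglongrightarrow> 0)"

definition V_space :: "(real^'n) set \<Rightarrow> (real^'n) set \<Rightarrow> (real^'n \<Rightarrow> real) set" where
  "V_space \<Omega> \<gamma>0 = {v \<in> H1 \<Omega>. has_trace \<Omega> \<gamma>0 v (\<lambda>_. 0)}"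


section \<open>Families of transformations\<close>

definition bilipschitz_on :: "(real^'n) set \<Rightarrow> (real^'n \<Rightarrow> real^'n) \<Rightarrow> bool" where
  "bilipschitz_on \<Omega> f \<longleftrightarrow>
     (\<exists>L>0. \<forall>x\<in>\<Omega>. \<forall>y\<in>\<Omega>. dist x y / L \<le> dist (f x) (f y) \<and> dist (f x) (f y) \<le> L * dist x y)"

definition DT :: "(real \<Rightarrow> real^'n \<Rightarrow> real^'n) \<Rightarrow> real \<Rightarrow> real^'n \<Rightarrow> real^'n^'n" where
  "DT T t x = jacobian (T t) (at x)"

definition DTinv :: "(real \<Rightarrow> real^'n \<Rightarrow> real^'n) \<Rightarrow> real \<Rightarrow> real^'n \<Rightarrow> real^'n^'n" where
  "DTinv T t x = matrix_inv (DT T t x)"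

definition continuous_Linfty ::
    "real set \<Rightarrow> (real^'n) set \<Rightarrow> (real \<Rightarrow> real^'n \<Rightarrow> real^'n^'n) \<Rightarrow> bool" where
  "continuous_Linfty I \<Omega> M \<longleftrightarrow>
     (\<forall>t\<in>I. M t \<in> borel_measurable (lebesgue_on \<Omega>)) \<and>
     (\<forall>t\<in>I. \<forall>e>0. \<forall>\<^sub>F s in at t within I. AE x in lebesgue_on \<Omega>. norm (M s x - M t x) \<le> e)"

definition bounded_Linfty ::
    "real set \<Rightarrow> (real^'n) set \<Rightarrow> (real \<Rightarrow> real^'n \<Rightarrow> real^'n^'n) \<Rightarrow> bool" where
  "bounded_Linfty I \<Omega> M \<longleftrightarrow> (\<exists>C. AE x in lebesgue_on \<Omega>. \<forall>t\<in>I. norm (M t x) \<le> C)"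

text \<open>
  Jacobi matrices of Lipschitz maps exist only almost everywhere, so the derivatives in \<open>t\<close> are taken
  pointwise outside one null set, the same for all \<open>t\<close>.
\<close>

definition C2_Linfty ::
    "real set \<Rightarrow> (real^'n) set \<Rightarrow> (real \<Rightarrow> real^'n \<Rightarrow> real^'n^'n) \<Rightarrow> bool" where
  "C2_Linfty I \<Omega> M \<longleftrightarrow>
     (\<exists>M1 M2.
        (AE x in lebesgue_on \<Omega>. \<forall>t\<in>I.
           ((\<lambda>s. M s x) has_vector_derivative M1 t x) (at t) \<and>
           ((\<lambda>s. M1 s x) has_vector_derivative M2 t x) (at t)) \<and>
        (\<forall>N\<in>{M, M1, M2}. bounded_Linfty I \<Omega> N \<and> continuous_Linfty I \<Omega> N))"

definition C2_bilipschitz_family ::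
    "real set \<Rightarrow> (real^'n) set \<Rightarrow> (real \<Rightarrow> real^'n \<Rightarrow> real^'n) \<Rightarrow> bool" where
  "C2_bilipschitz_family I \<Omega> T \<longleftrightarrow>
     (\<forall>t\<in>I. bilipschitz_on \<Omega> (T t)) \<and>
     (\<forall>t\<in>I. uniform_limit \<Omega> T (T t) (at t within I)) \<and>
     (\<exists>T1 T2. \<forall>x\<in>\<Omega>. \<forall>t\<in>I.
        ((\<lambda>s. T s x) has_vector_derivative T1 t x) (at t) \<and>
        ((\<lambda>s. T1 s x) has_vector_derivative T2 t x) (at t)) \<and>
     (AE x in lebesgue_on \<Omega>. \<forall>t\<in>I. T t differentiable (at x) \<and> invertible (DT T t x)) \<and>
     C2_Linfty I \<Omega> (DT T) \<and> C2_Linfty I \<Omega> (DTinv T)"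

definition a_coeff :: "(real \<Rightarrow> real^'n \<Rightarrow> real^'n) \<Rightarrow> real \<Rightarrow> real^'n \<Rightarrow> real" where
  "a_coeff T t x = det (DT T t x)"

definition Q_coeff :: "(real \<Rightarrow> real^'n \<Rightarrow> real^'n) \<Rightarrow> real \<Rightarrow> real^'n \<Rightarrow> real^'n^'n" where
  "Q_coeff T t x = DTinv T t x ** transpose (DTinv T t x)"

definition conformal_at ::
    "(real^'n) set \<Rightarrow> (real \<Rightarrow> real^'n \<Rightarrow> real^'n) \<Rightarrow> real \<Rightarrow> bool" where
  "conformal_at \<Omega> T t \<longleftrightarrow>
     (\<exists>\<alpha> :: real^'n \<Rightarrow> real. AE x in lebesgue_on \<Omega>.
        \<alpha> x > 0 \<and> Q_coeff T t x = (1 / \<alpha> x) *\<^sub>R mat 1 \<and>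
        det ((\<alpha> x powr (- 1 / 2)) *\<^sub>R DT T t x) = 1)"


section \<open>The eigenvalue problem\<close>

definition A_form ::
    "(real^'n) set \<Rightarrow> (real \<Rightarrow> real^'n \<Rightarrow> real^'n) \<Rightarrow> real \<Rightarrow>
     (real^'n \<Rightarrow> real) \<Rightarrow> (real^'n \<Rightarrow> real) \<Rightarrow> real" where
  "A_form \<Omega> T t u v =
     (LINT x|lebesgue_on \<Omega>. (grad \<Omega> u x \<bullet> (Q_coeff T t x *v grad \<Omega> v x)) * a_coeff T t x)"

definition B_form ::
    "(real^'n) set \<Rightarrow> (real \<Rightarrow> real^'n \<Rightarrow> real^'n) \<Rightarrow> real \<Rightarrow>
     (real^'n \<Rightarrow> real) \<Rightarrow> (real^'n \<Rightarrow> real) \<Rightarrow> real" where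
  "B_form \<Omega> T t u v = (LINT x|lebesgue_on \<Omega>. u x * v x * a_coeff T t x)"

definition coercive_family ::
    "real set \<Rightarrow> (real^'n) set \<Rightarrow> (real^'n) set \<Rightarrow> (real \<Rightarrow> real^'n \<Rightarrow> real^'n) \<Rightarrow> bool" where
  "coercive_family I \<Omega> \<gamma>0 T \<longleftrightarrow>
     (\<exists>\<delta>>0. \<forall>t\<in>I. \<forall>u\<in>V_space \<Omega> \<gamma>0. A_form \<Omega> T t u u \<ge> \<delta> * (H1_norm \<Omega> u)\<^sup>2)"

definition eigenspace ::
    "(real^'n) set \<Rightarrow> (real^'n) set \<Rightarrow> (real \<Rightarrow> real^'n \<Rightarrow> real^'n) \<Rightarrow> real \<Rightarrow> real \<Rightarrow>
     (real^'n \<Rightarrow> real) set" where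
  "eigenspace \<Omega> \<gamma>0 T t \<mu> =
     {u \<in> V_space \<Omega> \<gamma>0. \<forall>v\<in>V_space \<Omega> \<gamma>0. A_form \<Omega> T t u v = \<mu> * B_form \<Omega> T t u v}"

definition is_eigenvalue ::
    "(real^'n) set \<Rightarrow> (real^'n) set \<Rightarrow> (real \<Rightarrow> real^'n \<Rightarrow> real^'n) \<Rightarrow> real \<Rightarrow> real \<Rightarrow> bool" where
  "is_eigenvalue \<Omega> \<gamma>0 T t \<mu> \<longleftrightarrow> (\<exists>u\<in>eigenspace \<Omega> \<gamma>0 T t \<mu>. B_form \<Omega> T t u u = 1)"

text \<open>
  Dimension modulo equality almost everywhere, as functions are not identified with their classes.
\<close>

definition AE_dim :: "(real^'n) set \<Rightarrow> (real^'n \<Rightarrow> real) set \<Rightarrow> enat" where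
  "AE_dim \<Omega> E = Sup {enat k | k. \<exists>u :: nat \<Rightarrow> real^'n \<Rightarrow> real. (\<forall>i<k. u i \<in> E) \<and>
     (\<forall>c :: nat \<Rightarrow> real. (AE x in lebesgue_on \<Omega>. (\<Sum>i<k. c i * u i x) = 0) \<longrightarrow> (\<forall>i<k. c i = 0))}"

text \<open>
  The \<open>j\<close>-th eigenvalue (\<open>j \<ge> 1\<close>) is the least \<open>\<mu>\<close> such that the eigenvalues up to \<open>\<mu>\<close> number at
  least \<open>j\<close> with multiplicity. The finite set \<open>F\<close> avoids sums over sets not yet known to be finite.
\<close>

definition eigenval ::
    "(real^'n) set \<Rightarrow> (real^'n) set \<Rightarrow> (real \<Rightarrow> real^'n \<Rightarrow> real^'n) \<Rightarrow> nat \<Rightarrow> real \<Rightarrow> real" where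
  "eigenval \<Omega> \<gamma>0 T j t =
     (LEAST \<mu>. \<exists>F. finite F \<and> F \<subseteq> {\<nu>. is_eigenvalue \<Omega> \<gamma>0 T t \<nu> \<and> \<nu> \<le> \<mu>} \<and>
        enat j \<le> (\<Sum>\<nu>\<in>F. AE_dim \<Omega> (eigenspace \<Omega> \<gamma>0 T t \<nu>)))"

end

theory Submission
  imports Defs "HOL-Library.Diagonal_Subsequence"
begin

text \<open>
  For a conformal family in the plane the matrix \<open>Q\<^sub>t a\<^sub>t\<close> is the identity, so the energy form is
  the Dirichlet integral for every \<open>t\<close> (lemma \<open>conformal_A_form\<close>) and only the mass form
  \<open>B\<^sub>t(u,v) = \<integral> u v a\<^sub>t\<close> moves. Consequently \<open>\<mu>(t) = 1 / \<lambda>\<^sub>1(t)\<close> is the maximum of \<open>B\<^sub>t(u,u)\<close> over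
  the unit sphere of the Dirichlet form \<open>A\<close>. Let \<open>e\<close> be a maximiser. Second order perturbation
  theory gives \<open>\<mu>'' = B''(e,e) + 2 L\<close>, where \<open>B''(e,e) = \<integral> e\<^sup>2 a''\<close> is nonnegative by assumption,
  and \<open>L\<close>, classically the sum of \<open>B'(e,e\<^sub>k)\<^sup>2 / (\<mu> - \<mu>\<^sub>k)\<close> over the other eigenfunctions, is
  nonnegative because \<open>\<mu>\<close> is the top eigenvalue.

  The perturbation formula is proved for an abstract family of symmetric forms on an energy space
  whose top eigenvalue is separated by a gap from the rest (locale \<open>eigenvalue_family\<close>). The gap
  replaces the resolvent: it bounds the variation of the normalised eigenvector linearly in \<open>t\<close>,
  and it makes the difference quotients of the eigenvector a Cauchy family, whose pairing with
  \<open>B'(e,\<cdot>)\<close> converges to \<open>L\<close> (lemmas \<open>first_order\<close> and \<open>second_order\<close>).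

  That the maximum is attained, and that a gap exists when the maximiser is unique up to
  multiples, follows from completeness of the space \<open>V\<close> and compactness of its embedding into
  \<open>L\<^sup>2\<close> (locale \<open>compact_form\<close>). Completeness rests on the uniqueness of weak gradients and on the
  Riesz-Fischer theorem. Compactness (lemma \<open>Rellich\<close>) comes from an explicit inequality for
  functions of class \<open>C\<^sup>1\<close>: up to a small multiple of the Dirichlet integral, the \<open>L\<^sup>2\<close> norm on a
  Lipschitz domain is controlled by finitely many integrals over balls (lemma
  \<open>finite_rank_L2_estimate\<close>).

  Finally the eigenvalues, defined as least numbers with enough eigenvalues below them, have to be
  identified with the variational ones (lemma \<open>simple_principal_eigenvalue\<close>). The hypothesis
  \<open>\<lambda>\<^sub>1 < \<lambda>\<^sub>2\<close> enters twice there: it excludes the case without any eigenvalue, in which both least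
  numbers are the same unspecified value, and it makes the first eigenvalue simple.
\<close>

section \<open>Symmetric bilinear forms\<close>

text \<open>
  One operation with both coefficients explicit covers sums, differences and multiples.
\<close>

definition lincomb :: "real \<Rightarrow> ('a \<Rightarrow> real) \<Rightarrow> real \<Rightarrow> ('a \<Rightarrow> real) \<Rightarrow> 'a \<Rightarrow> real" where
  "lincomb a u b v = (\<lambda>x. a * u x + b * v x)"

definition sym_form :: "('a \<Rightarrow> real) set \<Rightarrow> (('a \<Rightarrow> real) \<Rightarrow> ('a \<Rightarrow> real) \<Rightarrow> real) \<Rightarrow> bool" where
  "sym_form S F \<longleftrightarrow>
     (\<forall>u\<in>S. \<forall>v\<in>S. F u v = F v u) \<and>
     (\<forall>u\<in>S. \<forall>v\<in>S. \<forall>w\<in>S. \<forall>a b. F (lincomb a u b v) w = a * F u w + b * F v w)"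

locale function_space =
  fixes S :: "('a \<Rightarrow> real) set"
  assumes lincomb_in [simp]: "u \<in> S \<Longrightarrow> v \<in> S \<Longrightarrow> lincomb a u b v \<in> S"
begin

lemma sym_form_commute: "sym_form S F \<Longrightarrow> u \<in> S \<Longrightarrow> v \<in> S \<Longrightarrow> F u v = F v u"
  unfolding sym_form_def by blast

lemma sym_form_left:
  "sym_form S F \<Longrightarrow> u \<in> S \<Longrightarrow> v \<in> S \<Longrightarrow> w \<in> S \<Longrightarrow> F (lincomb a u b v) w = a * F u w + b * F v w"
  unfolding sym_form_def by blast

lemma sym_form_right:
  "sym_form S F \<Longrightarrow> u \<in> S \<Longrightarrow> v \<in> S \<Longrightarrow> w \<in> S \<Longrightarrow> F w (lincomb a u b v) = a * F w u + b * F w v"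
  by (metis lincomb_in sym_form_commute sym_form_left)

lemma sym_form_square:
  assumes "sym_form S F" "u \<in> S" "v \<in> S"
  shows "F (lincomb a u b v) (lincomb a u b v) = a\<^sup>2 * F u u + 2 * a * b * F u v + b\<^sup>2 * F v v"
  using assms sym_form_commute[OF assms]
  by (simp add: sym_form_left sym_form_right power2_eq_square algebra_simps)

text \<open>
  If \<open>F v v > 0\<close>, the form is evaluated at a multiple of the vector \<open>u + b v\<close> of least energy. For
  \<open>F v v = 0\<close>, which is possible for \<open>v\<close> other than zero, a nonzero \<open>F u v\<close> would make the form
  unbounded below.
\<close>

lemma Cauchy_Schwarz_form:
  assumes F: "sym_form S F" and pos: "\<And>u. u \<in> S \<Longrightarrow> 0 \<le> F u u" and u: "u \<in> S" and v: "v \<in> S"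
  shows "(F u v)\<^sup>2 \<le> F u u * F v v"
proof (cases "F v v = 0")
  case False
  then have p: "F v v > 0" using pos[OF v] by simp
  have "0 \<le> F (lincomb (F v v) u (- F u v) v) (lincomb (F v v) u (- F u v) v)"
    using u v pos by simp
  also have "\<dots> = F v v * (F u u * F v v - (F u v)\<^sup>2)"
    by (subst sym_form_square[OF F u v]) (simp add: power2_eq_square algebra_simps)
  finally show ?thesis using p by (simp add: zero_le_mult_iff)
next
  case True
  have "F u v = 0"
  proof (rule ccontr)
    assume n: "F u v \<noteq> 0"
    define b where "b = - (F u u + 1) / (2 * F u v)"
    have "0 \<le> F (lincomb 1 u b v) (lincomb 1 u b v)"
      using u v pos by simp
    also have "\<dots> = -1"
      by (subst sym_form_square[OF F u v]) (use n True in \<open>simp add: b_def field_simps\<close>)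
    finally show False by simp
  qed
  then show ?thesis using True by simp
qed

text \<open>
  Applied to \<open>M A - B\<close> this is the Euler-Lagrange equation of a maximiser of \<open>B\<close> relative to \<open>A\<close>.
\<close>

lemma null_vector_form:
  assumes F: "sym_form S F" and pos: "\<And>u. u \<in> S \<Longrightarrow> 0 \<le> F u u"
    and u: "u \<in> S" and v: "v \<in> S" and "F u u = 0"
  shows "F u v = 0"
  using Cauchy_Schwarz_form[OF F pos u v] assms(5) by simp

end

text \<open>
  The energy \<open>A\<close> is only positive semidefinite, since functions that agree almost everywhere are
  not identified.
\<close>

locale energy_space = function_space S for S :: "('a \<Rightarrow> real) set" +
  fixes A :: "('a \<Rightarrow> real) \<Rightarrow> ('a \<Rightarrow> real) \<Rightarrow> real"
  assumes A_form: "sym_form S A" and A_nonneg: "u \<in> S \<Longrightarrow> 0 \<le> A u u"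
begin

definition enorm :: "('a \<Rightarrow> real) \<Rightarrow> real" where "enorm u = sqrt (A u u)"

lemma enorm_nonneg [simp]: "u \<in> S \<Longrightarrow> 0 \<le> enorm u"
  by (simp add: enorm_def A_nonneg)

lemma enorm_square: "u \<in> S \<Longrightarrow> (enorm u)\<^sup>2 = A u u"
  by (simp add: enorm_def A_nonneg)

lemma A_le_nrm: "u \<in> S \<Longrightarrow> v \<in> S \<Longrightarrow> \<bar>A u v\<bar> \<le> enorm u * enorm v"
  using Cauchy_Schwarz_form[OF A_form A_nonneg, of u v]
  by (simp add: enorm_def flip: real_sqrt_mult) (metis real_sqrt_abs real_sqrt_le_mono)

lemma enorm_lincomb_le:
  assumes u: "u \<in> S" and v: "v \<in> S"
  shows "enorm (lincomb a u b v) \<le> \<bar>a\<bar> * enorm u + \<bar>b\<bar> * enorm v"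
proof (rule power2_le_imp_le)
  have "(enorm (lincomb a u b v))\<^sup>2 = a\<^sup>2 * (enorm u)\<^sup>2 + 2 * (a * b * A u v) + b\<^sup>2 * (enorm v)\<^sup>2"
    using u v by (simp add: enorm_square sym_form_square[OF A_form])
  also have "a * b * A u v \<le> \<bar>a\<bar> * \<bar>b\<bar> * (enorm u * enorm v)"
  proof -
    have "a * b * A u v \<le> \<bar>a * b * A u v\<bar>" by simp
    also have "\<dots> = \<bar>a\<bar> * \<bar>b\<bar> * \<bar>A u v\<bar>" by (simp add: abs_mult)
    also have "\<dots> \<le> \<bar>a\<bar> * \<bar>b\<bar> * (enorm u * enorm v)" by (intro mult_left_mono A_le_nrm u v) simp
    finally show ?thesis .
  qed
  also have "a\<^sup>2 * (enorm u)\<^sup>2 + 2 * (\<bar>a\<bar> * \<bar>b\<bar> * (enorm u * enorm v)) + b\<^sup>2 * (enorm v)\<^sup>2 =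
      (\<bar>a\<bar> * enorm u + \<bar>b\<bar> * enorm v)\<^sup>2"
    by (simp add: power2_sum power_mult_distrib)
  finally show "(enorm (lincomb a u b v))\<^sup>2 \<le> (\<bar>a\<bar> * enorm u + \<bar>b\<bar> * enorm v)\<^sup>2" by simp
  show "0 \<le> \<bar>a\<bar> * enorm u + \<bar>b\<bar> * enorm v" using u v by simp
qed

end

section \<open>Maximisers of a relatively compact form\<close>

abbreviation fdiff :: "('a \<Rightarrow> real) \<Rightarrow> ('a \<Rightarrow> real) \<Rightarrow> 'a \<Rightarrow> real" where
  "fdiff u v \<equiv> lincomb 1 u (-1) v"

abbreviation sqdist ::
    "(('a \<Rightarrow> real) \<Rightarrow> ('a \<Rightarrow> real) \<Rightarrow> real) \<Rightarrow> ('a \<Rightarrow> real) \<Rightarrow> ('a \<Rightarrow> real) \<Rightarrow> real" where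
  "sqdist F u v \<equiv> F (fdiff u v) (fdiff u v)"

definition form_Cauchy :: "(('a \<Rightarrow> real) \<Rightarrow> ('a \<Rightarrow> real) \<Rightarrow> real) \<Rightarrow> (nat \<Rightarrow> 'a \<Rightarrow> real) \<Rightarrow> bool" where
  "form_Cauchy F x \<longleftrightarrow> (\<forall>\<epsilon>>0. \<exists>N. \<forall>m\<ge>N. \<forall>n\<ge>N. sqdist F (x m) (x n) < \<epsilon>)"

definition form_converges ::
    "(('a \<Rightarrow> real) \<Rightarrow> ('a \<Rightarrow> real) \<Rightarrow> real) \<Rightarrow> (nat \<Rightarrow> 'a \<Rightarrow> real) \<Rightarrow> ('a \<Rightarrow> real) \<Rightarrow> bool" where
  "form_converges F x v \<longleftrightarrow> (\<lambda>n. sqdist F (x n) v) \<longlonglongrightarrow> 0"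

lemma (in function_space) form_converges_left:
  assumes F: "sym_form S F" and pos: "\<And>u. u \<in> S \<Longrightarrow> 0 \<le> F u u"
    and x: "\<And>n. x n \<in> S" and v: "v \<in> S" and w: "w \<in> S" and conv: "form_converges F x v"
  shows "(\<lambda>n. F (x n) w) \<longlonglongrightarrow> F v w"
proof -
  have "(\<lambda>n. F (fdiff (x n) v) w) \<longlonglongrightarrow> 0"
  proof (rule Lim_null_comparison)
    show "(\<lambda>n. sqrt (sqdist F (x n) v * F w w)) \<longlonglongrightarrow> 0"
      using conv unfolding form_converges_def by (auto intro!: tendsto_eq_intros)
    show "eventually (\<lambda>n. norm (F (fdiff (x n) v) w) \<le>
        sqrt (sqdist F (x n) v * F w w)) sequentially"
      using Cauchy_Schwarz_form[OF F pos _ w] x v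
      by (intro always_eventually allI real_le_rsqrt) auto
  qed
  then have "(\<lambda>n. F (x n) w - F v w) \<longlonglongrightarrow> 0"
    using x v w by (simp add: sym_form_left[OF F])
  then show ?thesis using LIM_zero_iff by blast
qed

lemma (in function_space) form_converges_square:
  assumes F: "sym_form S F" and pos: "\<And>u. u \<in> S \<Longrightarrow> 0 \<le> F u u"
    and x: "\<And>n. x n \<in> S" and v: "v \<in> S" and conv: "form_converges F x v"
  shows "(\<lambda>n. F (x n) (x n)) \<longlonglongrightarrow> F v v"
proof -
  have "(\<lambda>n. sqdist F (x n) v + 2 * F (x n) v - F v v) \<longlonglongrightarrow> 0 + 2 * F v v - F v v"
    using conv form_converges_left[OF F pos x v v conv] unfolding form_converges_def
    by (intro tendsto_intros)
  then show ?thesis using x v by (simp add: sym_form_square[OF F])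
qed

text \<open>
  Every sequence of bounded energy has a subsequence that is Cauchy with respect to \<open>B\<close>: this is
  what compactness of \<open>B\<close> relative to \<open>A\<close> amounts to for a nonnegative form.
\<close>

locale compact_form = energy_space S A
  for S :: "('a \<Rightarrow> real) set" and A :: "('a \<Rightarrow> real) \<Rightarrow> ('a \<Rightarrow> real) \<Rightarrow> real" +
  fixes B :: "('a \<Rightarrow> real) \<Rightarrow> ('a \<Rightarrow> real) \<Rightarrow> real" and C :: real
  assumes B_form: "sym_form S B" and B_nonneg: "u \<in> S \<Longrightarrow> 0 \<le> B u u"
    and B_bound: "u \<in> S \<Longrightarrow> B u u \<le> C * A u u"
    and complete: "(\<And>n. x n \<in> S) \<Longrightarrow> form_Cauchy A x \<Longrightarrow> \<exists>v\<in>S. form_converges A x v"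
    and compact: "(\<And>n. x n \<in> S) \<Longrightarrow> (\<And>n. A (x n) (x n) \<le> 1) \<Longrightarrow>
        \<exists>r. strict_mono (r :: nat \<Rightarrow> nat) \<and> form_Cauchy B (x \<circ> r)"
begin

text \<open>
  The sum of two unit vectors cannot exceed the maximum. By the parallelogram identity the energy
  of their difference is therefore small as soon as both are almost maximal and their difference
  is small for \<open>B\<close>. So the subsequence that is Cauchy for \<open>B\<close> converges strongly in energy.
\<close>

lemma maximising_sequence:
  assumes M: "M > 0" and top: "\<And>w. w \<in> S \<Longrightarrow> B w w \<le> M * A w w"
    and x: "\<And>n. x n \<in> S" and unit: "\<And>n. A (x n) (x n) = 1" and lim: "(\<lambda>n. B (x n) (x n)) \<longlonglongrightarrow> M"
  obtains r v where "strict_mono (r :: nat \<Rightarrow> nat)" "v \<in> S" "form_converges A (x \<circ> r) v"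
    "A v v = 1" "B v v = M"
proof -
  obtain r where r: "strict_mono (r :: nat \<Rightarrow> nat)" "form_Cauchy B (x \<circ> r)"
    using compact[of x] x unit by auto
  define y where "y = x \<circ> r"
  have y [simp]: "y n \<in> S" and yu: "A (y n) (y n) = 1" for n using x unit by (simp_all add: y_def)
  have ylim: "(\<lambda>n. B (y n) (y n)) \<longlonglongrightarrow> M"
    using LIMSEQ_subseq_LIMSEQ[OF lim r(1)] by (simp add: y_def o_def)
  have par: "M * sqdist A (y m) (y n) \<le>
      2 * (M - B (y m) (y m)) + 2 * (M - B (y n) (y n)) + sqdist B (y m) (y n)" for m n
    using top[of "lincomb 1 (y m) 1 (y n)"]
    by (simp add: sym_form_square[OF A_form] sym_form_square[OF B_form] yu algebra_simps)
  have "form_Cauchy A y"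
    unfolding form_Cauchy_def
  proof (intro allI impI)
    fix \<epsilon> :: real assume "\<epsilon> > 0"
    define E where "E = M * \<epsilon>"
    have e: "E / 5 > 0" using M \<open>\<epsilon> > 0\<close> by (simp add: E_def)
    obtain N1 where N1: "\<And>m n. m \<ge> N1 \<Longrightarrow> n \<ge> N1 \<Longrightarrow> sqdist B (y m) (y n) < E / 5"
      using r(2) e unfolding form_Cauchy_def y_def by blast
    obtain N2 where N2: "\<And>n. n \<ge> N2 \<Longrightarrow> \<bar>B (y n) (y n) - M\<bar> < E / 5"
      using LIMSEQ_D[OF ylim e] by auto
    have "sqdist A (y m) (y n) < \<epsilon>" if "m \<ge> max N1 N2" "n \<ge> max N1 N2" for m n
    proof -
      have "M * sqdist A (y m) (y n) < E"
      proof -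
        have mn: "m \<ge> N1" "n \<ge> N1" "m \<ge> N2" "n \<ge> N2" using that by auto
        have comb: "x \<le> 2 * a + 2 * b + c \<Longrightarrow> c < E / 5 \<Longrightarrow> a < E / 5 \<Longrightarrow> b < E / 5 \<Longrightarrow>
            x < E" for x a b c :: real
          by linarith
        have "M - B (y m) (y m) < E / 5" "M - B (y n) (y n) < E / 5"
          using N2[OF mn(3)] N2[OF mn(4)] by (simp_all only: abs_less_iff) simp_all
        then show ?thesis using comb[OF par[of m n] N1[OF mn(1,2)]] by blast
      qed
      then show ?thesis using M by (simp add: E_def)
    qed
    then show "\<exists>N. \<forall>m\<ge>N. \<forall>n\<ge>N. sqdist A (y m) (y n) < \<epsilon>" by blast
  qed
  then obtain v where v: "v \<in> S" "form_converges A y v" using complete[of y] by auto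
  have cB: "form_converges B y v"
    unfolding form_converges_def
  proof (rule Lim_null_comparison)
    show "(\<lambda>n. C * sqdist A (y n) v) \<longlonglongrightarrow> 0"
      using v(2) unfolding form_converges_def by (auto intro!: tendsto_eq_intros)
    show "eventually (\<lambda>n. norm (sqdist B (y n) v) \<le> C * sqdist A (y n) v) sequentially"
      using v by (intro always_eventually allI) (simp add: B_bound B_nonneg)
  qed
  have "(\<lambda>n. A (y n) (y n)) \<longlonglongrightarrow> A v v" by (rule form_converges_square[OF A_form A_nonneg y v])
  then have 1: "A v v = 1" by (simp add: yu LIMSEQ_const_iff)
  have "(\<lambda>n. B (y n) (y n)) \<longlonglongrightarrow> B v v" by (rule form_converges_square[OF B_form B_nonneg y v(1) cB])
  then have 2: "B v v = M" using ylim LIMSEQ_unique by blast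
  show ?thesis using that[OF r(1) v(1)] v(2) 1 2 by (simp add: y_def)
qed

lemma maximiser_eigenvector:
  assumes top: "\<And>w. w \<in> S \<Longrightarrow> B w w \<le> M * A w w" and v: "v \<in> S" and "B v v = M * A v v" and w: "w \<in> S"
  shows "B v w = M * A v w"
proof -
  have "sym_form S (\<lambda>u w. M * A u w - B u w)"
    unfolding sym_form_def
  proof (intro conjI ballI allI)
    show "M * A u w - B u w = M * A w u - B w u" if "u \<in> S" "w \<in> S" for u w
      using that by (simp add: sym_form_commute[OF A_form, of u w] sym_form_commute[OF B_form, of u
          w])
  qed (simp add: sym_form_left[OF A_form] sym_form_left[OF B_form] algebra_simps)
  from null_vector_form[OF this _ v w] assms show ?thesis by simp
qed

lemma top_eigenvalue:
  assumes nontrivial: "u \<in> S" "B u u > 0"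
  obtains M v where "M > 0" "v \<in> S" "A v v = 1" "\<And>w. w \<in> S \<Longrightarrow> B v w = M * A v w"
    "\<And>w. w \<in> S \<Longrightarrow> B w w \<le> M * A w w"
proof -
  define R where "R = {B w w | w. w \<in> S \<and> A w w = 1}"
  define M where "M = Sup R"
  have Apos: "A w w > 0" if "w \<in> S" "B w w > 0" for w
    using B_bound[OF that(1)] that A_nonneg[OF that(1)] by (cases "A w w = 0") auto
  have scale: "F (lincomb (1 / enorm w) w 0 w) (lincomb (1 / enorm w) w 0 w) = F w w / A w w"
    if "sym_form S F" "w \<in> S" for F w
    using that by (simp add: sym_form_square power_divide enorm_square)
  have inR: "B w w / A w w \<in> R" if "w \<in> S" "A w w > 0" for w
    unfolding R_def using scale[OF A_form that(1)] scale[OF B_form that(1)] that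
    by (intro CollectI exI[of _ "lincomb (1 / enorm w) w 0 w"]) simp
  have bdd: "bdd_above R"
    using B_bound by (intro bdd_aboveI[of _ C]) (force simp: R_def)
  have top: "B w w \<le> M * A w w" if w: "w \<in> S" for w
  proof (cases "A w w = 0")
    case True
    then show ?thesis using B_bound[OF w] by simp
  next
    case False
    then have p: "A w w > 0" using A_nonneg[OF w] by simp
    have "B w w / A w w \<le> M" unfolding M_def by (rule cSup_upper[OF inR[OF w p] bdd])
    then show ?thesis using p by (simp add: divide_le_eq)
  qed
  have ne: "R \<noteq> {}" using inR[OF nontrivial(1) Apos[OF nontrivial]] by auto
  have Mpos: "M > 0"
    using top[OF nontrivial(1)] Apos[OF nontrivial] nontrivial(2)
        by (smt (verit) mult_nonpos_nonneg)
  have "\<exists>w. w \<in> S \<and> A w w = 1 \<and> M - inverse (real (Suc n)) < B w w" for n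
  proof -
    have "M - inverse (real (Suc n)) < Sup R" by (simp add: M_def)
    then obtain z where "z \<in> R" "M - inverse (real (Suc n)) < z" using less_cSup_iff[OF ne bdd]
        by blast
    then show ?thesis by (auto simp: R_def)
  qed
  then obtain x where x: "\<And>n. x n \<in> S" "\<And>n. A (x n) (x n) = 1"
    "\<And>n. M - inverse (real (Suc n)) < B (x n) (x n)" by metis
  have lim: "(\<lambda>n. B (x n) (x n)) \<longlonglongrightarrow> M"
  proof (rule tendsto_sandwich)
    show "(\<lambda>n. M - inverse (real (Suc n))) \<longlonglongrightarrow> M"
      using tendsto_diff[OF tendsto_const LIMSEQ_inverse_real_of_nat, of M] by simp
    show "(\<lambda>n. M) \<longlonglongrightarrow> M" by simp
    show "\<forall>\<^sub>F n in sequentially. B (x n) (x n) \<le> M" using top[OF x(1)] x(2) by simp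
    show "\<forall>\<^sub>F n in sequentially. M - inverse (real (Suc n)) \<le> B (x n) (x n)" 
      using x(3) by (intro always_eventually allI less_imp_le)
  qed
  obtain v where v: "v \<in> S" "A v v = 1" "B v v = M"
    using maximising_sequence[OF Mpos top x(1,2) lim] by metis
  show ?thesis
    using that[OF Mpos v(1,2) maximiser_eigenvector[OF top v(1)] top] v by simp
qed

text \<open>
  If there is no gap, unit vectors orthogonal to \<open>v\<close> form a maximising sequence; its limit is an
  eigenvector orthogonal to \<open>v\<close>.
\<close>

lemma simple_or_second_eigenvector:
  assumes M: "M > 0" and top: "\<And>w. w \<in> S \<Longrightarrow> B w w \<le> M * A w w" and v: "v \<in> S"
  shows "(\<exists>g>0. \<forall>w\<in>S. A v w = 0 \<longrightarrow> B w w \<le> (M - g) * A w w) \<or>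
         (\<exists>w\<in>S. A w w = 1 \<and> A v w = 0 \<and> (\<forall>z\<in>S. B w z = M * A w z))"
proof (rule disjCI)
  assume no: "\<not> (\<exists>w\<in>S. A w w = 1 \<and> A v w = 0 \<and> (\<forall>z\<in>S. B w z = M * A w z))"
  show "\<exists>g>0. \<forall>w\<in>S. A v w = 0 \<longrightarrow> B w w \<le> (M - g) * A w w"
  proof (rule ccontr)
    assume nogap: "\<not> ?thesis"
    have "\<exists>w. w \<in> S \<and> A w w = 1 \<and> A v w = 0 \<and> M - inverse (real (Suc n)) \<le> B w w" for n
    proof -
      obtain w where w: "w \<in> S" "A v w = 0" "B w w > (M - inverse (real (Suc n))) * A w w"
        using nogap by (metis inverse_positive_iff_positive not_le of_nat_0_less_iff zero_less_Suc)
      have p: "A w w > 0"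
        using w B_bound[OF w(1)] A_nonneg[OF w(1)] by (cases "A w w = 0") auto
      define z where "z = lincomb (1 / enorm w) w 0 w"
      have "z \<in> S" "A z z = 1" "A v z = 0" "B z z = B w w / A w w"
        using w v p unfolding z_def
        by (simp_all add: sym_form_square[OF A_form, OF w(1,1)] sym_form_square[OF B_form, OF
            w(1,1)]
            sym_form_right[OF A_form] power_divide enorm_square)
      moreover have "M - inverse (real (Suc n)) \<le> B w w / A w w" using w(3) p
          by (simp add: le_divide_eq)
      ultimately show ?thesis by metis
    qed
    then obtain x where x: "\<And>n. x n \<in> S" "\<And>n. A (x n) (x n) = 1" "\<And>n. A v (x n) = 0"
      "\<And>n. M - inverse (real (Suc n)) \<le> B (x n) (x n)" by metis
    have lim: "(\<lambda>n. B (x n) (x n)) \<longlonglongrightarrow> M"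
    proof (rule tendsto_sandwich)
      show "(\<lambda>n. M - inverse (real (Suc n))) \<longlonglongrightarrow> M"
        using tendsto_diff[OF tendsto_const LIMSEQ_inverse_real_of_nat, of M] by simp
      show "(\<lambda>n. M) \<longlonglongrightarrow> M" by simp
      show "\<forall>\<^sub>F n in sequentially. B (x n) (x n) \<le> M" using top[OF x(1)] x(2) by simp
      show "\<forall>\<^sub>F n in sequentially. M - inverse (real (Suc n)) \<le> B (x n) (x n)" 
        using x(4) by (intro always_eventually allI)
    qed
    obtain r w where w: "strict_mono (r :: nat \<Rightarrow> nat)" "w \<in> S" "form_converges A (x \<circ> r) w" "A w w =
        1" "B w w = M"
      using maximising_sequence[OF M top x(1,2) lim] by metis
    have "(\<lambda>n. A ((x \<circ> r) n) v) \<longlonglongrightarrow> A w v"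
      by (rule form_converges_left[OF A_form A_nonneg _ w(2) v w(3)]) (use x(1) in auto)
    then have "A v w = 0"
      using x v w by (simp add: sym_form_commute[OF A_form, of _ v] LIMSEQ_const_iff)
    moreover have "B w z = M * A w z" if "z \<in> S" for z
      using maximiser_eigenvector[OF top w(2) _ that] w by simp
    ultimately show False using no w by blast
  qed
qed

end

section \<open>Perturbation of a simple top eigenvalue\<close>

text \<open>
  The energy \<open>A\<close> is fixed. The forms \<open>B s\<close> are differentiable in \<open>s\<close> with Lipschitz derivative
  \<open>B1 s\<close>, all bounds being relative to the energy norm, and \<open>\<mu> s\<close> is the largest eigenvalue of
  \<open>B s\<close> relative to \<open>A\<close>, with unit eigenvector \<open>e s\<close> and a gap on the orthogonal complement of
  \<open>e s\<close>.
\<close>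

locale eigenvalue_family = energy_space S A
  for S :: "('a \<Rightarrow> real) set" and A :: "('a \<Rightarrow> real) \<Rightarrow> ('a \<Rightarrow> real) \<Rightarrow> real" +
  fixes I :: "real set" and B B1 :: "real \<Rightarrow> ('a \<Rightarrow> real) \<Rightarrow> ('a \<Rightarrow> real) \<Rightarrow> real"
    and C :: real and \<mu> :: "real \<Rightarrow> real" and e :: "real \<Rightarrow> 'a \<Rightarrow> real"
  assumes open_I: "open I"
    and B_form: "s \<in> I \<Longrightarrow> sym_form S (B s)"
    and B1_form: "s \<in> I \<Longrightarrow> sym_form S (B1 s)"
    and C_nonneg: "0 \<le> C"
    and B1_bound: "s \<in> I \<Longrightarrow> u \<in> S \<Longrightarrow> v \<in> S \<Longrightarrow> \<bar>B1 s u v\<bar> \<le> C * enorm u * enorm v"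
    and B1_lipschitz: "s \<in> I \<Longrightarrow> r \<in> I \<Longrightarrow> u \<in> S \<Longrightarrow> v \<in> S \<Longrightarrow>
          \<bar>B1 r u v - B1 s u v\<bar> \<le> C * \<bar>r - s\<bar> * enorm u * enorm v"
    and B_taylor: "s \<in> I \<Longrightarrow> r \<in> I \<Longrightarrow> u \<in> S \<Longrightarrow> v \<in> S \<Longrightarrow>
          \<bar>B r u v - B s u v - (r - s) * B1 s u v\<bar> \<le> C * (r - s)\<^sup>2 * enorm u * enorm v"
    and e_in [simp]: "s \<in> I \<Longrightarrow> e s \<in> S"
    and e_unit: "s \<in> I \<Longrightarrow> A (e s) (e s) = 1"
    and e_eigen: "s \<in> I \<Longrightarrow> v \<in> S \<Longrightarrow> B s (e s) v = \<mu> s * A (e s) v"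
    and mu_top: "s \<in> I \<Longrightarrow> v \<in> S \<Longrightarrow> B s v v \<le> \<mu> s * A v v"
    and gap: "s \<in> I \<Longrightarrow> \<exists>g>0. \<forall>v\<in>S. A (e s) v = 0 \<longrightarrow> B s v v \<le> (\<mu> s - g) * A v v"
begin

lemma enorm_e [simp]: "s \<in> I \<Longrightarrow> enorm (e s) = 1"
  by (simp add: enorm_def e_unit)

text \<open>
  The component of the eigenvector \<open>e r\<close> that is orthogonal to \<open>e s\<close>.
\<close>

definition dev :: "real \<Rightarrow> real \<Rightarrow> 'a \<Rightarrow> real" where
  "dev s r = lincomb 1 (e r) (- A (e r) (e s)) (e s)"

lemma dev_in [simp]: "s \<in> I \<Longrightarrow> r \<in> I \<Longrightarrow> dev s r \<in> S"
  by (simp add: dev_def)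

lemma e_decomp: "e r = lincomb (A (e r) (e s)) (e s) 1 (dev s r)"
  by (simp add: dev_def lincomb_def)

lemma dev_orth: "s \<in> I \<Longrightarrow> r \<in> I \<Longrightarrow> A (e s) (dev s r) = 0"
  by (simp add: dev_def sym_form_right[OF A_form] e_unit sym_form_commute[OF A_form, of "e s"
      "e r"])

lemma dev_norm: 
  assumes "s \<in> I" "r \<in> I" shows "(A (e r) (e s))\<^sup>2 + (enorm (dev s r))\<^sup>2 = 1"
proof -
  have "1 = A (lincomb (A (e r) (e s)) (e s) 1 (dev s r)) (lincomb (A (e r) (e s)) (e s) 1 (dev s
      r))"
    using e_decomp[of r s] e_unit assms by metis
  then show ?thesis 
    using assms by (simp add: sym_form_square[OF A_form] dev_orth e_unit enorm_square)
qed

text \<open>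
  The values \<open>B r (e s) (e s) \<le> \<mu> r\<close> and \<open>B s (e r) (e r) \<le> \<mu> s\<close> bound \<open>\<mu> r - \<mu> s\<close> from both sides
  by first order expansions. In the second one the gap gains \<open>g \<bar>dev\<bar>\<^sup>2\<close>, and the two expansions
  differ only by a multiple of \<open>\<bar>r - s\<bar> \<bar>dev\<bar>\<close> and a quadratic remainder. So the deviation is of
  order \<open>\<bar>r - s\<bar>\<close>, and then the two bounds agree up to order \<open>(r - s)\<^sup>2\<close>.
\<close>

lemma first_order:
  assumes s: "s \<in> I"
  obtains D where "0 \<le> D"
    "\<And>r. r \<in> I \<Longrightarrow> enorm (dev s r) \<le> D * \<bar>r - s\<bar>"
    "\<And>r. r \<in> I \<Longrightarrow> \<bar>\<mu> r - \<mu> s - (r - s) * B1 s (e s) (e s)\<bar> \<le> D * (r - s)\<^sup>2"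
proof -
  obtain g where g: "g > 0" "\<And>v. v \<in> S \<Longrightarrow> A (e s) v = 0 \<Longrightarrow> B s v v \<le> (\<mu> s - g) * A v v"
    using gap[OF s] by blast
  define D where "D = 1 + 6 * C / g"
  have D1: "D \<ge> 1" using g C_nonneg by (simp add: D_def)
  have main: "enorm (dev s r) \<le> D * \<bar>r - s\<bar> \<and> 
       \<bar>\<mu> r - \<mu> s - (r - s) * B1 s (e s) (e s)\<bar> \<le> (4 * C * D + C) * (r - s)\<^sup>2" if r: "r \<in> I" for r
  proof -
    define h where "h = r - s"
    define c where "c = A (e r) (e s)"
    define w where "w = dev s r"
    define p where "p = enorm w"
    have wS [simp]: "w \<in> S" using s r by (simp add: w_def)
    have p0: "0 \<le> p" by (simp add: p_def)
    have c2: "c\<^sup>2 = 1 - p\<^sup>2" using dev_norm[OF s r] by (simp add: c_def p_def w_def)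
    have "p\<^sup>2 \<le> 1" using c2 zero_le_power2[of c] by linarith
    then have p1: "p \<le> 1" using abs_square_le_1[of p] by simp
    have "c\<^sup>2 \<le> 1" using c2 zero_le_power2[of p] by linarith
    then have c1: "\<bar>c\<bar> \<le> 1" using abs_square_le_1[of c] by simp
    have er: "e r = lincomb c (e s) 1 w" by (simp add: c_def w_def e_decomp[of r s, symmetric])
    have Aw: "A w w = p\<^sup>2" by (simp add: p_def enorm_square)
    have orth: "A (e s) w = 0" using s r by (simp add: w_def dev_orth)
    have "B s (e r) (e r) = c\<^sup>2 * \<mu> s + B s w w"
      unfolding er using s by (simp add: sym_form_square[OF B_form[OF s]] e_eigen orth e_unit)
    also have "\<dots> \<le> c\<^sup>2 * \<mu> s + (\<mu> s - g) * p\<^sup>2" using g(2)[OF wS orth] Aw by simp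
    also have "\<dots> = \<mu> s - g * p\<^sup>2" unfolding c2 by (simp add: algebra_simps)
    finally have up0: "B s (e r) (e r) \<le> \<mu> s - g * p\<^sup>2" .
    have mur: "\<mu> r = B r (e r) (e r)" using r by (simp add: e_eigen e_unit)
    have mus: "\<mu> s = B s (e s) (e s)" using s by (simp add: e_eigen e_unit)
    have tr: "\<bar>B r (e r) (e r) - B s (e r) (e r) - h * B1 s (e r) (e r)\<bar> \<le> C * h\<^sup>2"
      using B_taylor[OF s r, of "e r" "e r"] s r by (simp add: h_def)
    have ts: "\<bar>B r (e s) (e s) - B s (e s) (e s) - h * B1 s (e s) (e s)\<bar> \<le> C * h\<^sup>2"
      using B_taylor[OF s r, of "e s" "e s"] s r by (simp add: h_def)
    have low: "\<mu> r \<ge> B r (e s) (e s)" using mu_top[OF r, of "e s"] s by (simp add: e_unit)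
    have b1: "B1 s (e r) (e r) = c\<^sup>2 * B1 s (e s) (e s) + 2 * c * B1 s (e s) w + B1 s w w"
      unfolding er using s by (simp add: sym_form_square[OF B1_form[OF s]])
    have x1: "\<bar>p\<^sup>2 * B1 s (e s) (e s)\<bar> \<le> p * C"
    proof -
      have "\<bar>B1 s (e s) (e s)\<bar> \<le> C" using B1_bound[OF s, of "e s" "e s"] s by simp
      moreover have "p\<^sup>2 \<le> p" using p0 p1 by (simp add: power2_eq_square mult_left_le)
      ultimately show ?thesis using p0 by (simp add: abs_mult mult_mono)
    qed
    have x2: "\<bar>2 * c * B1 s (e s) w\<bar> \<le> 2 * (p * C)"
    proof -
      have "\<bar>B1 s (e s) w\<bar> \<le> C * p" using B1_bound[OF s, of "e s" w] s by (simp add: p_def)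
      then have "\<bar>c\<bar> * \<bar>B1 s (e s) w\<bar> \<le> 1 * (C * p)" using c1 by (intro mult_mono) auto
      then show ?thesis by (simp add: abs_mult mult_ac)
    qed
    have x3: "\<bar>B1 s w w\<bar> \<le> p * C"
    proof -
      have "\<bar>B1 s w w\<bar> \<le> C * p * p" using B1_bound[OF s, of w w] by (simp add: p_def)
      also have "\<dots> \<le> C * p * 1" using p0 p1 C_nonneg by (intro mult_left_mono) auto
      finally show ?thesis by (simp add: mult_ac)
    qed
    have "B1 s (e r) (e r) - B1 s (e s) (e s) = - (p\<^sup>2 * B1 s (e s) (e s)) + 2 * c * B1 s (e s) w +
        B1 s w w"
      unfolding b1 c2 by (simp add: algebra_simps)
    then have bd: "\<bar>B1 s (e r) (e r) - B1 s (e s) (e s)\<bar> \<le> 4 * (p * C)"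
      using x1 x2 x3 by linarith
    have hbd: "\<bar>h * (B1 s (e r) (e r) - B1 s (e s) (e s))\<bar> \<le> \<bar>h\<bar> * (4 * (p * C))"
      unfolding abs_mult using bd by (intro mult_left_mono) auto
    have hsplit: "h * (B1 s (e r) (e r) - B1 s (e s) (e s)) = h * B1 s (e r) (e r) -
        h * B1 s (e s) (e s)"
      by (simp add: algebra_simps)
    have est: "g * p\<^sup>2 \<le> 4 * (C * (\<bar>h\<bar> * p)) + 2 * (C * h\<^sup>2)"
      using up0 tr ts low hbd mur mus hsplit by (simp add: mult_ac) 
    \<comment> \<open>Unless the bound is trivial, both error terms in \<open>est\<close> are multiples of \<open>\<bar>h\<bar> p\<close>, and \<open>p\<close>
        cancels.\<close>
    have pD: "p \<le> D * \<bar>h\<bar>"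
    proof (cases "p \<le> \<bar>h\<bar>")
      case True
      also have "\<bar>h\<bar> \<le> D * \<bar>h\<bar>" using mult_right_mono[OF D1, of "\<bar>h\<bar>"] by simp
      finally show ?thesis .
    next
      case False
      have "C * h\<^sup>2 \<le> C * (\<bar>h\<bar> * p)"
      proof (rule mult_left_mono[OF _ C_nonneg])
        have "h\<^sup>2 = \<bar>h\<bar> * \<bar>h\<bar>" by (simp add: power2_eq_square)
        also have "\<dots> \<le> \<bar>h\<bar> * p" using False by (intro mult_left_mono) auto
        finally show "h\<^sup>2 \<le> \<bar>h\<bar> * p" .
      qed
      then have "(g * p) * p \<le> (6 * C * \<bar>h\<bar>) * p" using est
          by (simp add: power2_eq_square algebra_simps)
      then have "g * p \<le> 6 * C * \<bar>h\<bar>" using False by (simp add: mult_le_cancel_right)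
      then have "p \<le> 6 * C / g * \<bar>h\<bar>" using g by (simp add: field_simps)
      also have "\<dots> \<le> D * \<bar>h\<bar>" by (intro mult_right_mono) (auto simp: D_def)
      finally show ?thesis .
    qed
    have h2: "\<bar>h\<bar> * (4 * (p * C)) \<le> 4 * C * D * h\<^sup>2"
    proof -
      have "\<bar>h\<bar> * (4 * (p * C)) = (4 * C * \<bar>h\<bar>) * p" by simp
      also have "\<dots> \<le> (4 * C * \<bar>h\<bar>) * (D * \<bar>h\<bar>)" using pD C_nonneg by (intro mult_left_mono) auto
      also have "\<dots> = 4 * C * D * h\<^sup>2" by (simp add: power2_eq_square)
      finally show ?thesis .
    qed
    have CD: "0 \<le> 4 * C * D * h\<^sup>2" using C_nonneg D1 by simp
    have gp: "0 \<le> g * p\<^sup>2" using g by simp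
    have "\<bar>\<mu> r - \<mu> s - h * B1 s (e s) (e s)\<bar> \<le> 4 * C * D * h\<^sup>2 + C * h\<^sup>2"
      using up0 tr ts low hbd mur mus hsplit h2 CD gp by linarith
    then show ?thesis using pD by (simp add: h_def p_def w_def algebra_simps)
  qed
  show ?thesis
  proof (rule that[of "D + 4 * C * D + C"])
    show "0 \<le> D + 4 * C * D + C" using D1 C_nonneg by simp
    fix r assume r: "r \<in> I"
    have "D * \<bar>r - s\<bar> \<le> (D + 4 * C * D + C) * \<bar>r - s\<bar>" using D1 C_nonneg
        by (intro mult_right_mono) auto
    then show "enorm (dev s r) \<le> (D + 4 * C * D + C) * \<bar>r - s\<bar>" using main[OF r] by linarith
    have "(4 * C * D + C) * (r - s)\<^sup>2 \<le> (D + 4 * C * D + C) * (r - s)\<^sup>2" using D1 C_nonneg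
        by (intro mult_right_mono) auto
    then show "\<bar>\<mu> r - \<mu> s - (r - s) * B1 s (e s) (e s)\<bar> \<le> (D + 4 * C * D + C) * (r - s)\<^sup>2"
        using main[OF r] by linarith
  qed
qed

lemma eigenvalue_has_derivative:
  assumes s: "s \<in> I"
  shows "(\<mu> has_real_derivative B1 s (e s) (e s)) (at s)"
proof -
  obtain D where D: "0 \<le> D"
    "\<And>r. r \<in> I \<Longrightarrow> \<bar>\<mu> r - \<mu> s - (r - s) * B1 s (e s) (e s)\<bar> \<le> D * (r - s)\<^sup>2"
    using first_order[OF s] by metis
  have "((\<lambda>r. (\<mu> r - \<mu> s) / (r - s) - B1 s (e s) (e s)) \<longlongrightarrow> 0) (at s)"
  proof (rule Lim_null_comparison)
    show "((\<lambda>r. D * \<bar>r - s\<bar>) \<longlongrightarrow> 0) (at s)"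
      by (auto intro!: tendsto_eq_intros)
    have "eventually (\<lambda>r. r \<in> I) (at s)" using open_I s by (simp add: eventually_at_in_open')
    moreover have "eventually (\<lambda>r. r \<noteq> s) (at s)" by (simp add: eventually_at_filter)
    ultimately show "eventually (\<lambda>r. norm ((\<mu> r - \<mu> s) / (r - s) - B1 s (e s) (e s)) \<le>
        D * \<bar>r - s\<bar>) (at s)"
    proof eventually_elim
      case (elim r)
      have "(\<mu> r - \<mu> s) / (r - s) - B1 s (e s) (e s) = (\<mu> r - \<mu> s - (r -
          s) * B1 s (e s) (e s)) / (r - s)"
        using elim by (simp add: field_simps)
      also have "norm \<dots> = \<bar>\<mu> r - \<mu> s - (r - s) * B1 s (e s) (e s)\<bar> / \<bar>r - s\<bar>" by simp
      also have "\<dots> \<le> D * (r - s)\<^sup>2 / \<bar>r - s\<bar>" using D(2)[OF elim(1)]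
          by (intro divide_right_mono) auto
      also have "\<dots> = D * \<bar>r - s\<bar>" using elim by (simp add: power2_eq_square field_simps abs_if)
      finally show ?case .
    qed
  qed
  then show ?thesis
    unfolding has_field_derivative_iff using LIM_zero_iff by blast
qed

text \<open>
  The eigenvector is rescaled to \<open>f r = e t + w r\<close> with \<open>w r\<close> orthogonal to \<open>e t\<close>. Subtracting the
  eigenvalue equations at \<open>r\<close> and \<open>t\<close> shows that the quotient \<open>y r = w r / (r - t)\<close> solves the
  linearised equation \<open>\<mu> A (y r) v - B (y r) v = B1 (e t) v\<close> for \<open>v\<close> orthogonal to \<open>e t\<close>, up to an
  error of order \<open>r - t\<close>. The left side is coercive by the gap. Hence two such quotients are close
  to each other and \<open>\<phi> r = B1 (e t) (y r)\<close> has a limit \<open>L\<close>; the choice \<open>v = y r\<close> shows \<open>L \<ge> 0\<close>.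
  Expanding \<open>B1 r (f r) (f r)\<close> then gives the derivative \<open>d + 2 L\<close>.
\<close>

lemma second_order:
  assumes t: "t \<in> I" and d: "((\<lambda>r. B1 r (e t) (e t)) has_real_derivative d) (at t)"
  shows "\<exists>L\<ge>0. ((\<lambda>r. B1 r (e r) (e r)) has_real_derivative d + 2 * L) (at t)"
proof -
  obtain D where D: "0 \<le> D"
    "\<And>r. r \<in> I \<Longrightarrow> enorm (dev t r) \<le> D * \<bar>r - t\<bar>"
    "\<And>r. r \<in> I \<Longrightarrow> \<bar>\<mu> r - \<mu> t - (r - t) * B1 t (e t) (e t)\<bar> \<le> D * (r - t)\<^sup>2"
    using first_order[OF t] by blast
  obtain g where g: "g > 0" "\<And>v. v \<in> S \<Longrightarrow> A (e t) v = 0 \<Longrightarrow> B t v v \<le> (\<mu> t - g) * A v v"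
    using gap[OF t] by blast
  define c where "c r = A (e r) (e t)" for r
  define f where "f r = lincomb (1 / c r) (e r) 0 (e t)" for r
  define w where "w r = lincomb (1 / c r) (dev t r) 0 (e t)" for r
  define y where "y r = lincomb (1 / (r - t)) (w r) 0 (e t)" for r
  define J where "J = {r \<in> I. r \<noteq> t \<and> D * \<bar>r - t\<bar> \<le> 1 / 2}"
  have JI: "r \<in> I" "r \<noteq> t" "D * \<bar>r - t\<bar> \<le> 1 / 2" if "r \<in> J" for r using that by (auto simp: J_def)
  have evJ: "eventually (\<lambda>r. r \<in> J) (at t)"
  proof -
    have "((\<lambda>r. D * \<bar>r - t\<bar>) \<longlongrightarrow> 0) (at t)" by (auto intro!: tendsto_eq_intros)
    then have "eventually (\<lambda>r. D * \<bar>r - t\<bar> < 1 / 2) (at t)" by (rule order_tendstoD) simp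
    moreover have "eventually (\<lambda>r. r \<in> I) (at t)" using open_I t
        by (simp add: eventually_at_in_open')
    moreover have "eventually (\<lambda>r. r \<noteq> t) (at t)" by (simp add: eventually_at_filter)
    ultimately show ?thesis by eventually_elim (simp add: J_def)
  qed
  have wS [simp]: "w r \<in> S" and fS [simp]: "f r \<in> S" and yS [simp]: "y r \<in> S" if "r \<in> J" for r
    using JI[OF that] t by (auto simp: w_def f_def y_def)
  have csq: "3 / 4 \<le> (c r)\<^sup>2" "(c r)\<^sup>2 \<le> 1" "1 - (c r)\<^sup>2 \<le> D\<^sup>2 * (r - t)\<^sup>2" if r: "r \<in> J" for r
  proof -
    have "enorm (dev t r) \<le> D * \<bar>r - t\<bar>" "0 \<le> enorm (dev t r)" using D(2) JI[OF r] t by auto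
    then have a: "(enorm (dev t r))\<^sup>2 \<le> (D * \<bar>r - t\<bar>)\<^sup>2" and b: "(D * \<bar>r - t\<bar>)\<^sup>2 \<le> (1 / 2)\<^sup>2"
      using JI(3)[OF r] by (auto intro!: power_mono simp: D(1))
    have e: "(c r)\<^sup>2 + (enorm (dev t r))\<^sup>2 = 1" using dev_norm[OF t JI(1)[OF r]]
        by (simp add: c_def)
    show "3 / 4 \<le> (c r)\<^sup>2" using a b e by (simp add: power_divide)
    show "(c r)\<^sup>2 \<le> 1" using e zero_le_power2[of "enorm (dev t r)"] by linarith
    show "1 - (c r)\<^sup>2 \<le> D\<^sup>2 * (r - t)\<^sup>2" using a e by (simp add: power_mult_distrib)
  qed
  have c0: "c r \<noteq> 0" if "r \<in> J" for r using csq(1)[OF that] by auto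
  have cinv: "\<bar>1 / c r\<bar> \<le> 2" if "r \<in> J" for r
  proof -
    have "(1/2)\<^sup>2 \<le> (c r)\<^sup>2" using csq(1)[OF that] by (simp add: power_divide)
    then have "1 / 2 \<le> \<bar>c r\<bar>" by (simp add: abs_le_square_iff[symmetric])
    then show ?thesis by (simp add: divide_le_eq)
  qed
  have fw: "f r = lincomb 1 (e t) 1 (w r)" if "r \<in> J" for r
    using c0[OF that] by (auto simp: f_def w_def dev_def lincomb_def c_def fun_eq_iff field_simps)
  have worth: "A (e t) (w r) = 0" if "r \<in> J" for r
    using JI[OF that] t by (simp add: w_def sym_form_right[OF A_form] dev_orth)
  have yorth: "A (e t) (y r) = 0" if "r \<in> J" for r
    using that t worth[OF that] JI[OF that] by (simp add: y_def sym_form_right[OF A_form])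
  have nscale: "enorm (lincomb a u 0 v) = \<bar>a\<bar> * enorm u" if "u \<in> S" "v \<in> S" for a u v
    using that by (simp add: enorm_def sym_form_square[OF A_form] real_sqrt_mult)
  have nw: "enorm (w r) \<le> 2 * D * \<bar>r - t\<bar>" if "r \<in> J" for r
  proof -
    have "enorm (w r) = \<bar>1 / c r\<bar> * enorm (dev t r)" using JI[OF that] t by (simp add: w_def nscale)
    also have "\<dots> \<le> 2 * (D * \<bar>r - t\<bar>)"
      using cinv[OF that] D(2)[OF JI(1)[OF that]] JI[OF that] t by (intro mult_mono) auto
    finally show ?thesis by simp
  qed
  have nw1: "enorm (w r) \<le> 1" if "r \<in> J" for r using nw[OF that] JI(3)[OF that] by simp
  have ny: "enorm (y r) \<le> 2 * D" if "r \<in> J" for r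
    using nw[OF that] JI[OF that] t by (simp add: y_def nscale that divide_le_eq)
  have nf: "enorm (f r) \<le> 2" if "r \<in> J" for r
    using cinv[OF that] JI[OF that] t by (simp add: f_def nscale)
  \<comment> \<open>The contributions to \<open>K\<close>: the Taylor remainder gives \<open>2 C\<close>, the form \<open>B1\<close> at \<open>w r\<close> gives
      \<open>2 C D\<close>, and the change of the eigenvalue gives \<open>2 C D + D\<close>.\<close>
  define K where "K = 2 * C + 4 * C * D + D"
  have K0: "0 \<le> K" using C_nonneg D by (simp add: K_def)
  have key: "\<bar>\<mu> t * A (y r) v - B t (y r) v - B1 t (e t) v\<bar> \<le> K * \<bar>r - t\<bar> * enorm v"
    if r: "r \<in> J" and v: "v \<in> S" and o: "A (e t) v = 0" for r v
  proof -
    define h where "h = r - t"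
    note rI = JI(1)[OF r]
    have h0: "h \<noteq> 0" using JI(2)[OF r] by (simp add: h_def)
    have eq: "B r (f r) v = \<mu> r * A (f r) v"
      using rI t v by (simp add: f_def sym_form_left[OF B_form] sym_form_left[OF A_form] e_eigen)
    have Af: "A (f r) v = A (w r) v"
      using fw[OF r] r t v o by (simp add: sym_form_left[OF A_form])
    have Bf: "B t (f r) v = B t (w r) v"
      using fw[OF r] r t v o by (simp add: sym_form_left[OF B_form] e_eigen)
    have B1f: "B1 t (f r) v = B1 t (e t) v + B1 t (w r) v"
      using fw[OF r] r t v o by (simp add: sym_form_left[OF B1_form])
    have v0: "0 \<le> enorm v" using v by simp
    have "\<bar>B r (f r) v - B t (f r) v - h * B1 t (f r) v\<bar> \<le> C * h\<^sup>2 * enorm (f r) * enorm v"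
      unfolding h_def using t rI r v by (intro B_taylor) auto
    also have "\<dots> \<le> C * h\<^sup>2 * 2 * enorm v"
      using nf[OF r] C_nonneg v0 r by (intro mult_right_mono mult_left_mono) auto
    finally have e1: "\<bar>\<mu> r * A (w r) v - B t (w r) v - h * B1 t (e t) v - h * B1 t (w r) v\<bar> \<le>
        2 * C * h\<^sup>2 * enorm v"
      unfolding eq Af Bf B1f by (simp add: algebra_simps)
    have Aw: "\<bar>A (w r) v\<bar> \<le> 2 * D * \<bar>h\<bar> * enorm v"
      using order.trans[OF A_le_nrm mult_right_mono[OF nw[OF r] v0]] r v by (simp add: h_def)
    have e2: "\<bar>h * B1 t (w r) v\<bar> \<le> 2 * C * D * h\<^sup>2 * enorm v"
    proof -
      have "\<bar>B1 t (w r) v\<bar> \<le> C * enorm (w r) * enorm v" using t r v by (intro B1_bound) auto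
      also have "\<dots> \<le> C * (2 * D * \<bar>h\<bar>) * enorm v"
        using nw[OF r] C_nonneg v0 by (intro mult_right_mono mult_left_mono) (auto simp: h_def)
      finally have "\<bar>h\<bar> * \<bar>B1 t (w r) v\<bar> \<le> \<bar>h\<bar> * (C * (2 * D * \<bar>h\<bar>) * enorm v)"
          by (intro mult_left_mono) auto
      also have "\<dots> = 2 * C * D * (\<bar>h\<bar> * \<bar>h\<bar>) * enorm v" by (simp add: mult_ac)
      finally show ?thesis by (simp add: abs_mult power2_eq_square)
    qed
    have "\<bar>\<mu> r - \<mu> t\<bar> \<le> \<bar>h\<bar> * (C + 1 / 2)"
    proof -
      have "\<bar>B1 t (e t) (e t)\<bar> \<le> C" using B1_bound[OF t, of "e t" "e t"] t by simp
      then have "\<bar>h * B1 t (e t) (e t)\<bar> \<le> \<bar>h\<bar> * C" unfolding abs_mult by (intro mult_left_mono) auto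
      moreover have "D * h\<^sup>2 \<le> \<bar>h\<bar> * (1 / 2)"
      proof -
        have "D * h\<^sup>2 = \<bar>h\<bar> * (D * \<bar>h\<bar>)" by (simp add: power2_eq_square)
        also have "\<dots> \<le> \<bar>h\<bar> * (1 / 2)" using JI(3)[OF r] by (intro mult_left_mono) (auto simp: h_def)
        finally show ?thesis .
      qed
      ultimately show ?thesis using D(3)[OF rI] unfolding h_def[symmetric]
          by (simp add: algebra_simps)
    qed
    then have "\<bar>(\<mu> r - \<mu> t) * A (w r) v\<bar> \<le> (\<bar>h\<bar> * (C + 1 / 2)) * (2 * D * \<bar>h\<bar> * enorm v)"
      unfolding abs_mult using Aw C_nonneg by (intro mult_mono) auto
    also have "\<dots> = (2 * C * D + D) * (\<bar>h\<bar> * \<bar>h\<bar>) * enorm v" by (simp add: algebra_simps)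
    finally have e3: "\<bar>(\<mu> r - \<mu> t) * A (w r) v\<bar> \<le> (2 * C * D + D) * h\<^sup>2 * enorm v"
      by (simp add: power2_eq_square)
    have "\<mu> t * A (w r) v - B t (w r) v - h * B1 t (e t) v =
        (\<mu> r * A (w r) v - B t (w r) v - h * B1 t (e t) v - h * B1 t (w r) v)
          + h * B1 t (w r) v - (\<mu> r - \<mu> t) * A (w r) v" by (simp add: algebra_simps)
    then have "\<bar>\<mu> t * A (w r) v - B t (w r) v - h * B1 t (e t) v\<bar> \<le>
        2 * C * h\<^sup>2 * enorm v + 2 * C * D * h\<^sup>2 * enorm v + (2 * C * D + D) * h\<^sup>2 * enorm v"
      using e1 e2 e3 by linarith
    also have "\<dots> = K * h\<^sup>2 * enorm v" by (simp add: K_def algebra_simps)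
    finally have e4: "\<bar>\<mu> t * A (w r) v - B t (w r) v - h * B1 t (e t) v\<bar> \<le> K * h\<^sup>2 * enorm v" .
    have "\<mu> t * A (y r) v - B t (y r) v - B1 t (e t) v =
        (\<mu> t * A (w r) v - B t (w r) v - h * B1 t (e t) v) / h"
      using r t v h0 by (simp add: y_def sym_form_left[OF A_form] sym_form_left[OF B_form]
          h_def[symmetric] field_simps)
    then have "\<bar>\<mu> t * A (y r) v - B t (y r) v - B1 t (e t) v\<bar> =
        \<bar>\<mu> t * A (w r) v - B t (w r) v - h * B1 t (e t) v\<bar> / \<bar>h\<bar>" by (simp add: abs_divide)
    also have "\<dots> \<le> K * h\<^sup>2 * enorm v / \<bar>h\<bar>" using e4 by (intro divide_right_mono) auto
    also have "\<dots> = K * \<bar>h\<bar> * enorm v" using h0 by (simp add: power2_eq_square field_simps abs_if)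
    finally show ?thesis by (simp add: h_def)
  qed
  define \<phi> where "\<phi> r = B1 t (e t) (y r)" for r
  have gapA: "g * A v v \<le> \<mu> t * A v v - B t v v" if "v \<in> S" "A (e t) v = 0" for v
    using g(2)[OF that] by (simp add: algebra_simps)
  have \<phi>_low: "\<phi> r \<ge> - (K * \<bar>r - t\<bar> * (2 * D))" if r: "r \<in> J" for r
  proof -
    have "0 \<le> g * A (y r) (y r)" using g r A_nonneg by simp
    moreover have "K * \<bar>r - t\<bar> * enorm (y r) \<le> K * \<bar>r - t\<bar> * (2 * D)"
      using ny[OF r] K0 by (intro mult_left_mono) auto
    ultimately show ?thesis
      using key[OF r, of "y r"] gapA[of "y r"] yorth[OF r] r by (simp add: \<phi>_def)
  qed
  have \<phi>_Cauchy: "\<bar>\<phi> r - \<phi> q\<bar> \<le> C * K / g * (\<bar>r - t\<bar> + \<bar>q - t\<bar>)"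
      if r: "r \<in> J" and q: "q \<in> J" for r q
  proof -
    define v where "v = lincomb 1 (y r) (-1) (y q)"
    have v [simp]: "v \<in> S" using r q by (simp add: v_def)
    have o: "A (e t) v = 0" using r q t by (simp add: v_def sym_form_right[OF A_form] yorth)
    have n0: "0 \<le> enorm v" by simp
    have "A v v = A (y r) v - A (y q) v" "B t v v = B t (y r) v - B t (y q) v"
      using r q t by (subst (1) v_def, simp add: sym_form_left[OF A_form] sym_form_left[OF B_form])+
    then have "\<mu> t * A v v - B t v v = \<mu> t * (A (y r) v - A (y q) v) - (B t (y r) v - B t (y q) v)"
        by presburger
    then have "\<mu> t * A v v - B t v v = (\<mu> t * A (y r) v - B t (y r) v - B1 t (e t) v)
        - (\<mu> t * A (y q) v - B t (y q) v - B1 t (e t) v)" by (simp add: algebra_simps)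
    then have "\<mu> t * A v v - B t v v \<le> K * \<bar>r - t\<bar> * enorm v + K * \<bar>q - t\<bar> * enorm v"
      using key[OF r v o] key[OF q v o] by linarith
    then have "(g * enorm v) * enorm v \<le> (K * (\<bar>r - t\<bar> + \<bar>q - t\<bar>)) * enorm v"
      using gapA[OF v o] enorm_square[OF v] by (simp add: power2_eq_square algebra_simps)
    then have "g * enorm v \<le> K * (\<bar>r - t\<bar> + \<bar>q - t\<bar>)"
    proof (cases "enorm v = 0")
      case True then show ?thesis using K0 by simp
    next
      case False then show ?thesis 
        using \<open>(g * enorm v) * enorm v \<le> _\<close> n0 by (simp add: mult_le_cancel_right)
    qed
    then have nv: "enorm v \<le> K / g * (\<bar>r - t\<bar> + \<bar>q - t\<bar>)" using g(1) by (simp add: field_simps)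
    have "\<phi> r - \<phi> q = B1 t (e t) v"
      using r q t by (simp add: \<phi>_def v_def sym_form_right[OF B1_form])
    then have "\<bar>\<phi> r - \<phi> q\<bar> \<le> C * enorm v" using B1_bound[OF t, of "e t" v] t by simp
    also have "\<dots> \<le> C * (K / g * (\<bar>r - t\<bar> + \<bar>q - t\<bar>))" using nv C_nonneg
        by (intro mult_left_mono) auto
    finally show ?thesis by simp
  qed
  obtain L where L: "(\<phi> \<longlongrightarrow> L) (at t)"
  proof -
    define P where "P = C * K / g"
    have P0: "0 \<le> P" using C_nonneg K0 g by (simp add: P_def)
    define q where "q n = t + inverse (real (Suc n))" for n
    have "q \<longlonglongrightarrow> t + 0" unfolding q_def by (intro tendsto_add tendsto_const LIMSEQ_inverse_real_of_nat)
    then have q: "q \<longlonglongrightarrow> t" by simp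
    then have "filterlim q (at t) sequentially"
      by (auto simp: filterlim_at q_def)
    then have evq: "eventually (\<lambda>n. q n \<in> J) sequentially" using evJ unfolding filterlim_iff
        by blast
    have q0: "(\<lambda>n. \<bar>q n - t\<bar>) \<longlonglongrightarrow> 0" using q by (auto intro!: tendsto_eq_intros)
    have "Cauchy (\<lambda>n. \<phi> (q n))"
    proof (rule CauchyI)
      fix \<epsilon> :: real assume "\<epsilon> > 0"
      then have "eventually (\<lambda>n. \<bar>q n - t\<bar> < \<epsilon> / (2 * (P + 1))) sequentially"
        using q0 P0 by (intro order_tendstoD(2)) auto
      then have "eventually (\<lambda>n. q n \<in> J \<and> \<bar>q n - t\<bar> < \<epsilon> / (2 * (P + 1))) sequentially"
        using evq by eventually_elim auto
      then obtain N where N: "\<And>n. n \<ge> N \<Longrightarrow> q n \<in> J \<and> \<bar>q n - t\<bar> < \<epsilon> / (2 * (P + 1))"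
        by (auto simp: eventually_sequentially)
      have "norm (\<phi> (q m) - \<phi> (q n)) < \<epsilon>" if "m \<ge> N" "n \<ge> N" for m n
      proof -
        have "\<bar>\<phi> (q m) - \<phi> (q n)\<bar> \<le> P * (\<bar>q m - t\<bar> + \<bar>q n - t\<bar>)"
          using \<phi>_Cauchy N that by (simp add: P_def)
        also have "\<dots> \<le> (P + 1) * (\<bar>q m - t\<bar> + \<bar>q n - t\<bar>)" by (intro mult_right_mono) auto
        also have "\<dots> < (P + 1) * (\<epsilon> / (2 * (P + 1)) + \<epsilon> / (2 * (P + 1)))"
          using N that P0 by (intro mult_strict_left_mono add_strict_mono) auto
        also have "\<dots> = \<epsilon>"
        proof -
          have "R * (\<epsilon> / (2 * R) + \<epsilon> / (2 * R)) = \<epsilon>" if "R > 0" for R :: real using that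
              by (simp add: field_simps)
          from this[of "P + 1"] P0 show ?thesis by simp
        qed
        finally show ?thesis by simp
      qed
      then show "\<exists>N. \<forall>m\<ge>N. \<forall>n\<ge>N. norm (\<phi> (q m) - \<phi> (q n)) < \<epsilon>" by blast
    qed
    then obtain L where L: "(\<lambda>n. \<phi> (q n)) \<longlonglongrightarrow> L" using Cauchy_convergent convergent_def by blast
    have bd: "\<bar>\<phi> r - L\<bar> \<le> P * \<bar>r - t\<bar>" if r: "r \<in> J" for r
    proof (rule tendsto_le)
      show "(\<lambda>n. \<bar>\<phi> r - \<phi> (q n)\<bar>) \<longlonglongrightarrow> \<bar>\<phi> r - L\<bar>" by (intro tendsto_intros L)
      have "(\<lambda>n. P * (\<bar>r - t\<bar> + \<bar>q n - t\<bar>)) \<longlonglongrightarrow> P * (\<bar>r - t\<bar> + 0)" by (intro tendsto_intros q0)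
      then show "(\<lambda>n. P * (\<bar>r - t\<bar> + \<bar>q n - t\<bar>)) \<longlonglongrightarrow> P * \<bar>r - t\<bar>" by simp
      show "eventually (\<lambda>n. \<bar>\<phi> r - \<phi> (q n)\<bar> \<le> P * (\<bar>r - t\<bar> + \<bar>q n - t\<bar>)) sequentially"
        using evq by eventually_elim (use \<phi>_Cauchy r in \<open>simp add: P_def\<close>)
    qed simp
    have "((\<lambda>r. \<phi> r - L) \<longlongrightarrow> 0) (at t)"
    proof (rule Lim_null_comparison)
      show "((\<lambda>r. P * \<bar>r - t\<bar>) \<longlongrightarrow> 0) (at t)" by (auto intro!: tendsto_eq_intros)
      show "eventually (\<lambda>r. norm (\<phi> r - L) \<le> P * \<bar>r - t\<bar>) (at t)"
        using evJ by eventually_elim (simp add: bd)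
    qed
    then show ?thesis using that LIM_zero_iff by blast
  qed
  have "L \<ge> 0"
  proof (rule tendsto_le)
    show "(\<phi> \<longlongrightarrow> L) (at t)" by fact
    show "((\<lambda>r. - (K * \<bar>r - t\<bar> * (2 * D))) \<longlongrightarrow> 0) (at t)" by (auto intro!: tendsto_eq_intros)
    show "eventually (\<lambda>r. - (K * \<bar>r - t\<bar> * (2 * D)) \<le> \<phi> r) (at t)"
      using evJ by eventually_elim (rule \<phi>_low)
  qed simp
  \<comment> \<open>With \<open>e r = c r f r\<close> and \<open>f r = e t + w r\<close>, the remainder collects the variation of \<open>B1\<close> in
      the mixed term, the quadratic term in \<open>w r\<close>, and the defect \<open>1 - (c r)\<^sup>2\<close> of the
      normalisation.\<close>
  define Q where "Q = 4 * C * D + 8 * C * D\<^sup>2"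
  have exp: "\<bar>B1 r (e r) (e r) - B1 r (e t) (e t) - 2 * (r - t) * \<phi> r\<bar> \<le> Q * (r - t)\<^sup>2"
      if r: "r \<in> J" for r
  proof -
    define h where "h = r - t"
    note rI = JI(1)[OF r]
    have h0: "h \<noteq> 0" using JI(2)[OF r] by (simp add: h_def)
    have n0: "0 \<le> enorm (w r)" "0 \<le> enorm (f r)" using r by simp_all
    have "e r = lincomb (c r) (f r) 0 (e t)" using c0[OF r]
        by (simp add: f_def lincomb_def fun_eq_iff)
    then have er: "B1 r (e r) (e r) = (c r)\<^sup>2 * B1 r (f r) (f r)"
      using r rI t by (simp add: sym_form_square[OF B1_form])
    have ff: "B1 r (f r) (f r) = B1 r (e t) (e t) + 2 * B1 r (e t) (w r) + B1 r (w r) (w r)"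
      unfolding fw[OF r] using r rI t by (simp add: sym_form_square[OF B1_form])
    have "w r = lincomb h (y r) 0 (e t)" using h0 by (simp add: y_def h_def lincomb_def fun_eq_iff)
    then have "B1 t (e t) (w r) = h * \<phi> r" 
      using r t by (simp add: \<phi>_def sym_form_right[OF B1_form])
    moreover have "\<bar>B1 r (e t) (w r) - B1 t (e t) (w r)\<bar> \<le> C * \<bar>h\<bar> * (2 * D * \<bar>h\<bar>)"
    proof -
      have "\<bar>B1 r (e t) (w r) - B1 t (e t) (w r)\<bar> \<le> C * \<bar>h\<bar> * enorm (e t) * enorm (w r)"
        unfolding h_def using t rI r by (intro B1_lipschitz) auto
      also have "\<dots> \<le> C * \<bar>h\<bar> * (2 * D * \<bar>h\<bar>)"
        using nw[OF r] t C_nonneg by (auto simp: h_def intro!: mult_left_mono)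
      finally show ?thesis .
    qed
    ultimately have x1: "\<bar>B1 r (e t) (w r) - h * \<phi> r\<bar> \<le> 2 * C * D * h\<^sup>2"
      by (simp add: power2_eq_square mult_ac)
    have x2: "\<bar>B1 r (w r) (w r)\<bar> \<le> 4 * C * D\<^sup>2 * h\<^sup>2"
    proof -
      have "\<bar>B1 r (w r) (w r)\<bar> \<le> C * enorm (w r) * enorm (w r)" using rI r by (intro B1_bound) auto
      also have "\<dots> = C * (enorm (w r))\<^sup>2" by (simp add: power2_eq_square)
      also have "\<dots> \<le> C * (2 * D * \<bar>h\<bar>)\<^sup>2"
        using nw[OF r] n0 C_nonneg by (intro mult_left_mono power_mono) (auto simp: h_def)
      also have "\<dots> = 4 * C * D\<^sup>2 * h\<^sup>2" by (simp add: power_mult_distrib)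
      finally show ?thesis .
    qed
    have x3: "\<bar>(1 - (c r)\<^sup>2) * B1 r (f r) (f r)\<bar> \<le> 4 * C * D\<^sup>2 * h\<^sup>2"
    proof -
      have "\<bar>B1 r (f r) (f r)\<bar> \<le> C * enorm (f r) * enorm (f r)" using rI r by (intro B1_bound) auto
      also have "\<dots> \<le> C * 2 * 2" using nf[OF r] n0 C_nonneg by (intro mult_mono) auto
      finally have "\<bar>1 - (c r)\<^sup>2\<bar> * \<bar>B1 r (f r) (f r)\<bar> \<le> (D\<^sup>2 * h\<^sup>2) * (C * 2 * 2)"
        using csq[OF r] by (intro mult_mono) (auto simp: h_def)
      then show ?thesis by (simp add: abs_mult mult_ac)
    qed
    have "B1 r (e r) (e r) - B1 r (e t) (e t) - 2 * h * \<phi> r =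
        2 * (B1 r (e t) (w r) - h * \<phi> r) + B1 r (w r) (w r) - (1 - (c r)\<^sup>2) * B1 r (f r) (f r)"
      unfolding er using ff by (simp add: algebra_simps)
    note split = this
    have "\<bar>B1 r (e r) (e r) - B1 r (e t) (e t) - 2 * h * \<phi> r\<bar> \<le> 
        2 * (2 * C * D * h\<^sup>2) + 4 * C * D\<^sup>2 * h\<^sup>2 + 4 * C * D\<^sup>2 * h\<^sup>2"
    proof -
      have "\<bar>X\<bar> \<le> 2 * p' + q' + s'" if "X = 2 * a + b - c'" "\<bar>a\<bar> \<le> p'" "\<bar>b\<bar> \<le> q'" "\<bar>c'\<bar> \<le> s'"
        for X a b c' p' q' s' :: real using that by linarith
      from this[OF split x1 x2 x3] show ?thesis .
    qed
    also have "\<dots> = Q * h\<^sup>2" by (simp add: Q_def algebra_simps)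
    finally show ?thesis by (simp add: h_def)
  qed
  define q where "q r = (B1 r (e r) (e r) - B1 r (e t) (e t) - 2 * (r - t) * \<phi> r) / (r - t)" for r
  have q0: "(q \<longlongrightarrow> 0) (at t)"
  proof (rule Lim_null_comparison)
    show "((\<lambda>r. Q * \<bar>r - t\<bar>) \<longlongrightarrow> 0) (at t)" by (auto intro!: tendsto_eq_intros)
    show "eventually (\<lambda>r. norm (q r) \<le> Q * \<bar>r - t\<bar>) (at t)" using evJ
    proof eventually_elim
      case (elim r)
      have "norm (q r) \<le> Q * (r - t)\<^sup>2 / \<bar>r - t\<bar>"
        using exp[OF elim] by (auto simp: q_def abs_divide intro!: divide_right_mono)
      also have "\<dots> = Q * \<bar>r - t\<bar>" using JI(2)[OF elim]
          by (simp add: power2_eq_square field_simps abs_if)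
      finally show ?case .
    qed
  qed
  have "((\<lambda>r. (B1 r (e t) (e t) - B1 t (e t) (e t)) / (r - t) + 2 * \<phi> r + q r) \<longlongrightarrow> d + 2 * L +
      0) (at t)"
    using d unfolding has_field_derivative_iff by (intro tendsto_intros L q0)
  moreover have "eventually (\<lambda>r. (B1 r (e t) (e t) - B1 t (e t) (e t)) / (r - t) + 2 * \<phi> r + q r =
      (B1 r (e r) (e r) - B1 t (e t) (e t)) / (r - t)) (at t)"
    using evJ
  proof eventually_elim
    case (elim r)
    have "2 * h * \<phi> r / h = 2 * \<phi> r" if "h \<noteq> 0" for h :: real using that by simp
    from this[of "r - t"] have "2 * (r - t) * \<phi> r / (r - t) = 2 * \<phi> r" using JI(2)[OF elim]
        by (metis eq_iff_diff_eq_0)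
    then show ?case unfolding q_def diff_divide_distrib by linarith
  qed
  ultimately have "((\<lambda>r. (B1 r (e r) (e r) - B1 t (e t) (e t)) / (r - t)) \<longlongrightarrow> d + 2 * L + 0) (at t)"
    by (rule Lim_transform_eventually)
  then show ?thesis using \<open>L \<ge> 0\<close> unfolding has_field_derivative_iff by (metis add.right_neutral)
qed

end

section \<open>Translation estimates for continuously differentiable functions\<close>

text \<open>
  The variance of \<open>g\<close> over \<open>S\<close> is nonnegative.
\<close>

lemma set_integral_Cauchy_Schwarz:
  fixes g :: "'a \<Rightarrow> real"
  assumes S: "S \<in> sets M" "emeasure M S < \<infinity>"
    and g: "set_integrable M S g" and g2: "set_integrable M S (\<lambda>x. (g x)\<^sup>2)"
  shows "(LINT x:S|M. g x)\<^sup>2 \<le> measure M S * (LINT x:S|M. (g x)\<^sup>2)"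
proof (cases "measure M S = 0")
  case True
  then have "emeasure M S = 0" using S by (auto simp: measure_def enn2real_eq_0_iff)
  then have "AE x in M. x \<notin> S" using S(1) by (intro AE_not_in null_setsI)
  then have "AE x in M. indicator S x *\<^sub>R g x = 0" by eventually_elim simp
  then have "(LINT x:S|M. g x) = 0" unfolding set_lebesgue_integral_def
      by (rule integral_eq_zero_AE)
  then show ?thesis using True by simp
next
  case False
  define m where "m = measure M S"
  have m: "m > 0" using False measure_nonneg[of M S] by (simp add: m_def less_le)
  define c where "c = (LINT x:S|M. g x) / m"
  have k: "set_integrable M S (\<lambda>x. k)" for k :: real
    using S by (simp add: set_integrable_def)
  have "0 \<le> (LINT x:S|M. (g x - c)\<^sup>2)"
    by (simp add: set_lebesgue_integral_def)
  also have "\<dots> = (LINT x:S|M. (g x)\<^sup>2 - 2 * c * g x + c\<^sup>2)"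
    by (rule set_lebesgue_integral_cong[OF S(1)]) (simp add: power2_eq_square algebra_simps)
  also have "\<dots> = (LINT x:S|M. (g x)\<^sup>2) - 2 * c * (LINT x:S|M. g x) + c\<^sup>2 * m"
  proof -
    have "(LINT x:S|M. c\<^sup>2) = c\<^sup>2 * m"
      using S by (simp add: set_lebesgue_integral_def m_def)
    then show ?thesis using g g2 k
        by (simp add: set_integral_add set_integral_diff set_integrable_mult_right)
  qed
  also have "\<dots> = (LINT x:S|M. (g x)\<^sup>2) - (LINT x:S|M. g x)\<^sup>2 / m"
    using m by (simp add: c_def power2_eq_square field_simps)
  finally show ?thesis using m by (simp add: m_def[symmetric] field_simps)
qed

lemma C1_grad_continuous:
  assumes "C1_grad \<phi> \<psi>" shows "continuous_on UNIV \<phi>" "continuous_on UNIV \<psi>"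
  using assms unfolding C1_grad_def gderiv_def
  by (auto intro!: continuous_at_imp_continuous_on has_derivative_continuous)

lemma C1_grad_measurable [measurable_dest]:
  assumes "C1_grad \<phi> \<psi>" shows "\<phi> \<in> borel_measurable borel" "\<psi> \<in> borel_measurable borel"
  using C1_grad_continuous[OF assms] by (auto intro: borel_measurable_continuous_onI)

lemma C1_grad_along_line:
  assumes "C1_grad \<phi> \<psi>"
  shows "((\<lambda>s. \<phi> (x + s *\<^sub>R z)) has_real_derivative (\<psi> (x + s *\<^sub>R z) \<bullet> z)) (at s)"
proof -
  have "(\<phi> has_derivative (\<lambda>h. h \<bullet> \<psi> (x + s *\<^sub>R z))) (at (x + s *\<^sub>R z))"
    using assms by (simp add: C1_grad_def gderiv_def)
  then have "((\<lambda>s. \<phi> (x + s *\<^sub>R z)) has_derivative (\<lambda>h. (h *\<^sub>R z) \<bullet> \<psi> (x + s *\<^sub>R z))) (at s)"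
    by (rule has_derivative_compose[rotated]) (auto intro!: derivative_eq_intros)
  then show ?thesis by (simp add: has_field_derivative_def inner_commute mult.commute[of _ "z \<bullet> _"]
      mult_commute_abs)
qed

lemma nn_integral_lborel_shift:
  fixes f :: "real^'n \<Rightarrow> ennreal"
  assumes [measurable]: "f \<in> borel_measurable borel"
  shows "(\<integral>\<^sup>+x. f (c + x) \<partial>lborel) = (\<integral>\<^sup>+x. f x \<partial>lborel)"
proof -
  have "(\<integral>\<^sup>+x. f x \<partial>lborel) = (\<integral>\<^sup>+x. f x \<partial>distr lborel borel ((+) c))"
    by (simp add: lborel_distr_plus)
  also have "\<dots> = (\<integral>\<^sup>+x. f (c + x) \<partial>lborel)" by (subst nn_integral_distr) auto
  finally show ?thesis by simp
qed

text \<open>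
  The increment is the integral of the directional derivative along the segment, and the square of
  an integral over the unit interval is at most the integral of the square.
\<close>

lemma C1_increment_le:
  fixes \<phi> :: "real^'n \<Rightarrow> real"
  assumes C1: "C1_grad \<phi> \<psi>"
  shows "ennreal ((\<phi> (x + z) - \<phi> x)\<^sup>2) \<le>
    (\<integral>\<^sup>+s\<in>{0..1}. ennreal ((norm z)\<^sup>2) * ennreal ((norm (\<psi> (x + s *\<^sub>R z)))\<^sup>2) \<partial>lborel)"
proof -
  define g where "g s = \<psi> (x + s *\<^sub>R z) \<bullet> z" for s
  have cont: "continuous_on A g" for A
    unfolding g_def
    by (intro continuous_intros continuous_on_compose2[OF C1_grad_continuous(2)[OF C1]]) auto
  have int: "set_integrable lborel {0..1} g" "set_integrable lborel {0..1} (\<lambda>s. (g s)\<^sup>2)"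
    by (auto intro!: borel_integrable_atLeastAtMost' continuous_intros cont)
  have "(LBINT s:{0..1}. g s) = \<phi> (x + z) - \<phi> x"
  proof -
    have "(LBINT s:{0..1}. g s) = \<phi> (x + 1 *\<^sub>R z) - \<phi> (x + 0 *\<^sub>R z)"
      unfolding set_lebesgue_integral_def
      by (rule integral_FTC_atLeastAtMost)
        (auto intro!: cont[unfolded g_def] has_field_derivative_at_within C1_grad_along_line[OF C1]
          simp: has_real_derivative_iff_has_vector_derivative[symmetric] g_def)
    then show ?thesis by simp
  qed
  then have "(\<phi> (x + z) - \<phi> x)\<^sup>2 \<le> (LBINT s:{0..1}. (g s)\<^sup>2)"
    using set_integral_Cauchy_Schwarz[OF _ _ int] by simp
  then have "ennreal ((\<phi> (x + z) - \<phi> x)\<^sup>2) \<le> ennreal (LBINT s:{0..1}. (g s)\<^sup>2)"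
      by (rule ennreal_leI)
  also have "\<dots> = (\<integral>\<^sup>+s. ennreal (indicator {0..1} s *\<^sub>R (g s)\<^sup>2) \<partial>lborel)"
    unfolding set_lebesgue_integral_def using int(2)
    by (subst nn_integral_eq_integral) (auto simp: set_integrable_def)
  also have "\<dots> \<le> (\<integral>\<^sup>+s\<in>{0..1}. ennreal ((norm z)\<^sup>2) * ennreal ((norm (\<psi> (x + s *\<^sub>R z)))\<^sup>2) \<partial>lborel)"
  proof (rule nn_integral_mono)
    fix s :: real
    have "(g s)\<^sup>2 \<le> (norm z)\<^sup>2 * (norm (\<psi> (x + s *\<^sub>R z)))\<^sup>2"
      unfolding g_def using Cauchy_Schwarz_ineq[of "\<psi> (x + s *\<^sub>R z)" z]
          by (simp add: power2_norm_eq_inner mult.commute)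
    then show "ennreal (indicator {0..1} s *\<^sub>R (g s)\<^sup>2) \<le>
        ennreal ((norm z)\<^sup>2) * ennreal ((norm (\<psi> (x + s *\<^sub>R z)))\<^sup>2) * indicator {0..1} s"
      by (auto split: split_indicator simp: ennreal_mult[symmetric] intro!: ennreal_leI)
  qed
  finally show ?thesis .
qed

abbreviation sq_mass :: "(real^'n) set \<Rightarrow> (real^'n \<Rightarrow> real) \<Rightarrow> ennreal" where
  "sq_mass K f \<equiv> (\<integral>\<^sup>+x\<in>K. ennreal ((f x)\<^sup>2) \<partial>lborel)"

abbreviation sq_norm_mass :: "(real^'n) set \<Rightarrow> (real^'n \<Rightarrow> 'b::real_normed_vector) \<Rightarrow> ennreal" where
  "sq_norm_mass K f \<equiv> (\<integral>\<^sup>+x\<in>K. ennreal ((norm (f x))\<^sup>2) \<partial>lborel)"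

text \<open>
  The increments are integrated over \<open>K\<close> with the order of integration exchanged; for each \<open>s\<close> the
  translate \<open>K + s z\<close> lies in \<open>\<Omega>\<close>.
\<close>

lemma C1_translation_estimate:
  fixes \<phi> :: "real^'n \<Rightarrow> real"
  assumes C1: "C1_grad \<phi> \<psi>" and [measurable]: "K \<in> sets borel" "\<Omega> \<in> sets borel"
    and seg: "\<And>x s. x \<in> K \<Longrightarrow> s \<in> {0..1} \<Longrightarrow> x + s *\<^sub>R z \<in> \<Omega>"
  shows "(\<integral>\<^sup>+x\<in>K. ennreal ((\<phi> (x + z) - \<phi> x)\<^sup>2) \<partial>lborel) \<le>
      ennreal ((norm z)\<^sup>2) * sq_norm_mass \<Omega> \<psi>"
proof -
  note [measurable] = C1_grad_measurable[OF C1]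
  define G where "G = sq_norm_mass \<Omega> \<psi>"
  define k where "k = ennreal ((norm z)\<^sup>2)"
  have "(\<integral>\<^sup>+x\<in>K. ennreal ((\<phi> (x + z) - \<phi> x)\<^sup>2) \<partial>lborel) \<le>
      (\<integral>\<^sup>+x. (\<integral>\<^sup>+s. k * ennreal ((norm (\<psi> (x + s *\<^sub>R z)))\<^sup>2) * indicator {0..1} s \<partial>lborel) *
          indicator K x \<partial>lborel)"
    unfolding k_def by (intro nn_integral_mono mult_right_mono C1_increment_le[OF C1]) auto
  also have "\<dots> = (\<integral>\<^sup>+x. \<integral>\<^sup>+s. k * ennreal ((norm (\<psi> (x +
      s *\<^sub>R z)))\<^sup>2) * indicator {0..1} s * indicator K x \<partial>lborel \<partial>lborel)"
    by (intro nn_integral_cong nn_integral_multc[symmetric]) measurable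
  also have "\<dots> = (\<integral>\<^sup>+s. \<integral>\<^sup>+x. k * ennreal ((norm (\<psi> (x +
      s *\<^sub>R z)))\<^sup>2) * indicator {0..1} s * indicator K x \<partial>lborel \<partial>lborel)"
    by (rule lborel_pair.Fubini'[symmetric]) (unfold split_beta', measurable)
  also have "\<dots> \<le> (\<integral>\<^sup>+s. k * G * indicator {0..1::real} s \<partial>lborel)"
  proof (rule nn_integral_mono)
    fix s :: real
    have "(\<integral>\<^sup>+x. k * ennreal ((norm (\<psi> (x +
        s *\<^sub>R z)))\<^sup>2) * indicator {0..1} s * indicator K x \<partial>lborel)
        \<le> (\<integral>\<^sup>+x. k * indicator {0..1} s * (ennreal ((norm (\<psi> (s *\<^sub>R z + x)))\<^sup>2) * indicator \<Omega> (s *\<^sub>R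
            z + x)) \<partial>lborel)"
      using seg by (intro nn_integral_mono) (auto split: split_indicator simp: add.commute)
    also have "\<dots> = k * indicator {0..1} s * (\<integral>\<^sup>+x. ennreal ((norm (\<psi> (s *\<^sub>R z +
        x)))\<^sup>2) * indicator \<Omega> (s *\<^sub>R z + x) \<partial>lborel)"
      by (rule nn_integral_cmult) measurable
    also have "(\<integral>\<^sup>+x. ennreal ((norm (\<psi> (s *\<^sub>R z + x)))\<^sup>2) * indicator \<Omega> (s *\<^sub>R z + x) \<partial>lborel) = G"
      unfolding G_def by (rule nn_integral_lborel_shift) measurable
    finally show "(\<integral>\<^sup>+x. k * ennreal ((norm (\<psi> (x +
        s *\<^sub>R z)))\<^sup>2) * indicator {0..1} s * indicator K x \<partial>lborel)
      \<le> k * G * indicator {0..1} s" by (simp add: mult_ac)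
  qed
  also have "\<dots> = k * G" by (simp add: nn_integral_cmult_indicator)
  finally show ?thesis unfolding k_def G_def .
qed

lemma continuous_set_integrable_bounded:
  fixes f :: "real^'n \<Rightarrow> real"
  assumes "continuous_on UNIV f" "bounded S" "S \<in> sets borel"
  shows "set_integrable lborel S f"
proof (rule set_integrable_subset)
  have "compact (closure S)" using assms by (simp add: compact_closure)
  then show "set_integrable lborel (closure S) f"
    unfolding set_integrable_def using assms(1) 
    by (intro borel_integrable_compact) (auto intro: continuous_on_subset)
qed (use assms closure_subset in auto)

text \<open>
  A point \<open>x\<close> of \<open>K\<close> lies in a ball \<open>ball q r\<close> with \<open>q \<in> D\<close>. The difference between \<open>\<phi> x\<close> and the
  mean of \<open>\<phi>\<close> over that ball is an average of increments \<open>\<phi> (x + z) - \<phi> x\<close> with \<open>\<bar>z\<bar> < 2 r\<close>, so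
  after integration over \<open>K\<close> the translation estimate bounds it by \<open>r\<^sup>2\<close> times the Dirichlet
  integral. The factor \<open>2\<close> to the power of the dimension is the ratio of the volumes of balls of
  radius \<open>2 r\<close> and \<open>r\<close>.
\<close>

lemma C1_interior_estimate:
  fixes \<phi> :: "real^'n \<Rightarrow> real"
  assumes C1: "C1_grad \<phi> \<psi>" and K: "compact K" and [measurable]: "\<Omega> \<in> sets borel" and r: "r > 0"
    and sub: "\<And>x. x \<in> K \<Longrightarrow> ball x (2 * r) \<subseteq> \<Omega>"
    and D: "finite D" "K \<subseteq> (\<Union>q\<in>D. ball q r)"
  shows "sq_mass K \<phi> \<le>
      ennreal (8 * r\<^sup>2 * 2 ^ CARD('n)) * sq_norm_mass \<Omega> \<psi> +
      ennreal (2 * measure lborel K / (measure lborel (ball (0::real^'n) r))\<^sup>2 * (\<Sum>q\<in>D. (LBINT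
          x:ball q r. \<phi> x)\<^sup>2))"
proof -
  note [measurable] = C1_grad_measurable[OF C1]
  have [measurable]: "K \<in> sets borel" using K by (simp add: borel_compact)
  have [measurable]: "ball q s \<in> sets borel" for q :: "real^'n" and s by simp
  define G where "G = sq_norm_mass \<Omega> \<psi>"
  define b where "b = measure lborel (ball (0::real^'n) r)"
  have bq: "measure lborel (ball q r) = b" for q :: "real^'n"
    unfolding b_def using r by (simp add: content_ball)
  have b0: "b > 0" unfolding b_def using r by (simp add: content_ball)
  define Q where "Q = 2 * (\<Sum>q\<in>D. ((LBINT x:ball q r. \<phi> x) / b)\<^sup>2)"
  have Q0: "0 \<le> Q" by (simp add: Q_def sum_nonneg)
  define R where "R x = (\<integral>\<^sup>+z\<in>ball 0 (2 * r). ennreal ((\<phi> (x + z) - \<phi> x)\<^sup>2) \<partial>lborel)" for x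
  have pointwise: "ennreal ((\<phi> x)\<^sup>2) \<le> ennreal (2 / b) * R x + ennreal Q" if x: "x \<in> K" for x
  proof -
    obtain q where q: "q \<in> D" "x \<in> ball q r" using D x by blast
    define av where "av = (LBINT y:ball q r. \<phi> y) / b"
    define g where "g y = \<phi> y - \<phi> x" for y
    have fin: "emeasure lborel (ball q r) < \<infinity>" by (rule emeasure_bounded_finite) simp
    have cont: "continuous_on UNIV g" "continuous_on UNIV (\<lambda>y. (g y)\<^sup>2)"
      unfolding g_def by (intro continuous_intros C1_grad_continuous(1)[OF C1])+
    have int: "set_integrable lborel (ball q r) g" "set_integrable lborel (ball q r) (\<lambda>y. (g y)\<^sup>2)"
      "set_integrable lborel (ball q r) \<phi>" "set_integrable lborel (ball q r) (\<lambda>y. \<phi> x)"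
      using cont C1_grad_continuous(1)[OF C1] by (auto intro!: continuous_set_integrable_bounded)
    have "(LBINT y:ball q r. g y) = (LBINT y:ball q r. \<phi> y) - \<phi> x * b"
      unfolding g_def using int by (simp add: set_integral_diff set_lebesgue_integral_def[of _ _
          "\<lambda>y. \<phi> x"] bq mult.commute)
    also have "\<dots> = b * (av - \<phi> x)" using b0 by (simp add: av_def field_simps)
    finally have "(b * (av - \<phi> x))\<^sup>2 \<le> b * (LBINT y:ball q r. (g y)\<^sup>2)"
      using set_integral_Cauchy_Schwarz[OF _ fin int(1,2)] by (simp add: bq)
    then have "b * (b * (av - \<phi> x)\<^sup>2) \<le> b * (LBINT y:ball q r. (g y)\<^sup>2)"
      by (simp add: power_mult_distrib power2_eq_square mult_ac)
    then have v: "(av - \<phi> x)\<^sup>2 \<le> (LBINT y:ball q r. (g y)\<^sup>2) / b" using b0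
        by (simp add: field_simps)
    have "(\<phi> x)\<^sup>2 \<le> 2 * (av - \<phi> x)\<^sup>2 + 2 * av\<^sup>2"
      using zero_le_power2[of "2 * av - \<phi> x"] by (simp add: power2_eq_square algebra_simps)
    also have "\<dots> \<le> 2 / b * (LBINT y:ball q r. (g y)\<^sup>2) + Q"
    proof -
      have "av\<^sup>2 \<le> (\<Sum>q\<in>D. ((LBINT x:ball q r. \<phi> x) / b)\<^sup>2)"
        unfolding av_def using q D by (intro member_le_sum) auto
      then show ?thesis using v by (simp add: Q_def)
    qed
    finally have "ennreal ((\<phi> x)\<^sup>2) \<le> ennreal (2 / b * (LBINT y:ball q r. (g y)\<^sup>2) + Q)"
        by (rule ennreal_leI)
    also have "\<dots> = ennreal (2 / b) * ennreal (LBINT y:ball q r. (g y)\<^sup>2) + ennreal Q"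
    proof -
      have "0 \<le> (LBINT y:ball q r. (g y)\<^sup>2)" by (simp add: set_lebesgue_integral_def)
      then show ?thesis using b0 Q0 by (simp flip: ennreal_mult ennreal_plus)
    qed
    also have "\<dots> \<le> ennreal (2 / b) * R x + ennreal Q"
    proof (intro add_right_mono mult_left_mono)
      have "ennreal (LBINT y:ball q r. (g y)\<^sup>2) =
          (\<integral>\<^sup>+y. ennreal (indicator (ball q r) y *\<^sub>R (g y)\<^sup>2) \<partial>lborel)"
        unfolding set_lebesgue_integral_def using int(2)
        by (subst nn_integral_eq_integral) (auto simp: set_integrable_def)
      also have "\<dots> = (\<integral>\<^sup>+z. ennreal (indicator (ball q r) (x + z) *\<^sub>R (g (x + z))\<^sup>2) \<partial>lborel)"
      proof (rule nn_integral_lborel_shift[symmetric])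
        have [measurable]: "g \<in> borel_measurable borel" using cont(1)
            by (rule borel_measurable_continuous_onI)
        show "(\<lambda>y. ennreal (indicator (ball q r) y *\<^sub>R (g y)\<^sup>2)) \<in> borel_measurable borel"
          by (intro measurable_compose[OF _ measurable_ennreal] borel_measurable_scaleR
              borel_measurable_indicator borel_measurable_power) auto
      qed
      also have "\<dots> \<le> R x"
        unfolding R_def
      proof (rule nn_integral_mono)
        fix z :: "real^'n"
        have "z \<in> ball 0 (2 * r)" if "x + z \<in> ball q r"
        proof -
          have "norm z = dist (x + z) x" by (simp add: dist_norm)
          also have "\<dots> \<le> dist q (x + z) + dist q x" by (metis dist_commute dist_triangle)
          also have "\<dots> < 2 * r" using that q by simp
          finally show ?thesis by simp
        qed
        then show "ennreal (indicator (ball q r) (x + z) *\<^sub>R (g (x + z))\<^sup>2) \<le>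
            ennreal ((\<phi> (x + z) - \<phi> x)\<^sup>2) * indicator (ball 0 (2 * r)) z"
          by (auto split: split_indicator simp: g_def)
      qed
      finally show "ennreal (LBINT y:ball q r. (g y)\<^sup>2) \<le> R x" .
    qed simp
    finally show ?thesis .
  qed
  have dbl: "(\<integral>\<^sup>+x\<in>K. R x \<partial>lborel) \<le> ennreal ((2 * r)\<^sup>2) * G * ennreal (2 ^ CARD('n) * b)"
  proof -
    have "(\<integral>\<^sup>+x\<in>K. R x \<partial>lborel) = (\<integral>\<^sup>+x. \<integral>\<^sup>+z. ennreal ((\<phi> (x + z) -
        \<phi> x)\<^sup>2) * indicator (ball 0 (2 * r)) z * indicator K x \<partial>lborel \<partial>lborel)"
      unfolding R_def by (intro nn_integral_cong nn_integral_multc[symmetric]) measurable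
    also have "\<dots> = (\<integral>\<^sup>+z. \<integral>\<^sup>+x. ennreal ((\<phi> (x + z) -
        \<phi> x)\<^sup>2) * indicator (ball 0 (2 * r)) z * indicator K x \<partial>lborel \<partial>lborel)"
      by (rule lborel_pair.Fubini'[symmetric]) (unfold split_beta', measurable)
    also have "\<dots> \<le> (\<integral>\<^sup>+z. ennreal ((2 * r)\<^sup>2) * G * indicator (ball (0::real^'n) (2 * r)) z
        \<partial>lborel)"
    proof (rule nn_integral_mono)
      fix z :: "real^'n"
      show "(\<integral>\<^sup>+x. ennreal ((\<phi> (x + z) - \<phi> x)\<^sup>2) * indicator (ball 0 (2 * r)) z * indicator K x
          \<partial>lborel)
          \<le> ennreal ((2 * r)\<^sup>2) * G * indicator (ball 0 (2 * r)) z"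
      proof (cases "z \<in> ball 0 (2 * r)")
        case True
        have "(\<integral>\<^sup>+x\<in>K. ennreal ((\<phi> (x + z) - \<phi> x)\<^sup>2) \<partial>lborel) \<le> ennreal ((norm z)\<^sup>2) * G"
          unfolding G_def
        proof (rule C1_translation_estimate[OF C1])
          fix x and s :: real assume "x \<in> K" "s \<in> {0..1}"
          moreover have "x + s *\<^sub>R z \<in> ball x (2 * r)" 
            using True \<open>s \<in> {0..1}\<close>
                by (auto simp: dist_norm intro: le_less_trans[OF mult_left_le_one_le])
          ultimately show "x + s *\<^sub>R z \<in> \<Omega>" using sub by blast
        qed measurable
        also have "\<dots> \<le> ennreal ((2 * r)\<^sup>2) * G"
          using True by (intro mult_right_mono ennreal_leI power_mono) auto
        finally show ?thesis using True by simp
      qed simp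
    qed
    also have "\<dots> = ennreal ((2 * r)\<^sup>2) * G * emeasure lborel (ball (0::real^'n) (2 * r))"
      by (rule nn_integral_cmult_indicator) simp
    also have "emeasure lborel (ball (0::real^'n) (2 * r)) = ennreal (2 ^ CARD('n) * b)"
      using r by (simp add: b_def content_ball emeasure_ball power_mult_distrib mult_ac)
    finally show ?thesis .
  qed
  have "sq_mass K \<phi> \<le> (\<integral>\<^sup>+x. ennreal (2 / b) * (R x * indicator K x) +
      ennreal Q * indicator K x \<partial>lborel)"
    using pointwise by (intro nn_integral_mono) (auto split: split_indicator)
  also have "\<dots> = ennreal (2 / b) * (\<integral>\<^sup>+x\<in>K. R x \<partial>lborel) + ennreal Q * emeasure lborel K"
    unfolding R_def by (subst nn_integral_add, measurable) (simp add: nn_integral_cmult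
        nn_integral_cmult_indicator)
  also have "\<dots> \<le> ennreal (2 / b) * (ennreal ((2 * r)\<^sup>2) * G * ennreal (2 ^ CARD('n) * b)) +
      ennreal Q * emeasure lborel K"
    by (intro add_right_mono mult_left_mono dbl) auto
  also have "ennreal (2 / b) * (ennreal ((2 * r)\<^sup>2) * G * ennreal (2 ^ CARD('n) * b)) = 
      (ennreal (2 / b) * ennreal ((2 * r)\<^sup>2) * ennreal (2 ^ CARD('n) * b)) *
          G" by (simp add: mult_ac)
  also have "ennreal (2 / b) * ennreal ((2 * r)\<^sup>2) * ennreal (2 ^ CARD('n) * b) =
      ennreal (8 * r\<^sup>2 * 2 ^ CARD('n))"
    using b0 by (simp add: ennreal_mult[symmetric] power_mult_distrib)
  also have "ennreal Q * emeasure lborel K = ennreal (2 * measure lborel K / b\<^sup>2 * (\<Sum>q\<in>D.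
      (LBINT x:ball q r. \<phi> x)\<^sup>2))"
  proof -
    have "emeasure lborel K = ennreal (measure lborel K)"
      using emeasure_bounded_finite[OF compact_imp_bounded[OF K]]
          by (intro emeasure_eq_ennreal_measure) (simp add: less_top)
    then show ?thesis using Q0 b0
      by (simp add: ennreal_mult[symmetric] Q_def power_divide sum_divide_distrib[symmetric]
          sum_nonneg mult_ac)
  qed
  finally show ?thesis unfolding G_def b_def .
qed

section \<open>A finite rank estimate in Lipschitz domains\<close>

text \<open>
  Near a boundary point the domain lies above a graph in direction \<open>e\<close>. Moving points upwards
  keeps them in the domain, and moving all of them by the same \<open>s > 0\<close> keeps them at height at
  least \<open>s\<close> above the graph, which is a closed condition.
\<close>

lemma lipschitz_domain_boundary:
  fixes \<Omega> :: "(real^'n) set"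
  assumes \<Omega>: "lipschitz_domain \<Omega>" and x0: "x0 \<in> frontier \<Omega>"
  obtains \<rho> e where "\<rho> > 0" "norm e = 1"
    "\<And>y s. y \<in> \<Omega> \<inter> ball x0 \<rho> \<Longrightarrow> 0 \<le> s \<Longrightarrow> s \<le> \<rho> \<Longrightarrow> y + s *\<^sub>R e \<in> \<Omega>"
    "\<And>s. 0 < s \<Longrightarrow> s \<le> \<rho> \<Longrightarrow> closure ((\<lambda>y. y + s *\<^sub>R e) ` (\<Omega> \<inter> ball x0 \<rho>)) \<subseteq> \<Omega>"
proof -
  obtain U e g L where U: "open U" "x0 \<in> U" and e: "norm e = 1" and g: "L-lipschitz_on UNIV g"
    and \<Omega>U: "\<Omega> \<inter> U = {y \<in> U. y \<bullet> e > (g (y - (y \<bullet> e) *\<^sub>R e) :: real)}"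
    using \<Omega> x0 unfolding lipschitz_domain_def by blast
  obtain R where R: "R > 0" "cball x0 R \<subseteq> U" using U open_contains_cball by blast
  define \<rho> where "\<rho> = R / 2"
  have \<rho>: "\<rho> > 0" using R by (simp add: \<rho>_def)
  have ee: "e \<bullet> e = 1" using e by (simp add: norm_eq_1)
  have near: "y + s *\<^sub>R e \<in> cball x0 R" if "y \<in> ball x0 \<rho>" "0 \<le> s" "s \<le> \<rho>" for y s
  proof -
    have "dist x0 (y + s *\<^sub>R e) \<le> dist x0 y + dist y (y + s *\<^sub>R e)" by (rule dist_triangle)
    also have "dist y (y + s *\<^sub>R e) = s" using that e by (simp add: dist_norm)
    finally show ?thesis using that by (simp add: \<rho>_def)
  qed
  have perp: "(y + s *\<^sub>R e) - (y \<bullet> e + s) *\<^sub>R e = y - (y \<bullet> e) *\<^sub>R e" for y s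
    by (simp add: scaleR_add_left)
  have up: "(y + s *\<^sub>R e) \<bullet> e = y \<bullet> e + s" for y s using ee by (simp add: inner_add_left)
  have above: "y \<bullet> e > g (y - (y \<bullet> e) *\<^sub>R e)" if "y \<in> \<Omega> \<inter> ball x0 \<rho>" for y
  proof -
    have "y \<in> cball x0 R" using near[of y 0] that \<rho> by simp
    then have "y \<in> \<Omega> \<inter> U" using that R by blast
    then show ?thesis unfolding \<Omega>U by simp
  qed
  have 1: "y + s *\<^sub>R e \<in> \<Omega>" if y: "y \<in> \<Omega> \<inter> ball x0 \<rho>" and s: "0 \<le> s" "s \<le> \<rho>" for y s
  proof -
    have "y + s *\<^sub>R e \<in> U" using near y s R by blast
    moreover have "(y + s *\<^sub>R e) \<bullet> e > g ((y + s *\<^sub>R e) - ((y + s *\<^sub>R e) \<bullet> e) *\<^sub>R e)"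
      unfolding up perp using above[OF y] s by simp
    ultimately have "y + s *\<^sub>R e \<in> \<Omega> \<inter> U" unfolding \<Omega>U by simp
    then show ?thesis by simp
  qed
  have 2: "closure ((\<lambda>y. y + s *\<^sub>R e) ` (\<Omega> \<inter> ball x0 \<rho>)) \<subseteq> \<Omega>" if s: "0 < s" "s \<le> \<rho>" for s
  proof -
    define F where "F = cball x0 R \<inter> {z. g (z - (z \<bullet> e) *\<^sub>R e) + s \<le> z \<bullet> e}"
    have "continuous_on UNIV (\<lambda>z. g (z - (z \<bullet> e) *\<^sub>R e))"
      by (rule continuous_on_compose2[OF lipschitz_on_continuous_on[OF g]]) (auto
          intro!: continuous_intros)
    then have "closed {z. g (z - (z \<bullet> e) *\<^sub>R e) + s \<le> z \<bullet> e}"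
      by (intro closed_Collect_le continuous_intros) auto
    then have "closed F" unfolding F_def by (intro closed_Int) auto
    moreover have "(\<lambda>y. y + s *\<^sub>R e) ` (\<Omega> \<inter> ball x0 \<rho>) \<subseteq> F"
    proof
      fix z assume "z \<in> (\<lambda>y. y + s *\<^sub>R e) ` (\<Omega> \<inter> ball x0 \<rho>)"
      then obtain y where y: "y \<in> \<Omega> \<inter> ball x0 \<rho>" "z = y + s *\<^sub>R e" by blast
      have "z \<in> cball x0 R" unfolding y(2) using y s by (intro near) auto
      moreover have "g (z - (z \<bullet> e) *\<^sub>R e) + s \<le> z \<bullet> e"
        unfolding y(2) up perp using above[OF y(1)] by simp
      ultimately show "z \<in> F" by (simp add: F_def)
    qed
    ultimately have "closure ((\<lambda>y. y + s *\<^sub>R e) ` (\<Omega> \<inter> ball x0 \<rho>)) \<subseteq> F"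
        by (rule closure_minimal[rotated])
    also have "F \<subseteq> \<Omega>"
    proof
      fix z assume "z \<in> F"
      then have "z \<in> {y \<in> U. y \<bullet> e > g (y - (y \<bullet> e) *\<^sub>R e)}" using s R by (auto simp: F_def)
      then show "z \<in> \<Omega>" using \<Omega>U by blast
    qed
    finally show ?thesis .
  qed
  show ?thesis by (rule that[OF \<rho> e 1 2])
qed

text \<open>
  The mass in a strip at the boundary is at most twice the mass of the strip moved into the
  interior plus twice the square of the increment.
\<close>

lemma shifted_square_estimate:
  fixes \<phi> :: "real^'n \<Rightarrow> real"
  assumes C1: "C1_grad \<phi> \<psi>" and [measurable]: "S \<in> sets borel" "K \<in> sets borel" "\<Omega> \<in> sets borel"
    and seg: "\<And>x s. x \<in> S \<Longrightarrow> s \<in> {0..1} \<Longrightarrow> x + s *\<^sub>R z \<in> \<Omega>"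
    and K: "\<And>x. x \<in> S \<Longrightarrow> x + z \<in> K"
  shows "sq_mass S \<phi> \<le>
      ennreal (2 * (norm z)\<^sup>2) * sq_norm_mass \<Omega> \<psi> + 2 * sq_mass K \<phi>"
proof -
  note [measurable] = C1_grad_measurable[OF C1]
  define J where "J = sq_mass K \<phi>"
  have "sq_mass S \<phi> \<le>
     (\<integral>\<^sup>+x. 2 * (ennreal ((\<phi> (x + z) - \<phi> x)\<^sup>2) * indicator S x) + 2 * (ennreal ((\<phi> (z + x))\<^sup>2) *
         indicator K (z + x)) \<partial>lborel)"
  proof (rule nn_integral_mono)
    fix x
    show "ennreal ((\<phi> x)\<^sup>2) * indicator S x \<le> 
      2 * (ennreal ((\<phi> (x + z) - \<phi> x)\<^sup>2) * indicator S x) + 2 * (ennreal ((\<phi> (z + x))\<^sup>2) * indicator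
          K (z + x))"
    proof (cases "x \<in> S")
      case True
      have "(\<phi> x)\<^sup>2 \<le> 2 * (\<phi> (x + z) - \<phi> x)\<^sup>2 + 2 * (\<phi> (z + x))\<^sup>2"
        using zero_le_power2[of "2 * \<phi> (x + z) - \<phi> x"] by (simp add: power2_eq_square algebra_simps)
      then have "ennreal ((\<phi> x)\<^sup>2) \<le> ennreal (2 * (\<phi> (x + z) - \<phi> x)\<^sup>2 + 2 * (\<phi> (z + x))\<^sup>2)"
          by (rule ennreal_leI)
      also have "\<dots> = 2 * ennreal ((\<phi> (x + z) - \<phi> x)\<^sup>2) + 2 * ennreal ((\<phi> (z + x))\<^sup>2)"
        by (simp add: ennreal_plus ennreal_mult)
      finally show ?thesis using True K[OF True] by (simp add: add.commute)
    qed simp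
  qed
  also have "\<dots> = 2 * (\<integral>\<^sup>+x\<in>S. ennreal ((\<phi> (x + z) - \<phi> x)\<^sup>2) \<partial>lborel)
      + 2 * (\<integral>\<^sup>+x. ennreal ((\<phi> (z + x))\<^sup>2) * indicator K (z + x) \<partial>lborel)"
    by (subst nn_integral_add, measurable) (simp add: nn_integral_cmult)
  also have "(\<integral>\<^sup>+x. ennreal ((\<phi> (z + x))\<^sup>2) * indicator K (z + x) \<partial>lborel) = J"
    unfolding J_def by (rule nn_integral_lborel_shift) measurable
  also have "2 * (\<integral>\<^sup>+x\<in>S. ennreal ((\<phi> (x + z) - \<phi> x)\<^sup>2) \<partial>lborel) \<le>
      2 * (ennreal ((norm z)\<^sup>2) * sq_norm_mass \<Omega> \<psi>)"
    by (intro mult_left_mono C1_translation_estimate[OF C1] seg) auto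
  finally show ?thesis unfolding J_def by (simp add: ennreal_mult mult_ac)
qed

text \<open>
  Finitely many boundary balls cover the frontier. The strip in each of them is pushed by a small
  distance \<open>s\<close> into a compact subset \<open>K\<close> of \<open>\<Omega>\<close>, at the cost of \<open>s\<^sup>2\<close> times the Dirichlet
  integral, and \<open>K\<close> also contains what the balls leave uncovered. The interior estimate for \<open>K\<close>
  costs \<open>r\<^sup>2\<close> times the Dirichlet integral; here \<open>s\<close> is chosen first, then \<open>r\<close> in dependence of
  \<open>K\<close>.
\<close>

lemma finite_rank_L2_estimate:
  fixes \<Omega> :: "(real^'n) set"
  assumes \<Omega>: "lipschitz_domain \<Omega>" and \<epsilon>: "\<epsilon> > 0"
  obtains D r C where "finite D" "r > 0" "0 \<le> C" "\<And>q. q \<in> D \<Longrightarrow> ball q r \<subseteq> \<Omega>"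
    "\<And>\<phi> \<psi>. C1_grad \<phi> \<psi> \<Longrightarrow> sq_mass \<Omega> \<phi> \<le>
        ennreal \<epsilon> * sq_norm_mass \<Omega> \<psi> +
        ennreal (C * (\<Sum>q\<in>D. (LBINT x:ball q r. \<phi> x)\<^sup>2))"
proof -
  have op: "open \<Omega>" and bd: "bounded \<Omega>" using \<Omega> by (auto simp: lipschitz_domain_def)
  have "\<forall>x\<in>frontier \<Omega>. \<exists>\<rho> e. \<rho> > 0 \<and> norm e = 1 \<and>
      (\<forall>y s. y \<in> \<Omega> \<inter> ball x \<rho> \<longrightarrow> 0 \<le> s \<longrightarrow> s \<le> \<rho> \<longrightarrow> y + s *\<^sub>R e \<in> \<Omega>) \<and>
      (\<forall>s. 0 < s \<longrightarrow> s \<le> \<rho> \<longrightarrow> closure ((\<lambda>y. y + s *\<^sub>R e) ` (\<Omega> \<inter> ball x \<rho>)) \<subseteq> \<Omega>)"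
    by (rule ballI, erule lipschitz_domain_boundary[OF \<Omega>]) blast
  then obtain \<rho> e where \<rho>e: "\<And>x. x \<in> frontier \<Omega> \<Longrightarrow> \<rho> x > 0 \<and> norm (e x) = 1 \<and>
      (\<forall>y s. y \<in> \<Omega> \<inter> ball x (\<rho> x) \<longrightarrow> 0 \<le> s \<longrightarrow> s \<le> \<rho> x \<longrightarrow> y + s *\<^sub>R e x \<in> \<Omega>) \<and>
      (\<forall>s. 0 < s \<longrightarrow> s \<le> \<rho> x \<longrightarrow> closure ((\<lambda>y. y + s *\<^sub>R e x) ` (\<Omega> \<inter> ball x (\<rho> x))) \<subseteq> \<Omega>)"
    by metis
  have into: "y + s *\<^sub>R e x \<in> \<Omega>"
    if "x \<in> frontier \<Omega>" "y \<in> \<Omega> \<inter> ball x (\<rho> x)" "0 \<le> s" "s \<le> \<rho> x" for x y s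
    using conjunct1[OF conjunct2[OF conjunct2[OF \<rho>e[OF that(1)]]], rule_format, OF that(2-4)] .
  have "compact (frontier \<Omega>)" using bd by (simp add: compact_frontier_bounded)
  moreover have "frontier \<Omega> \<subseteq> (\<Union>x\<in>frontier \<Omega>. ball x (\<rho> x))"
  proof
    fix x assume x: "x \<in> frontier \<Omega>"
    then have "x \<in> ball x (\<rho> x)" using \<rho>e[OF x] by simp
    then show "x \<in> (\<Union>x\<in>frontier \<Omega>. ball x (\<rho> x))" using x by blast
  qed
  ultimately obtain X where X: "X \<subseteq> frontier \<Omega>" "finite X" "frontier \<Omega> \<subseteq> (\<Union>x\<in>X. ball x (\<rho> x))"
    by (rule compactE_image[OF _ open_ball])
  define N where "N = real (card X)"
  have N0: "0 \<le> N" by (simp add: N_def)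
  \<comment> \<open>Small enough for every boundary ball, and such that the strips together cost at most \<open>\<epsilon> / 2\<close>;
      the bound by \<open>1\<close> gives \<open>s\<^sup>2 \<le> s\<close>.\<close>
  define s where "s = Min (insert (min 1 (\<epsilon> / (4 * (N + 1)))) (\<rho> ` X))"
  have s0: "s > 0" unfolding s_def using X \<rho>e \<epsilon> N0 by (subst Min_gr_iff) auto
  have s\<rho>: "s \<le> \<rho> x" if "x \<in> X" for x unfolding s_def using X that by (intro Min_le) auto
  have smin: "s \<le> min 1 (\<epsilon> / (4 * (N + 1)))" unfolding s_def using X by (intro Min_le) auto
  have s2: "2 * N * s\<^sup>2 \<le> \<epsilon> / 2"
  proof -
    have "s\<^sup>2 \<le> s" using smin s0 by (simp add: power2_eq_square mult_left_le)
    then have "2 * N * s\<^sup>2 \<le> 2 * (N + 1) * s" using N0 s0 by (intro mult_mono) auto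
    also have "\<dots> \<le> 2 * (N + 1) * (\<epsilon> / (4 * (N + 1)))" using N0 smin by (intro mult_left_mono) auto
    also have "\<dots> = \<epsilon> / 2" using N0 by (simp add: field_simps)
    finally show ?thesis .
  qed
  define S where "S x = \<Omega> \<inter> ball x (\<rho> x)" for x
  define K where "K = (closure \<Omega> - (\<Union>x\<in>X. ball x (\<rho> x))) \<union> (\<Union>x\<in>X. closure ((\<lambda>y. y +
      s *\<^sub>R e x) ` S x))"
  have K\<Omega>: "K \<subseteq> \<Omega>"
  proof -
    have "closure \<Omega> - (\<Union>x\<in>X. ball x (\<rho> x)) \<subseteq> \<Omega>"
      using X(3) op by (auto simp: frontier_def interior_open)
    moreover have "closure ((\<lambda>y. y + s *\<^sub>R e x) ` S x) \<subseteq> \<Omega>" if "x \<in> X" for x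
      using \<rho>e[of x] that X(1) s\<rho>[OF that] s0 unfolding S_def by blast
    ultimately show ?thesis unfolding K_def by blast
  qed
  have Kc: "compact K"
  proof -
    have "closed K" unfolding K_def using X(2)
        by (intro closed_Un closed_Diff closed_UN open_UN) auto
    moreover have "bounded K" using K\<Omega> bd bounded_subset by blast
    ultimately show ?thesis by (simp add: compact_eq_bounded_closed)
  qed
  obtain r0 where r0: "r0 > 0" "(\<Union>x\<in>K. ball x r0) \<subseteq> \<Omega>"
    using compact_subset_open_imp_ball_epsilon_subset[OF Kc op K\<Omega>] by blast
  define k where "k = 2 * (1 + 2 * N) * 8 * 2 ^ CARD('n)"
  have k0: "k > 0" using N0 by (simp add: k_def)
  define r where "r = min (r0 / 2) (min 1 (\<epsilon> / k))"
  have r: "r > 0" "2 * r \<le> r0" "r \<le> 1" "r \<le> \<epsilon> / k" using r0 \<epsilon> k0 by (auto simp: r_def)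
  have r2: "(1 + 2 * N) * (8 * r\<^sup>2 * 2 ^ CARD('n)) \<le> \<epsilon> / 2"
  proof -
    have "r\<^sup>2 \<le> r" using r by (simp add: power2_eq_square mult_left_le)
    then have "k * r\<^sup>2 \<le> k * (\<epsilon> / k)" using r(4) k0 by (intro mult_left_mono) auto
    then have "k * r\<^sup>2 \<le> \<epsilon>" using k0 by simp
    then show ?thesis by (simp add: k_def algebra_simps)
  qed
  \<comment> \<open>The ball centres are taken in \<open>K\<close>, so that the balls themselves stay inside \<open>\<Omega>\<close>.\<close>
  have Kcov: "K \<subseteq> (\<Union>q\<in>K. ball q r)" using r by auto
  obtain D where D: "D \<subseteq> K" "finite D" "K \<subseteq> (\<Union>q\<in>D. ball q r)"
    by (rule compactE_image[OF Kc open_ball Kcov])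
  define b where "b = measure lborel (ball (0::real^'n) r)"
  have subr: "ball x (2 * r) \<subseteq> \<Omega>" if "x \<in> K" for x
    using r0(2) that subset_ball[OF r(2), of x] by blast
  show ?thesis
  proof (rule that[of D r "(1 + 2 * N) * (2 * measure lborel K / b\<^sup>2)"])
    show "finite D" "r > 0" by fact+
    show "0 \<le> (1 + 2 * N) * (2 * measure lborel K / b\<^sup>2)" using N0 by simp
    show "ball q r \<subseteq> \<Omega>" if "q \<in> D" for q
    proof -
      have "ball q r \<subseteq> ball q (2 * r)" using r by (intro subset_ball) auto
      then show ?thesis using subr[of q] that D by blast
    qed
    fix \<phi> :: "real^'n \<Rightarrow> real" and \<psi> assume C1: "C1_grad \<phi> \<psi>"
    note [measurable] = C1_grad_measurable[OF C1]
    have [measurable]: "\<Omega> \<in> sets borel" "K \<in> sets borel" "\<And>x. S x \<in> sets borel"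
      using op Kc by (auto simp: S_def intro: borel_compact)
    define G where "G = sq_norm_mass \<Omega> \<psi>"
    define J where "J = sq_mass K \<phi>"
    define q where "q = 2 * measure lborel K / b\<^sup>2 * (\<Sum>q\<in>D. (LBINT x:ball q r. \<phi> x)\<^sup>2)"
    have q0: "0 \<le> q" by (simp add: q_def sum_nonneg)
    have J: "J \<le> ennreal (8 * r\<^sup>2 * 2 ^ CARD('n)) * G + ennreal q"
      unfolding J_def G_def q_def b_def
      by (rule C1_interior_estimate[OF C1 Kc _ r(1) subr D(2,3)]) auto
    have strip: "sq_mass (S y) \<phi> \<le> ennreal (2 * s\<^sup>2) * G + 2 * J" if y: "y \<in> X" for y
    proof -
      have yf: "y \<in> frontier \<Omega>" using y X by blast
      have n: "norm (s *\<^sub>R e y) = s" using \<rho>e[OF yf] s0 by simp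
      have "sq_mass (S y) \<phi> \<le> ennreal (2 * (norm (s *\<^sub>R e y))\<^sup>2) * G + 2 * J"
        unfolding G_def J_def
      proof (rule shifted_square_estimate[OF C1])
        fix x and h :: real assume x: "x \<in> S y" and h: "h \<in> {0..1}"
        have "h * s \<le> \<rho> y" using h s\<rho>[OF y] s0 by (auto intro: order.trans[OF mult_left_le_one_le])
        moreover have "0 \<le> h * s" using h s0 by simp
        ultimately have "x + (h * s) *\<^sub>R e y \<in> \<Omega>" using x unfolding S_def by (intro into[OF yf])
        then show "x + h *\<^sub>R s *\<^sub>R e y \<in> \<Omega>" by simp
      next
        fix x assume "x \<in> S y"
        then have "x + s *\<^sub>R e y \<in> closure ((\<lambda>x. x + s *\<^sub>R e y) ` S y)"
          by (intro subsetD[OF closure_subset] imageI)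
        then show "x + s *\<^sub>R e y \<in> K" unfolding K_def using y by blast
      qed measurable
      then show ?thesis unfolding n .
    qed
    have "sq_mass \<Omega> \<phi> \<le>
       (\<integral>\<^sup>+x. ennreal ((\<phi> x)\<^sup>2) * indicator K x + (\<Sum>y\<in>X. ennreal ((\<phi> x)\<^sup>2) * indicator (S y) x)
           \<partial>lborel)"
    proof (rule nn_integral_mono)
      fix x
      show "ennreal ((\<phi> x)\<^sup>2) * indicator \<Omega> x \<le> ennreal ((\<phi> x)\<^sup>2) * indicator K x +
          (\<Sum>y\<in>X. ennreal ((\<phi> x)\<^sup>2) * indicator (S y) x)"
      proof (cases "x \<in> \<Omega>")
        case True
        show ?thesis
        proof (cases "x \<in> K")
          case False
          then obtain y where y: "y \<in> X" "x \<in> S y" using True closure_subset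
              by (auto simp: K_def S_def)
          have "ennreal ((\<phi> x)\<^sup>2) * indicator \<Omega> x = ennreal ((\<phi> x)\<^sup>2) * indicator (S y) x"
              using y True by simp
          also have "\<dots> \<le> (\<Sum>y\<in>X. ennreal ((\<phi> x)\<^sup>2) * indicator (S y) x)" using y X
              by (intro member_le_sum) auto
          finally show ?thesis by (simp add: add_increasing)
        qed (simp add: add_increasing2 True)
      qed simp
    qed
    also have "\<dots> = J + (\<Sum>y\<in>X. \<integral>\<^sup>+x\<in>S y. ennreal ((\<phi> x)\<^sup>2) \<partial>lborel)"
      unfolding J_def by (subst nn_integral_add, measurable) (subst nn_integral_sum, auto)
    also have "\<dots> \<le> J + (\<Sum>y\<in>X. ennreal (2 * s\<^sup>2) * G + 2 * J)"
      by (intro add_left_mono sum_mono strip)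
    also have "\<dots> = J + ennreal N * (ennreal (2 * s\<^sup>2) * G + 2 * J)"
      by (simp add: N_def ennreal_of_nat_eq_real_of_nat)
    also have "\<dots> = ennreal (1 + 2 * N) * J + ennreal (2 * N * s\<^sup>2) * G"
      using N0 by (simp add: ennreal_plus ennreal_mult algebra_simps)
    also have "\<dots> \<le> ennreal (1 + 2 * N) * (ennreal (8 * r\<^sup>2 * 2 ^ CARD('n)) * G + ennreal q) +
        ennreal (\<epsilon> / 2) * G"
      by (intro add_mono mult_left_mono J mult_right_mono ennreal_leI s2) auto
    also have "\<dots> = ennreal ((1 + 2 * N) * (8 * r\<^sup>2 * 2 ^ CARD('n))) * G + ennreal ((1 +
        2 * N) * q) + ennreal (\<epsilon> / 2) * G"
      using N0 q0 by (simp add: ennreal_mult distrib_left mult_ac)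
    also have "\<dots> \<le> ennreal (\<epsilon> / 2) * G + ennreal ((1 + 2 * N) * q) + ennreal (\<epsilon> / 2) * G"
      by (intro add_right_mono mult_right_mono ennreal_leI r2) auto
    also have "\<dots> = ennreal (\<epsilon> / 2 + \<epsilon> / 2) * G + ennreal ((1 + 2 * N) * q)"
      using \<epsilon> by (subst ennreal_plus) (auto simp: distrib_right add_ac)
    finally show "sq_mass \<Omega> \<phi> \<le>
        ennreal \<epsilon> * sq_norm_mass \<Omega> \<psi> +
        ennreal ((1 + 2 * N) * (2 * measure lborel K / b\<^sup>2) * (\<Sum>q\<in>D. (LBINT x:ball q r. \<phi> x)\<^sup>2))"
      by (simp add: G_def q_def mult.assoc)
  qed
qed

section \<open>Square integrable functions\<close>

lemma L2_integrable_inner: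
  fixes f g :: "real^'n \<Rightarrow> 'b::euclidean_space"
  assumes f: "f \<in> L2 \<Omega>" and g: "g \<in> L2 \<Omega>"
  shows "integrable (lebesgue_on \<Omega>) (\<lambda>x. f x \<bullet> g x)"
proof (rule Bochner_Integration.integrable_bound)
  show "integrable (lebesgue_on \<Omega>) (\<lambda>x. (norm (f x))\<^sup>2 + (norm (g x))\<^sup>2)"
    using f g by (auto simp: L2_def)
  show "(\<lambda>x. f x \<bullet> g x) \<in> borel_measurable (lebesgue_on \<Omega>)"
    using f g by (auto simp: L2_def)
  show "AE x in lebesgue_on \<Omega>. norm (f x \<bullet> g x) \<le> norm ((norm (f x))\<^sup>2 + (norm (g x))\<^sup>2)"
  proof (rule AE_I2)
    fix x
    have "\<bar>f x \<bullet> g x\<bar> \<le> norm (f x) * norm (g x)" by (rule Cauchy_Schwarz_ineq2)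
    also have "\<dots> \<le> (norm (f x))\<^sup>2 + (norm (g x))\<^sup>2"
      using sum_squares_bound[of "norm (f x)" "norm (g x)"] mult_nonneg_nonneg[OF norm_ge_zero[of
          "f x"] norm_ge_zero[of "g x"]] by linarith
    finally show "norm (f x \<bullet> g x) \<le> norm ((norm (f x))\<^sup>2 + (norm (g x))\<^sup>2)" by simp
  qed
qed

lemma test_integrable:
  fixes F :: "real^'n \<Rightarrow> 'b::euclidean_space"
  assumes F: "F \<in> L2 \<Omega>" and \<phi>: "\<phi> \<in> L2 \<Omega>"
  shows "integrable (lebesgue_on \<Omega>) (\<lambda>x. \<phi> x *\<^sub>R F x :: 'b)"
proof (rule Bochner_Integration.integrable_bound)
  show "integrable (lebesgue_on \<Omega>) (\<lambda>x. (norm (\<phi> x))\<^sup>2 + (norm (F x))\<^sup>2)" using \<phi> F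
      by (auto simp: L2_def)
  show "(\<lambda>x. \<phi> x *\<^sub>R F x) \<in> borel_measurable (lebesgue_on \<Omega>)"
    using \<phi> F by (intro borel_measurable_scaleR) (auto simp: L2_def)
  have "norm (\<phi> x *\<^sub>R F x) \<le> (norm (\<phi> x))\<^sup>2 + (norm (F x))\<^sup>2" for x
    using sum_squares_bound[of "norm (\<phi> x)" "norm (F x)"] mult_nonneg_nonneg[OF norm_ge_zero[of
        "\<phi> x"] norm_ge_zero[of "F x"]]
    unfolding norm_scaleR real_norm_def by linarith
  then show "AE x in lebesgue_on \<Omega>. norm (\<phi> x *\<^sub>R F x) \<le> norm ((norm (\<phi> x))\<^sup>2 + (norm (F x))\<^sup>2)"
      by simp
qed

lemma L2_lincomb:
  fixes f g :: "real^'n \<Rightarrow> 'b::euclidean_space"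
  assumes f: "f \<in> L2 \<Omega>" and g: "g \<in> L2 \<Omega>"
  shows "(\<lambda>x. a *\<^sub>R f x + b *\<^sub>R g x) \<in> L2 \<Omega>"
proof -
  have "integrable (lebesgue_on \<Omega>) (\<lambda>x. a\<^sup>2 * (f x \<bullet> f x) + (2 * a * b) * (f x \<bullet> g x) +
      b\<^sup>2 * (g x \<bullet> g x))"
    using L2_integrable_inner[OF f f] L2_integrable_inner[OF f g] L2_integrable_inner[OF g g]
        by simp
  moreover have "(norm (a *\<^sub>R f x + b *\<^sub>R g x))\<^sup>2 = a\<^sup>2 * (f x \<bullet> f x) + (2 * a * b) * (f x \<bullet> g x) +
      b\<^sup>2 * (g x \<bullet> g x)" for x
    unfolding power2_norm_eq_inner by (simp add: inner_add_left inner_add_right inner_commute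
        power2_eq_square algebra_simps)
  ultimately show ?thesis using f g by (auto simp: L2_def)
qed

lemma finite_measure_lebesgue_on:
  fixes \<Omega> :: "(real^'n) set"
  assumes "bounded \<Omega>" "open \<Omega>" shows "finite_measure (lebesgue_on \<Omega>)"
proof
  have "emeasure lborel \<Omega> < \<infinity>" by (rule emeasure_bounded_finite) fact
  then show "emeasure (lebesgue_on \<Omega>) (space (lebesgue_on \<Omega>)) \<noteq> \<infinity>"
    using assms by (simp add: emeasure_restrict_space space_restrict_space)
qed

lemma L2_integrable:
  fixes f :: "real^'n \<Rightarrow> 'b::euclidean_space"
  assumes \<Omega>: "bounded \<Omega>" "open \<Omega>" and f: "f \<in> L2 \<Omega>"
  shows "integrable (lebesgue_on \<Omega>) f"
proof (rule Bochner_Integration.integrable_bound)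
  interpret finite_measure "lebesgue_on \<Omega>" by (rule finite_measure_lebesgue_on[OF \<Omega>])
  show "integrable (lebesgue_on \<Omega>) (\<lambda>x. 1 + (norm (f x))\<^sup>2)" using f by (auto simp: L2_def)
  show "f \<in> borel_measurable (lebesgue_on \<Omega>)" using f by (auto simp: L2_def)
  have "norm (f x) \<le> 1 + (norm (f x))\<^sup>2" for x
    using sum_squares_bound[of 1 "norm (f x)"] norm_ge_zero[of "f x"] by (simp del: norm_ge_zero) 
  then show "AE x in lebesgue_on \<Omega>. norm (f x) \<le> norm (1 + (norm (f x))\<^sup>2)" by simp
qed

lemma lebesgue_on_borel:
  fixes f :: "real^'n \<Rightarrow> 'b::euclidean_space"
  assumes \<Omega>: "open \<Omega>" and f: "f \<in> borel_measurable borel"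
  shows integrable_lebesgue_on_borel: "integrable (lebesgue_on \<Omega>) f \<longleftrightarrow> set_integrable lborel \<Omega> f"
    and integral_lebesgue_on_borel: "(LINT x|lebesgue_on \<Omega>. f x) = (LBINT x:\<Omega>. f x)"
proof -
  have m: "(\<lambda>x. indicator \<Omega> x *\<^sub>R f x) \<in> borel_measurable lborel" using \<Omega> f by simp
  show "integrable (lebesgue_on \<Omega>) f \<longleftrightarrow> set_integrable lborel \<Omega> f"
    using \<Omega> by (subst integrable_restrict_space) (auto simp: set_integrable_def
        integrable_completion[OF m])
  show "(LINT x|lebesgue_on \<Omega>. f x) = (LBINT x:\<Omega>. f x)"
    using \<Omega> by (subst integral_restrict_space) (auto simp: set_lebesgue_integral_def
        integral_completion[OF m])
qed

lemma borel_measurable_lebesgue_on: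
  assumes "f \<in> borel_measurable borel" shows "f \<in> borel_measurable (lebesgue_on \<Omega>)"
  by (rule measurable_restrict_space1, rule measurable_completion) (use assms in simp)

lemma continuous_in_L2:
  fixes f :: "real^'n \<Rightarrow> 'b::euclidean_space"
  assumes \<Omega>: "bounded \<Omega>" "open \<Omega>" and f: "continuous_on UNIV f"
  shows "f \<in> L2 \<Omega>"
proof -
  have m: "f \<in> borel_measurable borel" using f by (rule borel_measurable_continuous_onI)
  have "set_integrable lborel \<Omega> (\<lambda>x. (norm (f x))\<^sup>2)"
    using \<Omega> f by (intro continuous_set_integrable_bounded continuous_intros) auto
  then have "integrable (lebesgue_on \<Omega>) (\<lambda>x. (norm (f x))\<^sup>2)"
    using m \<Omega> by (subst integrable_lebesgue_on_borel) auto
  then show ?thesis using m by (simp add: L2_def borel_measurable_lebesgue_on)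
qed

definition L2_inner :: "(real^'n) set \<Rightarrow> (real^'n \<Rightarrow> 'b::euclidean_space) \<Rightarrow> (real^'n \<Rightarrow> 'b) \<Rightarrow> real"
    where
  "L2_inner \<Omega> f g = (LINT x|lebesgue_on \<Omega>. f x \<bullet> g x)"

lemma L2_inner_commute: "L2_inner \<Omega> f g = L2_inner \<Omega> g f"
  by (simp add: L2_inner_def inner_commute)

lemma L2_inner_self: "L2_inner \<Omega> f f = (LINT x|lebesgue_on \<Omega>. (norm (f x))\<^sup>2)"
  by (simp add: L2_inner_def power2_norm_eq_inner)

lemma L2_inner_nonneg: "0 \<le> L2_inner \<Omega> f f"
  by (simp add: L2_inner_self)

lemma L2_inner_left:
  assumes "f \<in> L2 \<Omega>" "g \<in> L2 \<Omega>" "h \<in> L2 \<Omega>"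
  shows "L2_inner \<Omega> (\<lambda>x. a *\<^sub>R f x + b *\<^sub>R g x) h = a * L2_inner \<Omega> f h + b * L2_inner \<Omega> g h"
  using L2_integrable_inner[OF assms(1,3)] L2_integrable_inner[OF assms(2,3)]
  by (simp add: L2_inner_def inner_add_left)

lemma L2_inner_cong_AE:
  assumes f: "f \<in> L2 \<Omega>" "f' \<in> L2 \<Omega>" "g \<in> L2 \<Omega>" "g' \<in> L2 \<Omega>"
    and AE: "AE x in lebesgue_on \<Omega>. f x = f' x" "AE x in lebesgue_on \<Omega>. g x = g' x"
  shows "L2_inner \<Omega> f g = L2_inner \<Omega> f' g'"
  unfolding L2_inner_def
proof (rule integral_cong_AE)
  show "(\<lambda>x. f x \<bullet> g x) \<in> borel_measurable (lebesgue_on \<Omega>)"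
      "(\<lambda>x. f' x \<bullet> g' x) \<in> borel_measurable (lebesgue_on \<Omega>)"
    using f by (auto simp: L2_def)
  show "AE x in lebesgue_on \<Omega>. f x \<bullet> g x = f' x \<bullet> g' x" using AE by eventually_elim simp
qed

lemma L2_function_space: "function_space (L2 \<Omega> :: (real^'n \<Rightarrow> real) set)"
proof
  fix u v :: "real^'n \<Rightarrow> real" and a b assume "u \<in> L2 \<Omega>" "v \<in> L2 \<Omega>"
  then show "lincomb a u b v \<in> L2 \<Omega>" using L2_lincomb[of u \<Omega> v a b] by (simp add: lincomb_def)
qed

lemma L2_inner_sym_form: "sym_form (L2 \<Omega>) (L2_inner \<Omega> :: (real^'n \<Rightarrow> real) \<Rightarrow> _)"
  unfolding sym_form_def
proof (intro conjI ballI allI)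
  fix u v w :: "real^'n \<Rightarrow> real" and a b
  assume "u \<in> L2 \<Omega>" "v \<in> L2 \<Omega>" "w \<in> L2 \<Omega>"
  then show "L2_inner \<Omega> (lincomb a u b v) w = a * L2_inner \<Omega> u w + b * L2_inner \<Omega> v w"
    using L2_inner_left[of u \<Omega> v w a b] by (simp add: lincomb_def)
qed (rule L2_inner_commute)

lemma integral_square_le:
  fixes g :: "'a \<Rightarrow> real"
  assumes "finite_measure M" "integrable M g" "integrable M (\<lambda>x. (g x)\<^sup>2)"
  shows "(LINT x|M. g x)\<^sup>2 \<le> measure M (space M) * (LINT x|M. (g x)\<^sup>2)"
proof -
  interpret finite_measure M by fact
  have fin: "emeasure M (space M) < \<infinity>" by (simp flip: less_top)
  have e: "set_integrable M (space M) f \<longleftrightarrow> integrable M f" "(LINT x:space M|M. f x) =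
      (LINT x|M. f x)" for f :: "'a \<Rightarrow> real"
    unfolding set_integrable_def set_lebesgue_integral_def
    by (intro Bochner_Integration.integrable_cong Bochner_Integration.integral_cong; simp)+
  show ?thesis
    using set_integral_Cauchy_Schwarz[OF sets.top fin, of g] assms(2,3) by (simp add: e)
qed

abbreviation L2_sqdist :: "(real^'n) set \<Rightarrow> (real^'n \<Rightarrow> 'b::euclidean_space) \<Rightarrow> (real^'n \<Rightarrow> 'b) \<Rightarrow> real"
    where
  "L2_sqdist \<Omega> f g \<equiv> (LINT x|lebesgue_on \<Omega>. (norm (f x - g x))\<^sup>2)"

text \<open>
  The Riesz-Fischer theorem. On a domain of finite measure a subsequence with rapidly decreasing
  \<open>L\<^sup>2\<close> differences has summable \<open>L\<^sup>1\<close> differences, hence converges almost everywhere. Fatou's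
  lemma shows that its limit is also the limit in \<open>L\<^sup>2\<close>.
\<close>

lemma L2_complete:
  fixes f :: "nat \<Rightarrow> real^'n \<Rightarrow> 'b::euclidean_space"
  assumes \<Omega>: "bounded \<Omega>" "open \<Omega>" and f: "\<And>n. f n \<in> L2 \<Omega>"
    and Cauchy: "\<And>\<epsilon>. \<epsilon> > 0 \<Longrightarrow> \<exists>N. \<forall>m\<ge>N. \<forall>n\<ge>N. L2_sqdist \<Omega> (f m) (f n) < \<epsilon>"
  obtains g where "g \<in> L2 \<Omega>" "(\<lambda>n. L2_sqdist \<Omega> (f n) g) \<longlonglongrightarrow> 0"
proof -
  define M where "M = lebesgue_on \<Omega>"
  interpret finite_measure M unfolding M_def by (rule finite_measure_lebesgue_on[OF \<Omega>])
  have mf [measurable]: "f n \<in> borel_measurable M" for n using f by (auto simp: L2_def M_def)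
  have fd: "(\<lambda>x. f m x - f n x) \<in> L2 \<Omega>" for m n using L2_lincomb[OF f f, of 1 m "-1" n] by simp
  have int2: "integrable M (\<lambda>x. (norm (f m x - f n x))\<^sup>2)" for m n using fd[of m n]
      by (simp add: L2_def M_def)
  have int1: "integrable M (\<lambda>x. norm (f m x - f n x))" for m n
    using L2_integrable[OF \<Omega> fd[of m n]] unfolding M_def by (rule integrable_norm)
  define c where "c = measure M (space M) + 1"
  have c: "c > 0" using measure_nonneg[of M "space M"] unfolding c_def by linarith
  have "\<exists>N. \<forall>m\<ge>N. \<forall>n\<ge>N. (LINT x|M. (norm (f m x - f n x))\<^sup>2) < (1/4)^k / c" for k
    unfolding M_def using c by (intro Cauchy) simp
  then obtain N where N: "\<And>k m n. m \<ge> N k \<Longrightarrow> n \<ge> N k \<Longrightarrow> (LINT x|M. (norm (f m x - f n x))\<^sup>2) <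
      (1/4)^k / c"
    by metis
  \<comment> \<open>Both \<open>r k\<close> and \<open>r (Suc k)\<close> lie beyond \<open>N k\<close>.\<close>
  define r where "r k = (\<Sum>j\<le>k. N j)" for k
  have rN: "r k \<ge> N k" "r (Suc k) \<ge> N k" for k
    unfolding r_def by (auto intro: member_le_sum trans_le_add1)
  have rinf: "r k \<ge> N j" if "k \<ge> j" for j k unfolding r_def using that by (intro member_le_sum) auto
  define h where "h k x = f (r (Suc k)) x - f (r k) x" for k x
  have mh [measurable]: "h k \<in> borel_measurable M" for k unfolding h_def by simp
  have h1: "(LINT x|M. norm (h k x)) \<le> (1/2)^k" for k
  proof -
    have "(LINT x|M. norm (h k x))\<^sup>2 \<le> measure M (space M) * (LINT x|M. (norm (h k x))\<^sup>2)"
      unfolding h_def by (intro integral_square_le int1 int2) unfold_locales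
    also have "\<dots> \<le> c * ((1/4)^k / c)"
      using N[OF rN(2,1)] unfolding h_def by (intro mult_mono) (auto simp: c_def less_imp_le)
    also have "\<dots> = ((1/2)^k)\<^sup>2" using c
        by (simp add: power_divide power_mult[symmetric] mult.commute[of k] power2_eq_square
        power_mult_distrib[symmetric] flip: power_mult)
    finally show ?thesis by (rule power2_le_imp_le) simp
  qed
  have "(\<integral>\<^sup>+x. (\<Sum>k. ennreal (norm (h k x))) \<partial>M) = (\<Sum>k. \<integral>\<^sup>+x. ennreal (norm (h k x)) \<partial>M)"
    by (rule nn_integral_suminf) simp
  also have "\<dots> \<le> (\<Sum>k. ennreal ((1/2)^k))"
  proof (rule suminf_le)
    fix k
    have "(\<integral>\<^sup>+x. ennreal (norm (h k x)) \<partial>M) = ennreal (LINT x|M. norm (h k x))"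
      unfolding h_def by (intro nn_integral_eq_integral int1) simp
    also have "\<dots> \<le> ennreal ((1/2)^k)" by (rule ennreal_leI) (rule h1)
    finally show "(\<integral>\<^sup>+x. ennreal (norm (h k x)) \<partial>M) \<le> ennreal ((1/2)^k)" .
  qed auto
  also have "\<dots> = ennreal (\<Sum>k. (1/2)^k)" by (rule suminf_ennreal2) (auto intro: summable_geometric)
  finally have "(\<integral>\<^sup>+x. (\<Sum>k. ennreal (norm (h k x))) \<partial>M) \<noteq> \<infinity>" by (auto simp: top_unique)
  then have "AE x in M. (\<Sum>k. ennreal (norm (h k x))) \<noteq> \<infinity>" by (intro nn_integral_PInf_AE) auto
  then have conv: "AE x in M. convergent (\<lambda>k. f (r k) x)"
  proof eventually_elim
    case (elim x)
    then have "summable (\<lambda>k. norm (h k x))" by (intro summable_suminf_not_top) auto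
    then have "summable (\<lambda>k. h k x)" by (rule summable_norm_cancel)
    then have "convergent (\<lambda>n. f (r 0) x + (\<Sum>k<n. h k x))"
      by (intro convergent_add convergent_const) (simp add: summable_iff_convergent)
    moreover have "f (r 0) x + (\<Sum>k<n. h k x) = f (r n) x" for n
      unfolding h_def using sum_lessThan_telescope[of "\<lambda>k. f (r k) x" n] by simp
    ultimately show ?case by simp
  qed
  define g where "g x = lim (\<lambda>k. f (r k) x)" for x
  have mg [measurable]: "g \<in> borel_measurable M" unfolding g_def
      by (intro borel_measurable_lim_metric) simp
  have glim: "AE x in M. (\<lambda>k. f (r k) x) \<longlonglongrightarrow> g x"
    using conv by eventually_elim (simp add: g_def convergent_LIMSEQ_iff)
  have bound: "\<exists>N. \<forall>n\<ge>N. (\<integral>\<^sup>+x. ennreal ((norm (f n x - g x))\<^sup>2) \<partial>M) \<le> ennreal \<epsilon>"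
      if e: "\<epsilon> > 0" for \<epsilon>
  proof -
    obtain N0 where N0: "\<And>m n. m \<ge> N0 \<Longrightarrow> n \<ge> N0 \<Longrightarrow> (LINT x|M. (norm (f m x - f n x))\<^sup>2) < \<epsilon>"
      using Cauchy[OF e] unfolding M_def by blast
    obtain K where K: "(1/4)^K / c < \<epsilon>"
    proof -
      have "(\<lambda>k. (1/4)^k / c) \<longlonglongrightarrow> 0 / c" using c
          by (intro tendsto_divide LIMSEQ_power_zero tendsto_const) auto
      then have "eventually (\<lambda>k. (1/4)^k / c < \<epsilon>) sequentially" using e
          by (intro order_tendstoD(2)) auto
      then show ?thesis using that by (auto simp: eventually_sequentially)
    qed
    have "(\<integral>\<^sup>+x. ennreal ((norm (f n x - g x))\<^sup>2) \<partial>M) \<le> ennreal \<epsilon>" if n: "n \<ge> max N0 (N K)" for n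
    proof -
      have "(\<integral>\<^sup>+x. ennreal ((norm (f n x - g x))\<^sup>2) \<partial>M) = (\<integral>\<^sup>+x. liminf (\<lambda>k. ennreal ((norm (f n x -
          f (r k) x))\<^sup>2)) \<partial>M)"
      proof (rule nn_integral_cong_AE, use glim in eventually_elim)
        case (elim x)
        have "(\<lambda>k. ennreal ((norm (f n x - f (r k) x))\<^sup>2)) \<longlonglongrightarrow> ennreal ((norm (f n x - g x))\<^sup>2)"
          by (intro tendsto_intros tendsto_ennrealI elim)
        then show ?case by (metis lim_imp_Liminf sequentially_bot)
      qed
      also have "\<dots> \<le> liminf (\<lambda>k. \<integral>\<^sup>+x. ennreal ((norm (f n x - f (r k) x))\<^sup>2) \<partial>M)"
        by (rule nn_integral_liminf) simp
      also have "\<dots> \<le> ennreal \<epsilon>"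
      proof (rule Liminf_le)
        show "eventually (\<lambda>k. (\<integral>\<^sup>+x. ennreal ((norm (f n x - f (r k) x))\<^sup>2) \<partial>M) \<le>
            ennreal \<epsilon>) sequentially"
          using eventually_ge_at_top[of K]
        proof eventually_elim
          case (elim k)
          have "(LINT x|M. (norm (f n x - f (r k) x))\<^sup>2) < (1/4)^K / c"
            using n elim by (intro N rinf) auto
          moreover have "(\<integral>\<^sup>+x. ennreal ((norm (f n x - f (r k) x))\<^sup>2) \<partial>M) =
              ennreal (LINT x|M. (norm (f n x - f (r k) x))\<^sup>2)"
            by (intro nn_integral_eq_integral int2) simp
          ultimately show ?case using K by (simp add: ennreal_leI)
        qed
      qed simp
      finally show ?thesis .
    qed
    then show ?thesis by blast
  qed
  obtain n0 where n0: "(\<integral>\<^sup>+x. ennreal ((norm (f n0 x - g x))\<^sup>2) \<partial>M) \<le> ennreal 1" using bound[of 1]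
      by auto
  have "integrable M (\<lambda>x. (norm (f n0 x - g x))\<^sup>2)"
    by (rule integrableI_nonneg) (auto intro: le_less_trans[OF n0])
  then have "(\<lambda>x. f n0 x - g x) \<in> L2 \<Omega>" using mf[of n0] mg by (simp add: L2_def M_def)
  from L2_lincomb[OF f[of n0] this, of 1 "-1"] have gL: "g \<in> L2 \<Omega>" by simp
  have "(\<lambda>n. LINT x|M. (norm (f n x - g x))\<^sup>2) \<longlonglongrightarrow> 0"
  proof (rule LIMSEQ_I)
    fix \<epsilon> :: real assume "\<epsilon> > 0"
    then have e: "\<epsilon> / 2 > 0" by simp
    obtain N where N: "\<And>n. n \<ge> N \<Longrightarrow> (\<integral>\<^sup>+x. ennreal ((norm (f n x - g x))\<^sup>2) \<partial>M) \<le> ennreal (\<epsilon> / 2)"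
        using bound[OF e] by blast
    have "norm ((LINT x|M. (norm (f n x - g x))\<^sup>2) - 0) < \<epsilon>" if "n \<ge> N" for n
    proof -
      have "(LINT x|M. (norm (f n x - g x))\<^sup>2) \<le> \<epsilon> / 2" using N[OF that] e
          by (intro integral_real_bounded) auto
      moreover have "0 \<le> (LINT x|M. (norm (f n x - g x))\<^sup>2)" by simp
      ultimately show ?thesis using \<open>\<epsilon> > 0\<close> by (simp del: integral_nonneg_AE)
    qed
    then show "\<exists>no. \<forall>n\<ge>no. norm ((LINT x|M. (norm (f n x - g x))\<^sup>2) - 0) < \<epsilon>" by blast
  qed
  then show ?thesis using that[OF gL] by (simp add: M_def)
qed

lemma bounded_sequences_common_subsequence:
  fixes f :: "nat \<Rightarrow> nat \<Rightarrow> real"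
  assumes bd: "\<And>n k. \<bar>f n k\<bar> \<le> M n"
  obtains r where "strict_mono (r :: nat \<Rightarrow> nat)" "\<And>n. convergent (\<lambda>k. f n (r k))"
proof -
  interpret subseqs "\<lambda>n s. convergent (\<lambda>k. f n (s k))"
  proof
    fix n and s :: "nat \<Rightarrow> nat" assume "strict_mono s"
    have "bounded (range (\<lambda>k. f n (s k)))" using bd by (intro boundedI[of _ "M n"]) auto
    then obtain l r where "strict_mono (r :: nat \<Rightarrow> nat)" "((\<lambda>k. f n (s k)) \<circ> r) \<longlonglongrightarrow> l"
      using bounded_imp_convergent_subsequence by blast
    then show "\<exists>r'. strict_mono r' \<and> convergent (\<lambda>k. f n ((s \<circ> r') k))"
      by (auto simp: convergent_def o_def)
  qed
  have "convergent (\<lambda>k. f n (diagseq k))" for n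
  proof -
    have "convergent (\<lambda>k. f n ((diagseq \<circ> (+) (Suc n)) k))"
    proof (rule diagseq_holds)
      fix r s :: "nat \<Rightarrow> nat" and m assume "strict_mono r" "convergent (\<lambda>k. f m (s k))"
      then show "convergent (\<lambda>k. f m ((s \<circ> r) k))"
        using convergent_subseq_convergent[of "\<lambda>k. f m (s k)" r] by (simp add: o_def)
    qed
    then have "convergent (\<lambda>k. f n (diagseq (k + Suc n)))" by (simp add: o_def add.commute)
    then show ?thesis by (simp only: convergent_ignore_initial_segment[where f =
        "\<lambda>k. f n (diagseq k)"])
  qed
  then show ?thesis using that[OF subseq_diagseq] by blast
qed

section \<open>Gradients of test functions\<close>

lemma C1_grad_const: "C1_grad (\<lambda>x. c) (\<lambda>x. 0)"
  by (simp add: C1_grad_def GDERIV_const)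

lemma C1_grad_lincomb:
  assumes "C1_grad f F" "C1_grad g G"
  shows "C1_grad (\<lambda>x. a * f x + b * g x) (\<lambda>x. a *\<^sub>R F x + b *\<^sub>R G x)"
proof -
  have "GDERIV (\<lambda>x. a * f x + b * g x) x :> a *\<^sub>R F x + b *\<^sub>R G x" for x
    using assms unfolding C1_grad_def
    by (auto intro!: GDERIV_add GDERIV_DERIV_compose[where g = "\<lambda>t. a * t"
        for a] derivative_eq_intros)
  then show ?thesis using C1_grad_continuous[OF assms(1)] C1_grad_continuous[OF assms(2)]
    by (auto simp: C1_grad_def intro!: continuous_intros)
qed

lemma C1_grad_mult:
  assumes "C1_grad f F" "C1_grad g G"
  shows "C1_grad (\<lambda>x. f x * g x) (\<lambda>x. f x *\<^sub>R G x + g x *\<^sub>R F x)"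
proof -
  have "GDERIV (\<lambda>x. f x * g x) x :> f x *\<^sub>R G x + g x *\<^sub>R F x" for x
    using assms unfolding C1_grad_def by (auto intro!: GDERIV_mult)
  then show ?thesis using C1_grad_continuous[OF assms(1)] C1_grad_continuous[OF assms(2)]
    by (auto simp: C1_grad_def intro!: continuous_intros)
qed

lemma C1_grad_sum:
  assumes "finite A" "\<And>i. i \<in> A \<Longrightarrow> C1_grad (f i) (F i)"
  shows "C1_grad (\<lambda>x. \<Sum>i\<in>A. f i x) (\<lambda>x. \<Sum>i\<in>A. F i x)"
  using assms
proof (induction A)
  case empty
  then show ?case by (simp add: C1_grad_const)
next
  case (insert i A)
  then show ?case using C1_grad_lincomb[of "f i" "F i" "\<lambda>x. \<Sum>i\<in>A. f i x" "\<lambda>x. \<Sum>i\<in>A. F i x" 1 1]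
      by simp
qed

lemma C1_grad_zero_outside_support:
  assumes C1: "C1_grad f F" and x: "x \<notin> closure {x. f x \<noteq> 0}"
  shows "F x = 0"
proof -
  have "((\<lambda>x. 0) has_derivative (\<lambda>h. 0)) (at x)" by simp
  then have "(f has_derivative (\<lambda>h. 0)) (at x)"
  proof (rule has_derivative_transform_within_open)
    show "open (- closure {x. f x \<noteq> 0})" by auto
    show "0 = f y" if "y \<in> - closure {x. f x \<noteq> 0}" for y
      using that closure_subset[of "{x. f x \<noteq> 0}"] by auto
  qed (use x in auto)
  moreover have "(f has_derivative (\<lambda>h. h \<bullet> F x)) (at x)" using C1
      by (simp add: C1_grad_def gderiv_def)
  ultimately have "(\<lambda>h. 0) = (\<lambda>h. h \<bullet> F x)" by (rule has_derivative_unique)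
  then have "F x \<bullet> F x = 0" by metis
  then show ?thesis by simp
qed

lemma integral_lborel_shift:
  fixes f :: "real^'n \<Rightarrow> 'b::euclidean_space"
  assumes [measurable]: "f \<in> borel_measurable borel"
  shows "integrable lborel (\<lambda>x. f (c + x)) \<longleftrightarrow> integrable lborel f" "(LBINT x. f (c + x)) =
      (LBINT x. f x)"
proof -
  have "integrable lborel f \<longleftrightarrow> integrable (distr lborel borel ((+) c)) f"
      by (simp add: lborel_distr_plus)
  also have "\<dots> \<longleftrightarrow> integrable lborel (\<lambda>x. f (c + x))" by (rule integrable_distr_eq) auto
  finally show "integrable lborel (\<lambda>x. f (c + x)) \<longleftrightarrow> integrable lborel f" ..
  have "(LBINT x. f x) = (\<integral>x. f x \<partial>distr lborel borel ((+) c))" by (simp add: lborel_distr_plus)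
  also have "\<dots> = (LBINT x. f (c + x))" by (rule integral_distr) auto
  finally show "(LBINT x. f (c + x)) = (LBINT x. f x)" ..
qed

text \<open>
  The difference quotients of \<open>f\<close> have integral zero by translation invariance and converge
  boundedly, on a fixed bounded set, to the directional derivatives.
\<close>

lemma C1_grad_integral_zero:
  fixes f :: "real^'n \<Rightarrow> real"
  assumes C1: "C1_grad f F" and supp: "compact (closure {x. f x \<noteq> 0})"
  shows "integrable lborel F" "(LBINT x. F x) = 0"
proof -
  note [measurable] = C1_grad_measurable[OF C1]
  obtain R where R: "closure {x. f x \<noteq> 0} \<subseteq> cball 0 R"
    using bounded_subset_ballD[OF compact_imp_bounded[OF supp], of 0] ball_subset_cball by blast
  have out: "x \<notin> closure {x. f x \<noteq> 0}" if "norm x > R" for x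
  proof
    assume "x \<in> closure {x. f x \<noteq> 0}"
    then have "x \<in> cball 0 R" using R by (rule subsetD[rotated])
    then show False using that by simp
  qed
  have f0: "f x = 0" if "norm x > R" for x
    using out[OF that] closure_subset[of "{x. f x \<noteq> 0}"] by auto
  have F0: "F x = 0" if "norm x > R" for x
    using C1_grad_zero_outside_support[OF C1 out[OF that]] .
  have cb: "compact (cball (0::real^'n) R')" for R' by simp
  have "integrable lborel (\<lambda>x. indicator (cball 0 R) x *\<^sub>R F x)"
    by (rule borel_integrable_compact) (auto intro: continuous_on_subset[OF C1_grad_continuous(2)[OF
        C1]])
  moreover have "indicator (cball 0 R) x *\<^sub>R F x = F x" for x using F0[of x]
      by (auto split: split_indicator)
  ultimately show intF: "integrable lborel F" by (simp only:)
  have "integrable lborel (\<lambda>x. indicator (cball 0 R) x *\<^sub>R f x)"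
    by (rule borel_integrable_compact) (auto intro: continuous_on_subset[OF C1_grad_continuous(1)[OF
        C1]])
  moreover have "indicator (cball 0 R) x *\<^sub>R f x = f x" for x using f0[of x]
      by (auto split: split_indicator)
  ultimately have intf: "integrable lborel f" by (simp only:)
  have "compact (F ` cball 0 (R + 1))"
    by (rule compact_continuous_image[OF _ cb]) (auto intro: continuous_on_subset[OF
        C1_grad_continuous(2)[OF C1]])
  then obtain B where B: "\<And>x. x \<in> cball 0 (R + 1) \<Longrightarrow> norm (F x) \<le> B"
    using compact_imp_bounded bounded_iff by (metis imageI)
  have "(LBINT x. F x) \<bullet> e = 0" if e: "e \<in> Basis" for e
  proof -
    define h where "h n = inverse (real (Suc n))" for n
    have h: "h n > 0" "h n \<le> 1" "h n \<noteq> 0" for n by (auto simp: h_def inverse_le_1_iff)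
    have hlim: "h \<longlonglongrightarrow> 0" unfolding h_def by (rule LIMSEQ_inverse_real_of_nat)
    define d where "d n x = (f (h n *\<^sub>R e + x) - f x) / h n" for n x
    have [measurable]: "d n \<in> borel_measurable borel" for n unfolding d_def by measurable
    have ne: "norm e = 1" using e by simp
    have "(\<lambda>n. LBINT x. d n x) \<longlonglongrightarrow> (LBINT x. F x \<bullet> e)"
    proof (rule integral_dominated_convergence)
      show "(\<lambda>x. F x \<bullet> e) \<in> borel_measurable lborel" by simp
      \<comment> \<open>The steps \<open>h n\<close> are at most \<open>1\<close>, so every difference quotient vanishes outside this
          ball.\<close>
      show "integrable lborel (\<lambda>x. indicator (cball 0 (R + 1)) x *\<^sub>R B)"
        by (rule borel_integrable_compact) auto
      show "AE x in lborel. (\<lambda>n. d n x) \<longlonglongrightarrow> F x \<bullet> e"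
      proof (rule AE_I2)
        fix x
        have "((\<lambda>s. f (x + s *\<^sub>R e)) has_real_derivative (F (x + 0 *\<^sub>R e) \<bullet> e)) (at 0)"
          by (rule C1_grad_along_line[OF C1])
        then have "((\<lambda>s. (f (x + s *\<^sub>R e) - f x) / s) \<longlongrightarrow> F x \<bullet> e) (at 0)"
          by (simp add: has_field_derivative_iff)
        moreover have "filterlim h (at 0) sequentially" using hlim h by (auto simp: filterlim_at)
        ultimately have "(\<lambda>n. (f (x + h n *\<^sub>R e) - f x) / h n) \<longlonglongrightarrow> F x \<bullet> e"
          by (rule filterlim_compose)
        then show "(\<lambda>n. d n x) \<longlonglongrightarrow> F x \<bullet> e" by (simp add: d_def add.commute)
      qed
      fix n
      show "AE x in lborel. norm (d n x) \<le> indicator (cball 0 (R + 1)) x *\<^sub>R B"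
      proof (rule AE_I2)
        fix x :: "real^'n"
        show "norm (d n x) \<le> indicator (cball 0 (R + 1)) x *\<^sub>R B"
        proof (cases "norm x \<le> R + 1 \<and> d n x \<noteq> 0")
          case False
          have "d n x = 0" if "norm x > R + 1"
          proof -
            have "norm x \<le> norm (h n *\<^sub>R e + x) + norm (h n *\<^sub>R e)"
              using norm_triangle_ineq4[of "h n *\<^sub>R e + x" "h n *\<^sub>R e"] by simp
            then have "norm (h n *\<^sub>R e + x) > R" using that h[of n] ne by simp
            then show ?thesis using f0 that by (simp add: d_def)
          qed
          then have d0: "d n x = 0" using False by (cases "norm x > R + 1") simp_all
          have "0 \<le> (indicator (cball 0 (R + 1)) x :: real) *\<^sub>R B"
          proof (cases "x \<in> cball 0 (R + 1)")
            case True
            then have "0 \<le> B" using B[OF True] norm_ge_zero[of "F x"] by linarith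
            then show ?thesis by (intro scaleR_nonneg_nonneg) simp_all
          qed simp
          then show ?thesis unfolding d0 by simp
        next
          case True
          have "\<exists>s>0. s < h n \<and> f (x + h n *\<^sub>R e) - f (x + 0 *\<^sub>R e) = (h n - 0) * (F (x +
              s *\<^sub>R e) \<bullet> e)"
            by (rule MVT2[OF h(1)]) (rule C1_grad_along_line[OF C1])
          then obtain s where s: "0 < s" "s < h n" "f (x + h n *\<^sub>R e) - f (x + 0 *\<^sub>R e) =
              (h n - 0) * (F (x + s *\<^sub>R e) \<bullet> e)"
            by blast
          define y where "y = x + s *\<^sub>R e"
          have dn: "d n x = F y \<bullet> e"
            using s(3) h(3)[of n] unfolding d_def y_def by (simp add: add.commute[of x])
          have yR: "norm y \<le> R + 1"
          proof (rule ccontr)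
            assume "\<not> norm y \<le> R + 1"
            then have "F y = 0" by (intro F0) simp
            then show False using True dn by simp
          qed
          have "\<bar>d n x\<bar> \<le> norm (F y) * norm e" unfolding dn by (rule Cauchy_Schwarz_ineq2)
          also have "\<dots> \<le> B" using B[of y] yR ne by simp
          also have "B = indicator (cball 0 (R + 1)) x *\<^sub>R B" using True by simp
          finally show ?thesis by simp
        qed
      qed
    qed simp
    moreover have "(LBINT x. d n x) = 0" for n
    proof -
      have mf: "f \<in> borel_measurable borel" by (rule C1_grad_measurable(1)[OF C1])
      have "integrable lborel (\<lambda>x. f (h n *\<^sub>R e + x))"
          by (rule integral_lborel_shift(1)[OF mf, THEN iffD2, OF intf])
      then have "(LBINT x. f (h n *\<^sub>R e + x) - f x) = (LBINT x. f (h n *\<^sub>R e + x)) - (LBINT x. f x)"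
        using intf by (rule Bochner_Integration.integral_diff)
      also have "\<dots> = 0" unfolding integral_lborel_shift(2)[OF mf] by (rule diff_self)
      finally show ?thesis unfolding d_def by simp
    qed
    ultimately have "(LBINT x. F x \<bullet> e) = 0" by (simp only: LIMSEQ_const_iff)
    moreover have "(LBINT x. F x \<bullet> e) = (LBINT x. F x) \<bullet> e"
      by (rule integral_inner_left) (rule intF)
    ultimately show ?thesis by (rule trans[OF sym, rotated])
  qed
  note comp = this
  show "(LBINT x. F x) = 0" by (rule euclidean_eqI) (simp only: comp inner_zero_left)
qed

text \<open>
  Integration by parts: the gradient of the product with a test function has integral zero.
\<close>

lemma C1_weak_gradient:
  fixes \<phi> :: "real^'n \<Rightarrow> real"
  assumes \<Omega>: "bounded \<Omega>" "open \<Omega>" and C1: "C1_grad \<phi> \<psi>"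
  shows "weak_gradient \<Omega> \<phi> \<psi>"
  unfolding weak_gradient_def
proof (intro conjI allI impI)
  show "\<phi> \<in> L2 \<Omega>" "\<psi> \<in> L2 \<Omega>" using continuous_in_L2[OF \<Omega>] C1_grad_continuous[OF C1] by auto
  fix \<eta> \<xi> assume "C1_grad \<eta> \<xi> \<and> compact (closure {x. \<eta> x \<noteq> 0}) \<and> closure {x. \<eta> x \<noteq> 0} \<subseteq> \<Omega>"
  then have C: "C1_grad \<eta> \<xi>" and cs: "compact (closure {x. \<eta> x \<noteq> 0})"
      and ss: "closure {x. \<eta> x \<noteq> 0} \<subseteq> \<Omega>" by auto
  note [measurable] = C1_grad_measurable[OF C1] C1_grad_measurable[OF C]
  have "closure {x. \<phi> x * \<eta> x \<noteq> 0} \<subseteq> closure {x. \<eta> x \<noteq> 0}" by (intro closure_mono) auto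
  then have "compact (closure {x. \<phi> x * \<eta> x \<noteq> 0})"
      using compact_Int_closed[OF cs closed_closure, of "{x. \<phi> x * \<eta> x \<noteq> 0}"]
      by (simp add: Int_absorb1)
  note Z = C1_grad_integral_zero[OF C1_grad_mult[OF C1 C] this]
  have o: "\<eta> x = 0 \<and> \<xi> x = 0" if "x \<notin> \<Omega>" for x
    using C1_grad_zero_outside_support[OF C, of x] ss that closure_subset[of "{x. \<eta> x \<noteq> 0}"] by auto
  have e1: "(LINT x|lebesgue_on \<Omega>. \<phi> x *\<^sub>R \<xi> x) = (LBINT x:\<Omega>. \<phi> x *\<^sub>R \<xi> x)"
    using \<Omega> by (intro integral_lebesgue_on_borel) auto
  have e2: "(LINT x|lebesgue_on \<Omega>. \<eta> x *\<^sub>R \<psi> x) = (LBINT x:\<Omega>. \<eta> x *\<^sub>R \<psi> x)"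
    using \<Omega> by (intro integral_lebesgue_on_borel) auto
  have i: "set_integrable lborel \<Omega> (\<lambda>x. \<phi> x *\<^sub>R \<xi> x)" "set_integrable lborel \<Omega> (\<lambda>x. \<eta> x *\<^sub>R \<psi> x)"
    using \<Omega> C1_grad_continuous[OF C1] C1_grad_continuous[OF C]
    by (subst integrable_lebesgue_on_borel[symmetric]; auto intro!: L2_integrable continuous_in_L2
        continuous_intros)+
  have "(LBINT x:\<Omega>. \<phi> x *\<^sub>R \<xi> x) + (LBINT x:\<Omega>. \<eta> x *\<^sub>R \<psi> x) = (LBINT x:\<Omega>. \<phi> x *\<^sub>R \<xi> x +
      \<eta> x *\<^sub>R \<psi> x)"
    by (rule set_integral_add(2)[symmetric, OF i])
  also have "\<dots> = (LBINT x. \<phi> x *\<^sub>R \<xi> x + \<eta> x *\<^sub>R \<psi> x)"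
    unfolding set_lebesgue_integral_def using o
        by (intro Bochner_Integration.integral_cong) (auto split: split_indicator)
  also have "\<dots> = 0" by (rule Z(2))
  finally show "(LINT x|lebesgue_on \<Omega>. \<phi> x *\<^sub>R \<xi> x) = - (LINT x|lebesgue_on \<Omega>. \<eta> x *\<^sub>R \<psi> x)"
    unfolding e1 e2 by (simp add: eq_neg_iff_add_eq_0)
qed

section \<open>Uniqueness of weak gradients\<close>

text \<open>
  The positive part is squared to make the function continuously differentiable.
\<close>

definition bump :: "real^'n \<Rightarrow> real \<Rightarrow> real^'n \<Rightarrow> real" where
  "bump c r x = (max 0 (r\<^sup>2 - (norm (x - c))\<^sup>2))\<^sup>2"

lemma max_square_derivative: "((\<lambda>t. (max 0 t)\<^sup>2) has_real_derivative 2 * max 0 t) (at (t :: real))"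
proof (cases "t = 0")
  case False
  show ?thesis
  proof (cases "t > 0")
    case True
    have "((\<lambda>t. t\<^sup>2) has_real_derivative 2 * max 0 t) (at t)"
      using True by (auto intro!: derivative_eq_intros)
    then show ?thesis
      by (rule has_field_derivative_transform_within_open[where S = "{0<..}"]) (use True in auto)
  next
    case neg: False
    have "((\<lambda>t. 0) has_real_derivative 2 * max 0 t) (at t)" using neg by simp
    then show ?thesis
      by (rule has_field_derivative_transform_within_open[where S = "{..<0}"]) (use False neg in
          auto)
  qed
next
  case True
  have "((\<lambda>h. (max 0 h)\<^sup>2 / h) \<longlongrightarrow> 0) (at (0::real))"
  proof (rule Lim_null_comparison)
    show "((\<lambda>h. \<bar>h\<bar>) \<longlongrightarrow> 0) (at (0::real))" by (auto intro!: tendsto_eq_intros)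
    show "eventually (\<lambda>h. norm ((max 0 h)\<^sup>2 / h) \<le> \<bar>h\<bar>) (at (0::real))"
      by (intro always_eventually allI) (auto simp: max_def power2_eq_square)
  qed
  then show ?thesis using True by (simp add: has_field_derivative_iff)
qed

lemma C1_grad_bump: "C1_grad (bump c r) (\<lambda>x. - (4 * max 0 (r\<^sup>2 - (norm (x - c))\<^sup>2)) *\<^sub>R (x - c))"
proof -
  have "GDERIV (\<lambda>x. r\<^sup>2 - (norm (x - c))\<^sup>2) x :> - 2 *\<^sub>R (x - c)" for x
    unfolding gderiv_def power2_norm_eq_inner
    by (auto intro!: derivative_eq_intros simp: inner_commute)
  then have "GDERIV (bump c r) x :> (2 * max 0 (r\<^sup>2 - (norm (x - c))\<^sup>2)) *\<^sub>R (- 2 *\<^sub>R (x - c))"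
      for x
    unfolding bump_def by (rule GDERIV_DERIV_compose) (rule max_square_derivative)
  moreover have "(2 * m) *\<^sub>R (- 2 *\<^sub>R (x - c)) = (- (4 * m)) *\<^sub>R (x - c)" for m x by simp
  moreover have "continuous_on UNIV (\<lambda>x. (- (4 * max 0 (r\<^sup>2 - (norm (x - c))\<^sup>2))) *\<^sub>R (x - c))"
    by (intro continuous_intros)
  ultimately show ?thesis unfolding C1_grad_def by simp
qed

lemma bump_pos_iff: "r > 0 \<Longrightarrow> bump c r x > 0 \<longleftrightarrow> x \<in> ball c r"
proof -
  assume r: "r > 0"
  have "(norm (x - c))\<^sup>2 < r\<^sup>2 \<longleftrightarrow> norm (x - c) < r"
    using r power2_less_imp_less[of "norm (x - c)" r] power_strict_mono[of "norm (x - c)" r 2]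
        by auto
  then show ?thesis by (auto simp: bump_def dist_norm norm_minus_commute max_def)
qed

lemma bump_nonneg: "0 \<le> bump c r x" by (simp add: bump_def)

lemma open_ball_sequence:
  fixes U :: "(real^'n) set"
  assumes "open U" "U \<noteq> {}"
  obtains c r where "\<And>i::nat. r i > (0::real)" "\<And>i. cball (c i) (r i) \<subseteq> U" "U =
      (\<Union>i. ball (c i) (r i))"
proof -
  define F where "F = {ball c r | c r. 0 < r \<and> cball c r \<subseteq> U}"
  have "\<And>S. S \<in> F \<Longrightarrow> open S" by (auto simp: F_def)
  then obtain F' where F': "F' \<subseteq> F" "countable F'" "\<Union>F' = \<Union>F" by (rule Lindelof)
  have UF: "\<Union>F = U"
  proof
    show "\<Union>F \<subseteq> U" unfolding F_def using ball_subset_cball by blast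
    show "U \<subseteq> \<Union>F"
    proof
      fix x assume "x \<in> U"
      then obtain e where "e > 0" "cball x e \<subseteq> U" using assms(1) open_contains_cball by blast
      then show "x \<in> \<Union>F" unfolding F_def by (intro UnionI[of "ball x e"]) auto
    qed
  qed
  have ne: "F' \<noteq> {}" using F' UF assms by auto
  have "\<exists>c r. from_nat_into F' i = ball c r \<and> 0 < r \<and> cball c r \<subseteq> U" for i
    using from_nat_into[OF ne, of i] F'(1) by (auto simp: F_def)
  then obtain c r where cr: "\<And>i. from_nat_into F' i = ball (c i) (r i) \<and> 0 < r i \<and>
      cball (c i) (r i) \<subseteq> U"
    by metis
  have "(\<Union>i. ball (c i) (r i)) = \<Union>(range (from_nat_into F'))" using cr by simp
  also have "\<dots> = U" using range_from_nat_into[OF ne F'(2)] F'(3) UF by simp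
  finally have eq: "U = (\<Union>i. ball (c i) (r i))" by (rule sym)
  show ?thesis
  proof (rule that[of r c])
    show "0 < r i" for i using cr[of i] by blast
    show "cball (c i) (r i) \<subseteq> U" for i using cr[of i] by blast
  qed (rule eq)
qed

text \<open>
  Let \<open>f n\<close> be the sum of \<open>n\<close> bumps supported in balls that exhaust \<open>U\<close>. It is positive exactly on
  the union of these balls, so the test functions \<open>n f n / (1 + n f n)\<close>, which take values in the
  unit interval, converge to the indicator of \<open>U\<close>.
\<close>

lemma test_functions_open_integral_zero:
  fixes G :: "real^'n \<Rightarrow> 'b::euclidean_space"
  assumes G: "integrable (lebesgue_on \<Omega>) G"
    and test: "\<And>\<phi> \<psi>. C1_grad \<phi> \<psi> \<Longrightarrow> compact (closure {x. \<phi> x \<noteq> 0}) \<Longrightarrow> closure {x. \<phi> x \<noteq> 0} \<subseteq> \<Omega> \<Longrightarrow>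
        (LINT x|lebesgue_on \<Omega>. \<phi> x *\<^sub>R G x) = 0"
    and U: "open U" "U \<subseteq> \<Omega>"
  shows "(LINT x|lebesgue_on \<Omega>. indicator U x *\<^sub>R G x) = 0"
proof (cases "U = {}")
  case False
  obtain c r where cr: "\<And>i::nat. r i > (0::real)" "\<And>i. cball (c i) (r i) \<subseteq> U" "U =
      (\<Union>i. ball (c i) (r i))"
    by (rule open_ball_sequence[OF U(1) False]) blast
  define f where "f n x = (\<Sum>i<n. bump (c i) (r i) x)" for n x
  define F where "F n x = (\<Sum>i<n. - (4 * max 0 ((r i)\<^sup>2 - (norm (x - c i))\<^sup>2)) *\<^sub>R (x - c i))"
      for n x
  have f0: "0 \<le> f n x" for n x by (simp add: f_def sum_nonneg bump_nonneg)
  have fC1: "C1_grad (f n) (F n)" for n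
    unfolding f_def[abs_def] F_def[abs_def] by (intro C1_grad_sum C1_grad_bump) auto
  define \<phi> where "\<phi> n x = real n * f n x / (1 + real n * f n x)" for n x
  have den: "1 + real n * f n x > 0" for n x using f0[of n x] by (simp add: add_pos_nonneg)
  have \<phi>C1: "C1_grad (\<phi> n) (\<lambda>x. (real n / (1 + real n * f n x)\<^sup>2) *\<^sub>R F n x)" for n
  proof -
    have "GDERIV (\<phi> n) x :> (real n / (1 + real n * f n x)\<^sup>2) *\<^sub>R F n x" for x
      unfolding \<phi>_def
    proof (rule GDERIV_DERIV_compose[where g = "\<lambda>t. real n * t / (1 + real n * t)"])
      show "GDERIV (f n) x :> F n x" using fC1 by (simp add: C1_grad_def)
      show "((\<lambda>t. real n * t / (1 + real n * t)) has_real_derivative real n / (1 +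
          real n * f n x)\<^sup>2) (at (f n x))"
        using den[of n x] by (auto intro!: derivative_eq_intros simp: power2_eq_square field_simps)
    qed
    moreover have "continuous_on UNIV (\<lambda>x. (real n / (1 + real n * f n x)\<^sup>2) *\<^sub>R F n x)"
    proof (intro continuous_intros C1_grad_continuous[OF fC1])
      show "\<forall>x\<in>UNIV. (1 + real n * f n x)\<^sup>2 \<noteq> 0" using den[of n]
          by (metis less_irrefl power_eq_0_iff)
    qed
    ultimately show ?thesis by (simp add: C1_grad_def)
  qed
  note [measurable] = C1_grad_measurable(1)[OF \<phi>C1]
  have fz: "f n x = 0" if "x \<notin> U" for n x
  proof -
    have "bump (c i) (r i) x = 0" for i
      using bump_pos_iff[OF cr(1), of "c i" i x] bump_nonneg[of "c i" "r i" x] that cr(3)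
          by (auto simp: less_le)
    then show ?thesis by (simp add: f_def)
  qed
  have supp: "closure {x. \<phi> n x \<noteq> 0} \<subseteq> (\<Union>i<n. cball (c i) (r i))" for n
  proof (rule closure_minimal)
    show "{x. \<phi> n x \<noteq> 0} \<subseteq> (\<Union>i<n. cball (c i) (r i))"
    proof
      fix x assume "x \<in> {x. \<phi> n x \<noteq> 0}"
      then have "f n x \<noteq> 0" by (auto simp: \<phi>_def)
      then obtain i where "i < n" "bump (c i) (r i) x \<noteq> 0"
          by (auto simp: f_def elim: sum.not_neutral_contains_not_neutral)
      then have "i < n" "x \<in> ball (c i) (r i)"
        using bump_pos_iff[OF cr(1), of "c i" i x] bump_nonneg[of "c i" "r i" x]
            by (auto simp: less_le)
      then show "x \<in> (\<Union>i<n. cball (c i) (r i))" using ball_subset_cball by blast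
    qed
    show "closed (\<Union>i<n. cball (c i) (r i))" by (intro closed_UN) auto
  qed
  have z: "(LINT x|lebesgue_on \<Omega>. \<phi> n x *\<^sub>R G x) = 0" for n
  proof (rule test[OF \<phi>C1])
    have "(\<Union>i<n. cball (c i) (r i)) \<subseteq> \<Omega>" using cr(2) U(2) by blast
    then show "closure {x. \<phi> n x \<noteq> 0} \<subseteq> \<Omega>" using supp by blast
    have "bounded (\<Union>i<n. cball (c i) (r i))" by (intro bounded_UN) auto
    then show "compact (closure {x. \<phi> n x \<noteq> 0})" using supp[of n] bounded_subset
        by (auto simp: compact_eq_bounded_closed)
  qed
  have "(\<lambda>n. LINT x|lebesgue_on \<Omega>. \<phi> n x *\<^sub>R G x) \<longlonglongrightarrow> (LINT x|lebesgue_on \<Omega>. indicator U x *\<^sub>R G x)"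
  proof (rule integral_dominated_convergence)
    have [measurable]: "U \<in> sets lebesgue" using U by auto
    have mG [measurable]: "G \<in> borel_measurable (lebesgue_on \<Omega>)" using G by auto
    have mU: "(indicator U :: _ \<Rightarrow> real) \<in> borel_measurable (lebesgue_on \<Omega>)"
      using U(1) by (intro borel_measurable_lebesgue_on borel_measurable_indicator) auto
    show "(\<lambda>x. indicator U x *\<^sub>R G x) \<in> borel_measurable (lebesgue_on \<Omega>)"
      using mU mG by (rule borel_measurable_scaleR)
    show "integrable (lebesgue_on \<Omega>) (\<lambda>x. norm (G x))" using G by simp
    show "AE x in lebesgue_on \<Omega>. (\<lambda>n. \<phi> n x *\<^sub>R G x) \<longlonglongrightarrow> indicator U x *\<^sub>R G x"
    proof (rule AE_I2)
      fix x
      have "(\<lambda>n. \<phi> n x) \<longlonglongrightarrow> indicator U x"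
      proof (cases "x \<in> U")
        case False
        then show ?thesis using fz by (simp add: \<phi>_def)
      next
        case True
        then obtain i where i: "x \<in> ball (c i) (r i)" using cr(3) by blast
        define b where "b = bump (c i) (r i) x"
        have b: "b > 0" using bump_pos_iff[OF cr(1)[of i], of "c i" x] i by (simp add: b_def)
        have ge: "b \<le> f n x" if "n > i" for n
          unfolding b_def f_def using that by (intro member_le_sum) (auto simp: bump_nonneg)
        have "(\<lambda>n. \<phi> n x - 1) \<longlonglongrightarrow> 0"
        proof (rule Lim_null_comparison)
          have "(\<lambda>n. inverse b * inverse (real n)) \<longlonglongrightarrow> inverse b * 0"
              by (intro tendsto_intros lim_inverse_n)
          then show "(\<lambda>n. inverse b * inverse (real n)) \<longlonglongrightarrow> 0" by simp
          show "eventually (\<lambda>n. norm (\<phi> n x - 1) \<le> inverse b * inverse (real n)) sequentially"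
            using eventually_gt_at_top[of i]
          proof eventually_elim
            case (elim n)
            have "\<phi> n x - 1 = - 1 / (1 + real n * f n x)" using den[of n x]
                by (simp add: \<phi>_def field_simps)
            then have "norm (\<phi> n x - 1) = 1 / (1 + real n * f n x)" using den[of n x] by simp
            also have "\<dots> \<le> 1 / (real n * b)"
            proof (rule divide_left_mono)
              have "real n * b \<le> real n * f n x" using ge[OF elim] by (intro mult_left_mono) auto
              then show "real n * b \<le> 1 + real n * f n x" by simp
              show "0 < (1 + real n * f n x) * (real n * b)" using den[of n x] b elim
                  by (intro mult_pos_pos) auto
            qed simp
            finally show ?case by (simp add: field_simps)
          qed
        qed
        then have "(\<lambda>n. \<phi> n x) \<longlonglongrightarrow> 1" using LIM_zero_iff by blast
        then show ?thesis using True by simp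
      qed
      then show "(\<lambda>n. \<phi> n x *\<^sub>R G x) \<longlonglongrightarrow> indicator U x *\<^sub>R G x" by (intro tendsto_intros)
    qed
    show "(\<lambda>x. \<phi> n x *\<^sub>R G x) \<in> borel_measurable (lebesgue_on \<Omega>)" for n
      using C1_grad_measurable(1)[OF \<phi>C1[of n]]
          by (intro borel_measurable_scaleR borel_measurable_lebesgue_on mG)
    show "AE x in lebesgue_on \<Omega>. norm (\<phi> n x *\<^sub>R G x) \<le> norm (G x)" for n
    proof (rule AE_I2)
      fix x
      have "0 \<le> \<phi> n x" "\<phi> n x \<le> 1" using den[of n x] f0[of n x] by (auto simp: \<phi>_def divide_le_eq)
      then show "norm (\<phi> n x *\<^sub>R G x) \<le> norm (G x)" by (simp add: mult_left_le_one_le)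
    qed
  qed
  then show ?thesis by (simp add: z LIMSEQ_const_iff)
qed simp

text \<open>
  Outer regularity passes from open sets to all measurable sets; the sets on which a component of
  \<open>G\<close> is positive then must be null.
\<close>

lemma open_integral_zero_imp_AE_zero:
  fixes G :: "real^'n \<Rightarrow> 'b::euclidean_space"
  assumes \<Omega>: "open \<Omega>" and G: "integrable (lebesgue_on \<Omega>) G"
    and zero: "\<And>U. open U \<Longrightarrow> U \<subseteq> \<Omega> \<Longrightarrow> (LINT x|lebesgue_on \<Omega>. indicator U x *\<^sub>R G x) = 0"
  shows "AE x in lebesgue_on \<Omega>. G x = 0"
proof -
  have mG: "G \<in> borel_measurable (lebesgue_on \<Omega>)" using G by auto
  have meas: "(LINT x|lebesgue_on \<Omega>. indicator A x *\<^sub>R G x) = 0"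
      if A: "A \<in> sets lebesgue" "A \<subseteq> \<Omega>" for A
  proof -
    have "\<exists>T. open T \<and> A \<subseteq> T \<and> emeasure lebesgue (T - A) < ennreal (inverse (real (Suc n)))" for n
      by (rule sets_lebesgue_outer_open[OF A(1), of "inverse (real (Suc n))"]) auto
    then obtain T where T: "\<And>n. open (T n)" "\<And>n. A \<subseteq> T n"
      "\<And>n. emeasure lebesgue (T n - A) < ennreal (inverse (real (Suc n)))" by metis
    define W where "W n = (\<Inter>k\<le>n. T k) \<inter> \<Omega>" for n
    have W: "open (W n)" "W n \<subseteq> \<Omega>" for n using T(1) \<Omega> by (auto simp: W_def)
    have dec: "decseq W" unfolding W_def decseq_def by force
    have null: "AE x in lebesgue_on \<Omega>. x \<in> (\<Inter>n. W n) \<longrightarrow> x \<in> A"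
    proof -
      have "(\<Inter>n. T n) - A \<in> null_sets lebesgue"
      proof (rule null_setsI)
        have "emeasure lebesgue ((\<Inter>n. T n) - A) \<le> ennreal (inverse (real (Suc n)))" for n
          using T A(1) by (intro order.trans[OF emeasure_mono less_imp_le[OF T(3)[of n]]]) auto
        then have "emeasure lebesgue ((\<Inter>n. T n) - A) \<le> ennreal 0"
          by (intro tendsto_lowerbound[OF tendsto_ennrealI[OF LIMSEQ_inverse_real_of_nat]]) auto
        then show "emeasure lebesgue ((\<Inter>n. T n) - A) = 0" by simp
        show "(\<Inter>n. T n) - A \<in> sets lebesgue" using T(1) A(1)
            by (intro sets.Diff sets.countable_INT) auto
      qed
      then have "AE x in lebesgue. x \<notin> (\<Inter>n. T n) - A" by (rule AE_not_in)
      then have "AE x in lebesgue_on \<Omega>. x \<notin> (\<Inter>n. T n) - A"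
        using \<Omega> by (subst AE_restrict_space_iff) auto
      then show ?thesis by eventually_elim (auto simp: W_def)
    qed
    have mind: "(indicator B :: _ \<Rightarrow> real) \<in> borel_measurable (lebesgue_on \<Omega>)"
        if "B \<in> sets lebesgue" for B
      using that by (intro measurable_restrict_space1) auto
    have "(\<lambda>n. LINT x|lebesgue_on \<Omega>. indicator (W n) x *\<^sub>R G x) \<longlonglongrightarrow>
        (LINT x|lebesgue_on \<Omega>. indicator A x *\<^sub>R G x)"
    proof (rule integral_dominated_convergence)
      show "(\<lambda>x. indicator A x *\<^sub>R G x) \<in> borel_measurable (lebesgue_on \<Omega>)"
        using mind[OF A(1)] mG by (rule borel_measurable_scaleR)
      show "(\<lambda>x. indicator (W n) x *\<^sub>R G x) \<in> borel_measurable (lebesgue_on \<Omega>)" for n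
        using W(1) by (intro borel_measurable_scaleR mind mG) auto
      show "integrable (lebesgue_on \<Omega>) (\<lambda>x. norm (G x))" using G by simp
      show "AE x in lebesgue_on \<Omega>. (\<lambda>n. indicator (W n) x *\<^sub>R G x) \<longlonglongrightarrow> indicator A x *\<^sub>R G x"
        using null AE_space
      proof eventually_elim
        case (elim x)
        have "(\<lambda>n. indicator (W n) x :: real) \<longlonglongrightarrow> indicator (\<Inter>n. W n) x"
            by (rule LIMSEQ_indicator_decseq[OF dec])
        moreover have "x \<in> (\<Inter>n. W n) \<longleftrightarrow> x \<in> A"
          using elim T(2) by (auto simp: W_def space_restrict_space)
        then have "(indicator (\<Inter>n. W n) x :: real) = indicator A x" by (simp add: indicator_def)
        ultimately have "(\<lambda>n. indicator (W n) x :: real) \<longlonglongrightarrow> indicator A x" by simp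
        then show ?case by (intro tendsto_intros)
      qed
      show "AE x in lebesgue_on \<Omega>. norm (indicator (W n) x *\<^sub>R G x) \<le> norm (G x)" for n
        by (intro AE_I2) (auto split: split_indicator)
    qed
    then show ?thesis using zero[OF W] by (simp add: LIMSEQ_const_iff)
  qed
  have half: "AE x in lebesgue_on \<Omega>. G x \<bullet> e \<le> 0" for e :: 'b
  proof -
    define A where "A = {x \<in> \<Omega>. G x \<bullet> e > 0}"
    have "{x \<in> space (lebesgue_on \<Omega>). G x \<bullet> e > 0} \<in> sets (lebesgue_on \<Omega>)"
      using mG by measurable
    then have sA: "A \<in> sets (lebesgue_on \<Omega>)" by (simp add: A_def space_restrict_space)
    then have A: "A \<in> sets lebesgue" "A \<subseteq> \<Omega>" using \<Omega> by (auto simp: sets_restrict_space_iff A_def)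
    have int: "integrable (lebesgue_on \<Omega>) (\<lambda>x. indicator A x *\<^sub>R G x)"
      by (rule integrable_mult_indicator[OF sA G])
    have "(LINT x|lebesgue_on \<Omega>. (indicator A x *\<^sub>R G x) \<bullet> e) =
        (LINT x|lebesgue_on \<Omega>. indicator A x *\<^sub>R G x) \<bullet> e"
      by (rule integral_inner_left) (rule int)
    then have "(LINT x|lebesgue_on \<Omega>. (indicator A x *\<^sub>R G x) \<bullet> e) = 0"
        by (simp only: meas[OF A] inner_zero_left)
    moreover have "integrable (lebesgue_on \<Omega>) (\<lambda>x. (indicator A x *\<^sub>R G x) \<bullet> e)"
      using int by (rule integrable_inner_left)
    moreover have "AE x in lebesgue_on \<Omega>. 0 \<le> (indicator A x *\<^sub>R G x) \<bullet> e"
      by (intro AE_I2) (auto simp: A_def split: split_indicator)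
    ultimately have "AE x in lebesgue_on \<Omega>. (indicator A x *\<^sub>R G x) \<bullet> e = 0"
      using integral_nonneg_eq_0_iff_AE by blast
    then show ?thesis using AE_space
      by eventually_elim (auto simp: A_def space_restrict_space split: split_indicator_asm)
  qed
  have "AE x in lebesgue_on \<Omega>. \<forall>e\<in>Basis. G x \<bullet> e \<le> 0 \<and> G x \<bullet> (- e) \<le> 0"
    by (intro AE_finite_allI AE_conjI half) auto
  then show ?thesis
  proof eventually_elim
    case (elim x)
    show "G x = 0" by (rule euclidean_eqI) (use elim in force)
  qed
qed

text \<open>
  The fundamental lemma of the calculus of variations. It makes \<^const>\<open>grad\<close>, an arbitrary choice among
  the weak gradients, linear almost everywhere and equal to the classical gradient where there is
  one.
\<close>

lemma weak_gradient_unique: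
  fixes \<Omega> :: "(real^'n) set"
  assumes \<Omega>: "bounded \<Omega>" "open \<Omega>" and G: "weak_gradient \<Omega> u G" and H: "weak_gradient \<Omega> v H"
    and uv: "AE x in lebesgue_on \<Omega>. u x = v x"
  shows "AE x in lebesgue_on \<Omega>. G x = H x"
proof -
  have GL: "G \<in> L2 \<Omega>" and HL: "H \<in> L2 \<Omega>" and uL: "u \<in> L2 \<Omega>" and vL: "v \<in> L2 \<Omega>"
    using G H by (auto simp: weak_gradient_def)
  have intG: "integrable (lebesgue_on \<Omega>) G" "integrable (lebesgue_on \<Omega>) H"
    using L2_integrable[OF \<Omega>] GL HL by auto
  define D where "D x = G x - H x" for x
  have intD: "integrable (lebesgue_on \<Omega>) D" unfolding D_def[abs_def] using intG by simp
  have "(LINT x|lebesgue_on \<Omega>. \<phi> x *\<^sub>R D x) = 0"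
    if C1: "C1_grad \<phi> \<psi>" and "compact (closure {x. \<phi> x \<noteq> 0})" "closure {x. \<phi> x \<noteq> 0} \<subseteq> \<Omega>" for \<phi> \<psi>
  proof -
    have \<phi>L: "\<phi> \<in> L2 \<Omega>" by (rule continuous_in_L2[OF \<Omega> C1_grad_continuous(1)[OF C1]])
    have mu: "(\<lambda>x. w x *\<^sub>R \<psi> x) \<in> borel_measurable (lebesgue_on \<Omega>)"
        if "w \<in> L2 \<Omega>" for w :: "real^'n \<Rightarrow> real"
      using that by (intro borel_measurable_scaleR borel_measurable_lebesgue_on[OF
          C1_grad_measurable(2)[OF C1]])
        (simp add: L2_def)
    have "(LINT x|lebesgue_on \<Omega>. u x *\<^sub>R \<psi> x) = (LINT x|lebesgue_on \<Omega>. v x *\<^sub>R \<psi> x)"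
      by (rule integral_cong_AE[OF mu[OF uL] mu[OF vL]]) (use uv in \<open>auto elim: eventually_mono\<close>)
    moreover have "(LINT x|lebesgue_on \<Omega>. u x *\<^sub>R \<psi> x) = - (LINT x|lebesgue_on \<Omega>. \<phi> x *\<^sub>R G x)"
      "(LINT x|lebesgue_on \<Omega>. v x *\<^sub>R \<psi> x) = - (LINT x|lebesgue_on \<Omega>. \<phi> x *\<^sub>R H x)"
      using G H that unfolding weak_gradient_def by blast+
    ultimately show ?thesis using test_integrable[OF GL \<phi>L] test_integrable[OF HL \<phi>L]
        by (simp add: D_def scaleR_diff_right)
  qed
  then have "AE x in lebesgue_on \<Omega>. D x = 0"
    using test_functions_open_integral_zero[OF intD]
        by (intro open_integral_zero_imp_AE_zero[OF \<Omega>(2) intD]) blast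
  then show ?thesis by eventually_elim (simp add: D_def)
qed

section \<open>The Sobolev space and its subspace of vanishing trace\<close>

definition Dirichlet :: "(real^'n) set \<Rightarrow> (real^'n \<Rightarrow> real) \<Rightarrow> (real^'n \<Rightarrow> real) \<Rightarrow> real" where
  "Dirichlet \<Omega> u v = L2_inner \<Omega> (grad \<Omega> u) (grad \<Omega> v)"

definition H1_inner :: "(real^'n) set \<Rightarrow> (real^'n \<Rightarrow> real) \<Rightarrow> (real^'n \<Rightarrow> real) \<Rightarrow> real" where
  "H1_inner \<Omega> u v = L2_inner \<Omega> u v + Dirichlet \<Omega> u v"

lemma H1_norm_eq: "H1_norm \<Omega> u = sqrt (H1_inner \<Omega> u u)"
  by (simp add: H1_norm_def H1_inner_def Dirichlet_def L2_inner_self)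

lemma weak_gradient_grad:
  assumes "u \<in> H1 \<Omega>" shows "weak_gradient \<Omega> u (grad \<Omega> u)"
  using assms someI_ex[of "weak_gradient \<Omega> u"] by (simp add: H1_def grad_def)

lemma weak_gradientD:
  assumes "weak_gradient \<Omega> u G" "C1_grad \<phi> \<psi>" "compact (closure {x. \<phi> x \<noteq> 0})" "closure {x.
      \<phi> x \<noteq> 0} \<subseteq> \<Omega>"
  shows "(LINT x|lebesgue_on \<Omega>. u x *\<^sub>R \<psi> x) = - (LINT x|lebesgue_on \<Omega>. \<phi> x *\<^sub>R G x)"
  using assms unfolding weak_gradient_def by blast

lemma H1_L2: "u \<in> H1 \<Omega> \<Longrightarrow> u \<in> L2 \<Omega>" "u \<in> H1 \<Omega> \<Longrightarrow> grad \<Omega> u \<in> L2 \<Omega>"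
  using weak_gradient_grad by (auto simp: weak_gradient_def)

lemma C1_in_H1:
  assumes "bounded \<Omega>" "open \<Omega>" "C1_grad \<phi> \<psi>"
  shows "\<phi> \<in> H1 \<Omega>" "AE x in lebesgue_on \<Omega>. grad \<Omega> \<phi> x = \<psi> x"
proof -
  show H: "\<phi> \<in> H1 \<Omega>" using C1_weak_gradient[OF assms] by (auto simp: H1_def)
  show "AE x in lebesgue_on \<Omega>. grad \<Omega> \<phi> x = \<psi> x"
    by (rule weak_gradient_unique[OF assms(1,2) weak_gradient_grad[OF H] C1_weak_gradient[OF
        assms]]) simp
qed

lemma integral_lincomb:
  fixes f g :: "'a \<Rightarrow> 'b::euclidean_space"
  assumes "integrable M f" "integrable M g"
  shows "(LINT x|M. a *\<^sub>R f x + b *\<^sub>R g x) = a *\<^sub>R (LINT x|M. f x) + b *\<^sub>R (LINT x|M. g x)"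
  using assms by simp

lemma weak_gradient_lincomb:
  assumes \<Omega>: "bounded \<Omega>" "open \<Omega>" and u: "weak_gradient \<Omega> u G" and v: "weak_gradient \<Omega> v H"
  shows "weak_gradient \<Omega> (lincomb a u b v) (\<lambda>x. a *\<^sub>R G x + b *\<^sub>R H x)"
  unfolding weak_gradient_def
proof (intro conjI allI impI)
  have L: "u \<in> L2 \<Omega>" "v \<in> L2 \<Omega>" "G \<in> L2 \<Omega>" "H \<in> L2 \<Omega>" using u v by (auto simp: weak_gradient_def)
  show "lincomb a u b v \<in> L2 \<Omega>" using L function_space.lincomb_in[OF L2_function_space] by blast
  show "(\<lambda>x. a *\<^sub>R G x + b *\<^sub>R H x) \<in> L2 \<Omega>" using L by (intro L2_lincomb)
  fix \<phi> \<psi> assume t: "C1_grad \<phi> \<psi> \<and> compact (closure {x. \<phi> x \<noteq> 0}) \<and> closure {x. \<phi> x \<noteq> 0} \<subseteq> \<Omega>"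
  have LL: "\<phi> \<in> L2 \<Omega>" "\<psi> \<in> L2 \<Omega>" using t C1_grad_continuous continuous_in_L2[OF \<Omega>] by blast+
  have e: "(LINT x|lebesgue_on \<Omega>. u x *\<^sub>R \<psi> x) = - (LINT x|lebesgue_on \<Omega>. \<phi> x *\<^sub>R G x)"
    "(LINT x|lebesgue_on \<Omega>. v x *\<^sub>R \<psi> x) = - (LINT x|lebesgue_on \<Omega>. \<phi> x *\<^sub>R H x)"
    using t by (auto intro!: weak_gradientD[OF u] weak_gradientD[OF v])
  have "(LINT x|lebesgue_on \<Omega>. lincomb a u b v x *\<^sub>R \<psi> x) =
      (LINT x|lebesgue_on \<Omega>. a *\<^sub>R (u x *\<^sub>R \<psi> x) + b *\<^sub>R (v x *\<^sub>R \<psi> x))"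
    by (simp add: lincomb_def scaleR_add_left)
  also have "\<dots> = a *\<^sub>R (LINT x|lebesgue_on \<Omega>. u x *\<^sub>R \<psi> x) + b *\<^sub>R (LINT x|lebesgue_on \<Omega>.
      v x *\<^sub>R \<psi> x)"
    by (intro integral_lincomb test_integrable L LL)
  also have "\<dots> = - (a *\<^sub>R (LINT x|lebesgue_on \<Omega>. \<phi> x *\<^sub>R G x) + b *\<^sub>R (LINT x|lebesgue_on \<Omega>.
      \<phi> x *\<^sub>R H x))"
    unfolding e by simp
  also have "a *\<^sub>R (LINT x|lebesgue_on \<Omega>. \<phi> x *\<^sub>R G x) + b *\<^sub>R (LINT x|lebesgue_on \<Omega>. \<phi> x *\<^sub>R H x) =
      (LINT x|lebesgue_on \<Omega>. a *\<^sub>R (\<phi> x *\<^sub>R G x) + b *\<^sub>R (\<phi> x *\<^sub>R H x))"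
    by (intro integral_lincomb[symmetric] test_integrable L LL)
  also have "\<dots> = (LINT x|lebesgue_on \<Omega>. \<phi> x *\<^sub>R (a *\<^sub>R G x + b *\<^sub>R H x))"
    by (simp add: scaleR_add_right mult.commute)
  finally show "(LINT x|lebesgue_on \<Omega>. lincomb a u b v x *\<^sub>R \<psi> x) =
      - (LINT x|lebesgue_on \<Omega>. \<phi> x *\<^sub>R (a *\<^sub>R G x + b *\<^sub>R H x))" .
qed

lemma grad_lincomb:
  assumes \<Omega>: "bounded \<Omega>" "open \<Omega>" and u: "u \<in> H1 \<Omega>" and v: "v \<in> H1 \<Omega>"
  shows "lincomb a u b v \<in> H1 \<Omega>"
    "AE x in lebesgue_on \<Omega>. grad \<Omega> (lincomb a u b v) x = a *\<^sub>R grad \<Omega> u x + b *\<^sub>R grad \<Omega> v x"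
proof -
  note W = weak_gradient_lincomb[OF \<Omega> weak_gradient_grad[OF u] weak_gradient_grad[OF v], of a b]
  show H: "lincomb a u b v \<in> H1 \<Omega>" using W by (auto simp: H1_def)
  show "AE x in lebesgue_on \<Omega>. grad \<Omega> (lincomb a u b v) x = a *\<^sub>R grad \<Omega> u x + b *\<^sub>R grad \<Omega> v x"
    by (rule weak_gradient_unique[OF \<Omega> weak_gradient_grad[OF H] W]) simp
qed

lemma Dirichlet_sym_form:
  assumes \<Omega>: "bounded \<Omega>" "open \<Omega>"
  shows "sym_form (H1 \<Omega>) (Dirichlet \<Omega>)"
  unfolding sym_form_def
proof (intro conjI ballI allI)
  fix u v w a b assume H: "u \<in> H1 \<Omega>" "v \<in> H1 \<Omega>" "w \<in> H1 \<Omega>"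
  have "Dirichlet \<Omega> (lincomb a u b v) w = L2_inner \<Omega> (\<lambda>x. a *\<^sub>R grad \<Omega> u x +
      b *\<^sub>R grad \<Omega> v x) (grad \<Omega> w)"
    unfolding Dirichlet_def using H grad_lincomb[OF \<Omega> H(1,2)]
    by (intro L2_inner_cong_AE H1_L2 L2_lincomb) auto
  then show "Dirichlet \<Omega> (lincomb a u b v) w = a * Dirichlet \<Omega> u w + b * Dirichlet \<Omega> v w"
    using H by (simp add: L2_inner_left H1_L2 Dirichlet_def)
qed (simp add: Dirichlet_def L2_inner_commute)

lemma sym_form_subset: "sym_form S F \<Longrightarrow> T \<subseteq> S \<Longrightarrow> sym_form T F"
  unfolding sym_form_def by blast

lemma H1_energy_space:
  assumes \<Omega>: "bounded \<Omega>" "open \<Omega>"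
  shows "energy_space (H1 \<Omega>) (H1_inner \<Omega>)"
proof
  show "lincomb a u b v \<in> H1 \<Omega>" if "u \<in> H1 \<Omega>" "v \<in> H1 \<Omega>" for u v a b
    using grad_lincomb(1)[OF \<Omega> that] .
  have "sym_form (H1 \<Omega>) (L2_inner \<Omega>)" by (rule sym_form_subset[OF L2_inner_sym_form]) (auto
      simp: H1_L2)
  then show "sym_form (H1 \<Omega>) (H1_inner \<Omega>)"
    using Dirichlet_sym_form[OF \<Omega>] unfolding sym_form_def H1_inner_def by (auto simp: algebra_simps)
  show "0 \<le> H1_inner \<Omega> u u" for u by (simp add: H1_inner_def Dirichlet_def L2_inner_nonneg)
qed
lemma fdiff_eq: "fdiff u v = (\<lambda>x. u x - v x)"
  by (simp add: lincomb_def)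

abbreviation trace_mass :: "(real^'n) set \<Rightarrow> (real^'n \<Rightarrow> real) \<Rightarrow> ennreal" where
  "trace_mass \<gamma> f \<equiv> (\<integral>\<^sup>+x\<in>\<gamma>. ennreal ((f x)\<^sup>2) \<partial>surface_measure)"

lemma sets_surface_measure: "sets (surface_measure :: (real^'n) measure) = sets borel"
  using sets.sigma_sets_eq[of "borel :: (real^'n) measure"]
  by (simp add: surface_measure_def hausdorff_measure_def)

lemma V_space_iff:
  "v \<in> V_space \<Omega> \<gamma> \<longleftrightarrow> v \<in> H1 \<Omega> \<and> (\<exists>\<phi>. (\<forall>k. \<exists>\<psi>. C1_grad (\<phi> k) \<psi>) \<and>
     (\<lambda>k. H1_norm \<Omega> (fdiff (\<phi> k) v)) \<longlonglongrightarrow> 0 \<and>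
     (\<lambda>k. trace_mass \<gamma> (\<phi> k)) \<longlonglongrightarrow> 0)"
  unfolding V_space_def has_trace_def fdiff_eq by auto

locale bounded_open_set =
  fixes \<Omega> :: "(real^'n) set"
  assumes bdd: "bounded \<Omega>" and op: "open \<Omega>"

sublocale bounded_open_set \<subseteq> H: energy_space "H1 \<Omega>" "H1_inner \<Omega>"
  by (rule H1_energy_space[OF bdd op])

sublocale bounded_open_set \<subseteq> L: function_space "L2 \<Omega> :: (real^'n \<Rightarrow> real) set"
  by (rule L2_function_space)

context bounded_open_set
begin

lemma enorm_eq: "H.enorm u = H1_norm \<Omega> u"
  by (simp add: H.enorm_def H1_norm_eq)

lemma L2_le_H1: "L2_inner \<Omega> u u \<le> H1_inner \<Omega> u u"
  by (simp add: H1_inner_def Dirichlet_def L2_inner_nonneg)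

lemma Dirichlet_le_H1: "Dirichlet \<Omega> u u \<le> H1_inner \<Omega> u u"
  by (simp add: H1_inner_def L2_inner_nonneg)

lemma H1_norm_tendsto_iff:
  "form_converges (H1_inner \<Omega>) x v \<longleftrightarrow> (\<lambda>k. H1_norm \<Omega> (fdiff (x k) v)) \<longlonglongrightarrow> 0"
proof
  assume "form_converges (H1_inner \<Omega>) x v"
  then have "(\<lambda>k. sqrt (sqdist (H1_inner \<Omega>) (x k) v)) \<longlonglongrightarrow> sqrt 0"
    unfolding form_converges_def by (rule tendsto_real_sqrt)
  then show "(\<lambda>k. H1_norm \<Omega> (fdiff (x k) v)) \<longlonglongrightarrow> 0" by (simp add: H1_norm_eq)
next
  assume "(\<lambda>k. H1_norm \<Omega> (fdiff (x k) v)) \<longlonglongrightarrow> 0"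
  then have "(\<lambda>k. (H1_norm \<Omega> (fdiff (x k) v))\<^sup>2) \<longlonglongrightarrow> 0\<^sup>2" by (rule tendsto_power)
  moreover have "(H1_norm \<Omega> u)\<^sup>2 = H1_inner \<Omega> u u" for u
    by (simp add: H1_norm_eq H1_inner_def Dirichlet_def L2_inner_nonneg)
  ultimately show "form_converges (H1_inner \<Omega>) x v" by (simp add: form_converges_def)
qed

lemma V_lincomb:
  assumes \<gamma>: "\<gamma> \<in> sets borel" and u: "u \<in> V_space \<Omega> \<gamma>" and v: "v \<in> V_space \<Omega> \<gamma>"
  shows "lincomb a u b v \<in> V_space \<Omega> \<gamma>"
proof -
  have uH: "u \<in> H1 \<Omega>" "v \<in> H1 \<Omega>" using u v by (auto simp: V_space_iff)
  obtain \<phi> where \<phi>0: "\<forall>k. \<exists>\<psi>. C1_grad (\<phi> k) \<psi>" "(\<lambda>k. H1_norm \<Omega> (fdiff (\<phi> k) u)) \<longlonglongrightarrow> 0"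
    "(\<lambda>k. trace_mass \<gamma> (\<phi> k)) \<longlonglongrightarrow> 0"
    using u unfolding V_space_iff by blast
  obtain \<phi>' where \<phi>1: "\<And>k. C1_grad (\<phi> k) (\<phi>' k)" using \<phi>0(1) by metis
  note \<phi> = \<phi>1 \<phi>0(2,3)
  obtain \<eta> where \<eta>0: "\<forall>k. \<exists>\<psi>. C1_grad (\<eta> k) \<psi>" "(\<lambda>k. H1_norm \<Omega> (fdiff (\<eta> k) v)) \<longlonglongrightarrow> 0"
    "(\<lambda>k. trace_mass \<gamma> (\<eta> k)) \<longlonglongrightarrow> 0"
    using v unfolding V_space_iff by blast
  obtain \<eta>' where \<eta>1: "\<And>k. C1_grad (\<eta> k) (\<eta>' k)" using \<eta>0(1) by metis
  note \<eta> = \<eta>1 \<eta>0(2,3)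
  have \<phi>H: "\<phi> k \<in> H1 \<Omega>" "\<eta> k \<in> H1 \<Omega>" for k using C1_in_H1(1)[OF bdd op] \<phi>(1) \<eta>(1) by auto
  define \<zeta> where "\<zeta> k = lincomb a (\<phi> k) b (\<eta> k)" for k
  have "C1_grad (\<zeta> k) (\<lambda>x. a *\<^sub>R \<phi>' k x + b *\<^sub>R \<eta>' k x)" for k
    unfolding \<zeta>_def lincomb_def by (rule C1_grad_lincomb[OF \<phi>(1) \<eta>(1)])
  moreover have "(\<lambda>k. H1_norm \<Omega> (fdiff (\<zeta> k) (lincomb a u b v))) \<longlonglongrightarrow> 0"
  proof (rule Lim_null_comparison)
    show "(\<lambda>k. \<bar>a\<bar> * H1_norm \<Omega> (fdiff (\<phi> k) u) + \<bar>b\<bar> * H1_norm \<Omega> (fdiff (\<eta> k) v)) \<longlonglongrightarrow> 0"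
      using tendsto_add[OF tendsto_mult_left[OF \<phi>(2), of "\<bar>a\<bar>"] tendsto_mult_left[OF \<eta>(2), of
          "\<bar>b\<bar>"]] by simp
    have "fdiff (\<zeta> k) (lincomb a u b v) = lincomb a (fdiff (\<phi> k) u) b (fdiff (\<eta> k) v)" for k
      by (simp add: \<zeta>_def lincomb_def fun_eq_iff algebra_simps)
    then have "H1_norm \<Omega> (fdiff (\<zeta> k) (lincomb a u b v)) \<le> \<bar>a\<bar> * H1_norm \<Omega> (fdiff (\<phi> k) u) +
        \<bar>b\<bar> * H1_norm \<Omega> (fdiff (\<eta> k) v)" for k
      using H.enorm_lincomb_le[of "fdiff (\<phi> k) u" "fdiff (\<eta> k) v" a b] \<phi>H uH by (simp add: enorm_eq)
    moreover have "0 \<le> H1_norm \<Omega> w" for w unfolding H1_norm_eq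
        by (simp add: H1_inner_def Dirichlet_def L2_inner_nonneg)
    ultimately show "eventually (\<lambda>k. norm (H1_norm \<Omega> (fdiff (\<zeta> k) (lincomb a u b v))) \<le>
        \<bar>a\<bar> * H1_norm \<Omega> (fdiff (\<phi> k) u) + \<bar>b\<bar> * H1_norm \<Omega> (fdiff (\<eta> k) v)) sequentially" by simp
  qed
  moreover have "(\<lambda>k. trace_mass \<gamma> (\<zeta> k)) \<longlonglongrightarrow> 0"
  proof (rule tendsto_sandwich[where f = "\<lambda>k. 0"])
    have m: "(\<lambda>x. ennreal ((w x)\<^sup>2) * indicator \<gamma> x) \<in> borel_measurable surface_measure"
      if "C1_grad w w'" for w :: "real^'n \<Rightarrow> real" and w'
    proof -
      have [measurable]: "w \<in> borel_measurable borel" "\<gamma> \<in> sets borel"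
          using C1_grad_measurable(1)[OF that] \<gamma> by auto
      have "(\<lambda>x. ennreal ((w x)\<^sup>2) * indicator \<gamma> x) \<in> borel_measurable borel" by measurable
      then show ?thesis by (simp add: measurable_cong_sets[OF sets_surface_measure refl])
    qed
    have "trace_mass \<gamma> (\<zeta> k) \<le>
       (\<integral>\<^sup>+x. ennreal (2 * a\<^sup>2) * (ennreal ((\<phi> k x)\<^sup>2) * indicator \<gamma> x) + ennreal (2 * b\<^sup>2) *
           (ennreal ((\<eta> k x)\<^sup>2) * indicator \<gamma> x) \<partial>surface_measure)" for k
    proof (rule nn_integral_mono)
      fix x
      have "(\<zeta> k x)\<^sup>2 \<le> 2 * a\<^sup>2 * (\<phi> k x)\<^sup>2 + 2 * b\<^sup>2 * (\<eta> k x)\<^sup>2"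
        using zero_le_power2[of "a * \<phi> k x - b * \<eta> k x"] unfolding \<zeta>_def lincomb_def
        by (simp add: power2_eq_square algebra_simps)
      then have "ennreal ((\<zeta> k x)\<^sup>2) \<le> ennreal (2 * a\<^sup>2) * ennreal ((\<phi> k x)\<^sup>2) +
          ennreal (2 * b\<^sup>2) * ennreal ((\<eta> k x)\<^sup>2)"
        by (simp flip: ennreal_mult ennreal_plus)
      then show "ennreal ((\<zeta> k x)\<^sup>2) * indicator \<gamma> x \<le>
          ennreal (2 * a\<^sup>2) * (ennreal ((\<phi> k x)\<^sup>2) * indicator \<gamma> x) + ennreal (2 * b\<^sup>2) * (ennreal
              ((\<eta> k x)\<^sup>2) * indicator \<gamma> x)"
        by (auto split: split_indicator)
    qed
    also have "\<dots> k = ennreal (2 * a\<^sup>2) * trace_mass \<gamma> (\<phi> k) +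
         ennreal (2 * b\<^sup>2) * trace_mass \<gamma> (\<eta> k)" for k
      using m[OF \<phi>(1)[of k]] m[OF \<eta>(1)[of k]]
          by (subst nn_integral_add) (auto simp: nn_integral_cmult)
    finally show "eventually (\<lambda>k. trace_mass \<gamma> (\<zeta> k) \<le> ennreal (2 * a\<^sup>2) * trace_mass \<gamma> (\<phi> k) +
         ennreal (2 * b\<^sup>2) * trace_mass \<gamma> (\<eta> k)) sequentially"
      by (intro always_eventually allI)
    have "(\<lambda>k. ennreal (2 * a\<^sup>2) * trace_mass \<gamma> (\<phi> k) +
         ennreal (2 * b\<^sup>2) * trace_mass \<gamma> (\<eta> k)) \<longlonglongrightarrow> ennreal (2 * a\<^sup>2) * 0 + ennreal (2 * b\<^sup>2) * 0"
      by (intro tendsto_add ennreal_tendsto_cmult \<phi>(3) \<eta>(3)) auto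
    then show "(\<lambda>k. ennreal (2 * a\<^sup>2) * trace_mass \<gamma> (\<phi> k) +
         ennreal (2 * b\<^sup>2) * trace_mass \<gamma> (\<eta> k)) \<longlonglongrightarrow> 0" by simp
  qed auto
  ultimately show ?thesis unfolding V_space_iff using uH by (blast intro: H.lincomb_in)
qed

text \<open>
  The trace is defined by approximation with \<open>C\<^sup>1\<close> functions, so a diagonal choice among the
  approximating sequences of the \<open>x n\<close> approximates the limit.
\<close>

lemma V_closed:
  assumes x: "\<And>n. x n \<in> V_space \<Omega> \<gamma>" and v: "v \<in> H1 \<Omega>" and conv: "form_converges (H1_inner \<Omega>) x v"
  shows "v \<in> V_space \<Omega> \<gamma>"
proof -
  have xH: "x n \<in> H1 \<Omega>" for n using x by (auto simp: V_space_iff)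
  have "\<exists>\<phi>. (\<exists>\<psi>. C1_grad \<phi> \<psi>) \<and> H1_norm \<Omega> (fdiff \<phi> (x n)) < inverse (real (Suc n)) \<and>
      trace_mass \<gamma> \<phi> < ennreal (inverse (real (Suc n)))" for n
  proof -
    obtain \<phi> where \<phi>: "\<And>k. \<exists>\<psi>. C1_grad (\<phi> k) \<psi>" "(\<lambda>k. H1_norm \<Omega> (fdiff (\<phi> k) (x n))) \<longlonglongrightarrow> 0"
      "(\<lambda>k. trace_mass \<gamma> (\<phi> k)) \<longlonglongrightarrow> 0"
      using x[of n] unfolding V_space_iff by blast
    have "eventually (\<lambda>k. H1_norm \<Omega> (fdiff (\<phi> k) (x n)) < inverse (real (Suc n))) sequentially"
      by (rule order_tendstoD(2)[OF \<phi>(2)]) simp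
    moreover have "eventually (\<lambda>k. trace_mass \<gamma> (\<phi> k) <
        ennreal (inverse (real (Suc n)))) sequentially"
      by (rule order_tendstoD(2)[OF \<phi>(3)]) simp
    ultimately have "eventually (\<lambda>k. H1_norm \<Omega> (fdiff (\<phi> k) (x n)) < inverse (real (Suc n)) \<and>
        trace_mass \<gamma> (\<phi> k) < ennreal (inverse (real (Suc n)))) sequentially"
      by eventually_elim blast
    then obtain k where "H1_norm \<Omega> (fdiff (\<phi> k) (x n)) < inverse (real (Suc n)) \<and>
        trace_mass \<gamma> (\<phi> k) < ennreal (inverse (real (Suc n)))"
      using eventually_happens'[OF sequentially_bot] by blast
    then show ?thesis using \<phi>(1)[of k] by blast
  qed
  then have "\<forall>n. \<exists>\<phi>. (\<exists>\<psi>. C1_grad \<phi> \<psi>) \<and> H1_norm \<Omega> (fdiff \<phi> (x n)) < inverse (real (Suc n)) \<and>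
      trace_mass \<gamma> \<phi> < ennreal (inverse (real (Suc n)))" ..
  from choice[OF this] obtain \<phi> where "\<forall>n. (\<exists>\<psi>. C1_grad (\<phi> n) \<psi>) \<and> H1_norm \<Omega> (fdiff (\<phi> n) (x n)) <
      inverse (real (Suc n)) \<and>
      trace_mass \<gamma> (\<phi> n) < ennreal (inverse (real (Suc n)))" ..
  then have \<phi>: "\<exists>\<psi>. C1_grad (\<phi> n) \<psi>" "H1_norm \<Omega> (fdiff (\<phi> n) (x n)) < inverse (real (Suc n))"
    "trace_mass \<gamma> (\<phi> n) < ennreal (inverse (real (Suc n)))" for n
    by simp_all
  have \<phi>H: "\<phi> n \<in> H1 \<Omega>" for n using C1_in_H1(1)[OF bdd op] \<phi>(1)[of n] by blast
  have "(\<lambda>n. H1_norm \<Omega> (fdiff (\<phi> n) v)) \<longlonglongrightarrow> 0"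
  proof (rule Lim_null_comparison)
    show "(\<lambda>n. inverse (real (Suc n)) + H1_norm \<Omega> (fdiff (x n) v)) \<longlonglongrightarrow> 0"
      using tendsto_add[OF LIMSEQ_inverse_real_of_nat conv[unfolded H1_norm_tendsto_iff]] by simp
    have "H1_norm \<Omega> (fdiff (\<phi> n) v) \<le> inverse (real (Suc n)) + H1_norm \<Omega> (fdiff (x n) v)" for n
    proof -
      have "fdiff (\<phi> n) v = lincomb 1 (fdiff (\<phi> n) (x n)) 1 (fdiff (x n) v)"
          by (simp add: lincomb_def)
      then have "H1_norm \<Omega> (fdiff (\<phi> n) v) \<le> H1_norm \<Omega> (fdiff (\<phi> n) (x n)) +
          H1_norm \<Omega> (fdiff (x n) v)"
        using H.enorm_lincomb_le[of "fdiff (\<phi> n) (x n)" "fdiff (x n) v" 1 1] \<phi>H xH v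
            by (simp add: enorm_eq)
      then show ?thesis using \<phi>(2)[of n] by simp
    qed
    moreover have "0 \<le> H1_norm \<Omega> w" for w unfolding H1_norm_eq
        by (simp add: H1_inner_def Dirichlet_def L2_inner_nonneg)
    ultimately show "eventually (\<lambda>n. norm (H1_norm \<Omega> (fdiff (\<phi> n) v)) \<le> inverse (real (Suc n)) +
        H1_norm \<Omega> (fdiff (x n) v)) sequentially"
      by simp
  qed
  moreover have "(\<lambda>n. \<integral>\<^sup>+z\<in>\<gamma>. ennreal ((\<phi> n z)\<^sup>2) \<partial>surface_measure) \<longlonglongrightarrow> 0"
  proof (rule tendsto_sandwich[where f = "\<lambda>k. 0"])
    show "eventually (\<lambda>n. trace_mass \<gamma> (\<phi> n) \<le> ennreal (inverse (real (Suc n)))) sequentially"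
      by (intro always_eventually allI less_imp_le \<phi>(3))
    show "(\<lambda>n. ennreal (inverse (real (Suc n)))) \<longlonglongrightarrow> 0"
      using tendsto_ennrealI[OF LIMSEQ_inverse_real_of_nat] by simp
  qed auto
  ultimately show ?thesis unfolding V_space_iff using v \<phi>(1) by blast
qed

text \<open>
  The functions and their gradients converge in \<open>L\<^sup>2\<close> separately, and the defining identity of the
  weak gradient passes to the limit in every component.
\<close>

lemma H1_complete:
  assumes x: "\<And>n. x n \<in> H1 \<Omega>" and Cauchy: "form_Cauchy (H1_inner \<Omega>) x"
  shows "\<exists>v\<in>H1 \<Omega>. form_converges (H1_inner \<Omega>) x v"
proof -
  have gd: "AE z in lebesgue_on \<Omega>. grad \<Omega> (fdiff u v) z = grad \<Omega> u z - grad \<Omega> v z"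
      if "u \<in> H1 \<Omega>" "v \<in> H1 \<Omega>" for u v
    using grad_lincomb(2)[OF bdd op that, of 1 "-1"] by simp
  have L2d: "sqdist (L2_inner \<Omega>) u v = (LINT z|lebesgue_on \<Omega>. (norm (u z - v z))\<^sup>2)" for u v
    by (simp add: L2_inner_self fdiff_eq)
  have Dd: "sqdist (Dirichlet \<Omega>) u v = L2_sqdist \<Omega> (grad \<Omega> u) G"
    if u: "u \<in> H1 \<Omega>" and v: "v \<in> H1 \<Omega>" and G: "G \<in> L2 \<Omega>" "AE z in lebesgue_on \<Omega>. grad \<Omega> v z = G z"
        for u v G
  proof -
    have L: "(\<lambda>z. grad \<Omega> u z - G z) \<in> L2 \<Omega>" using L2_lincomb[OF H1_L2(2)[OF u] G(1), of 1 "-1"]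
        by simp
    have AE: "AE z in lebesgue_on \<Omega>. grad \<Omega> (fdiff u v) z = grad \<Omega> u z - G z"
      using gd[OF u v] G(2) by eventually_elim simp
    have "sqdist (Dirichlet \<Omega>) u v = L2_inner \<Omega> (\<lambda>z. grad \<Omega> u z - G z) (\<lambda>z. grad \<Omega> u z - G z)"
      unfolding Dirichlet_def using u v by (intro L2_inner_cong_AE H1_L2(2) L AE) auto
    then show ?thesis by (simp add: L2_inner_self)
  qed
  obtain v where v: "v \<in> L2 \<Omega>" "(\<lambda>n. L2_sqdist \<Omega> (x n) v) \<longlonglongrightarrow> 0"
  proof (rule L2_complete[OF bdd op])
    show "x n \<in> L2 \<Omega>" for n using x by (rule H1_L2)
    show "\<exists>N. \<forall>m\<ge>N. \<forall>n\<ge>N. L2_sqdist \<Omega> (x m) (x n) < \<epsilon>" if "\<epsilon> > 0" for \<epsilon>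
      using Cauchy that L2_le_H1 unfolding form_Cauchy_def L2d[symmetric] by (meson le_less_trans)
  qed
  obtain G where G: "G \<in> L2 \<Omega>" "(\<lambda>n. L2_sqdist \<Omega> (grad \<Omega> (x n)) G) \<longlonglongrightarrow> 0"
  proof (rule L2_complete[OF bdd op])
    show "grad \<Omega> (x n) \<in> L2 \<Omega>" for n using x by (rule H1_L2)
    have "L2_sqdist \<Omega> (grad \<Omega> (x m)) (grad \<Omega> (x n)) \<le> sqdist (H1_inner \<Omega>) (x m) (x n)" for m n
      using Dirichlet_le_H1[of "fdiff (x m) (x n)"] Dd[OF x[of m] x[of n] H1_L2(2)[OF x[of n]]]
          by simp
    then show "\<exists>N. \<forall>m\<ge>N. \<forall>n\<ge>N. L2_sqdist \<Omega> (grad \<Omega> (x m)) (grad \<Omega> (x n)) < \<epsilon>" if "\<epsilon> > 0" for \<epsilon>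
      using Cauchy that unfolding form_Cauchy_def by (meson le_less_trans)
  qed
  have W: "weak_gradient \<Omega> v G"
    unfolding weak_gradient_def
  proof (intro conjI allI impI v(1) G(1))
    fix \<phi> \<psi> assume t: "C1_grad \<phi> \<psi> \<and> compact (closure {x. \<phi> x \<noteq> 0}) \<and> closure {x. \<phi> x \<noteq> 0} \<subseteq> \<Omega>"
    have LL: "\<phi> \<in> L2 \<Omega>" "\<psi> \<in> L2 \<Omega>" using t C1_grad_continuous continuous_in_L2[OF bdd op] by blast+
    show "(LINT x|lebesgue_on \<Omega>. v x *\<^sub>R \<psi> x) = - (LINT x|lebesgue_on \<Omega>. \<phi> x *\<^sub>R G x)"
    proof (rule euclidean_eqI)
      fix e :: "real^'n" assume e: "e \<in> Basis"
      have lim: "(\<lambda>n. L2_inner \<Omega> (y n) w) \<longlonglongrightarrow> L2_inner \<Omega> y0 w"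
        if "\<And>n. y n \<in> L2 \<Omega>" "y0 \<in> L2 \<Omega>" "w \<in> L2 \<Omega>" "(\<lambda>n. L2_sqdist \<Omega> (y n) y0) \<longlonglongrightarrow> 0" for y
            and y0 w :: "real^'n \<Rightarrow> real"
        by (rule L.form_converges_left[OF L2_inner_sym_form _ that(1-3)])
          (use that(4) in \<open>simp_all add: L2_inner_nonneg form_converges_def L2d\<close>)
      have \<psi>e: "(\<lambda>z. \<psi> z \<bullet> e) \<in> L2 \<Omega>"
        using t C1_grad_continuous(2) by (intro continuous_in_L2[OF bdd op] continuous_intros) blast
      have 1: "(\<lambda>n. L2_inner \<Omega> (x n) (\<lambda>z. \<psi> z \<bullet> e)) \<longlonglongrightarrow> L2_inner \<Omega> v (\<lambda>z. \<psi> z \<bullet> e)"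
        by (intro lim H1_L2 x v \<psi>e)
      have comp: "(\<lambda>z. F z \<bullet> e) \<in> L2 \<Omega>" if "F \<in> L2 \<Omega>" for F :: "real^'n \<Rightarrow> real^'n"
      proof -
        have "integrable (lebesgue_on \<Omega>) (\<lambda>z. (norm (F z \<bullet> e))\<^sup>2)"
        proof (rule Bochner_Integration.integrable_bound)
          show "integrable (lebesgue_on \<Omega>) (\<lambda>z. (norm (F z))\<^sup>2)" using that by (simp add: L2_def)
          show "(\<lambda>z. (norm (F z \<bullet> e))\<^sup>2) \<in> borel_measurable (lebesgue_on \<Omega>)" using that
              by (auto simp: L2_def)
          have "\<bar>F z \<bullet> e\<bar> \<le> norm (F z)" for z using Basis_le_norm[OF e] by simp
          then have "(\<bar>F z \<bullet> e\<bar>)\<^sup>2 \<le> (norm (F z))\<^sup>2" for z by (intro power_mono) auto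
          then show "AE z in lebesgue_on \<Omega>. norm ((norm (F z \<bullet> e))\<^sup>2) \<le> norm ((norm (F z))\<^sup>2)"
              by simp
        qed
        then show ?thesis using that by (auto simp: L2_def)
      qed
      have 2: "(\<lambda>n. L2_inner \<Omega> (\<lambda>z. grad \<Omega> (x n) z \<bullet> e) \<phi>) \<longlonglongrightarrow> L2_inner \<Omega> (\<lambda>z. G z \<bullet> e) \<phi>"
      proof (rule lim[OF comp[OF H1_L2(2)[OF x]] comp[OF G(1)] LL(1)])
        have Gd: "(\<lambda>z. grad \<Omega> (x n) z - G z) \<in> L2 \<Omega>" for n
            using L2_lincomb[OF H1_L2(2)[OF x[of n]] G(1), of 1 "-1"] by simp
        show "(\<lambda>n. LINT z|lebesgue_on \<Omega>. (norm (grad \<Omega> (x n) z \<bullet> e - G z \<bullet> e))\<^sup>2) \<longlonglongrightarrow> 0"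
        proof (rule Lim_null_comparison[OF _ G(2)], intro always_eventually allI)
          fix n
          have "(LINT z|lebesgue_on \<Omega>. (norm (grad \<Omega> (x n) z \<bullet> e - G z \<bullet> e))\<^sup>2) \<le>
              L2_sqdist \<Omega> (grad \<Omega> (x n)) G"
          proof (rule integral_mono)
            show "integrable (lebesgue_on \<Omega>) (\<lambda>z. (norm (grad \<Omega> (x n) z - G z))\<^sup>2)" using Gd[of n]
                by (simp add: L2_def)
            show "integrable (lebesgue_on \<Omega>) (\<lambda>z. (norm (grad \<Omega> (x n) z \<bullet> e - G z \<bullet> e))\<^sup>2)"
              using comp[OF Gd[of n]] by (simp add: L2_def inner_diff_left)
            fix z
            have "\<bar>(grad \<Omega> (x n) z - G z) \<bullet> e\<bar> \<le> norm (grad \<Omega> (x n) z - G z)"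
                using Basis_le_norm[OF e] by simp
            then have "(\<bar>(grad \<Omega> (x n) z - G z) \<bullet> e\<bar>)\<^sup>2 \<le> (norm (grad \<Omega> (x n) z - G z))\<^sup>2"
                by (intro power_mono) auto
            then show "(norm (grad \<Omega> (x n) z \<bullet> e - G z \<bullet> e))\<^sup>2 \<le> (norm (grad \<Omega> (x n) z - G z))\<^sup>2"
              by (simp add: inner_diff_left)
          qed
          then show "norm (LINT z|lebesgue_on \<Omega>. (norm (grad \<Omega> (x n) z \<bullet> e - G z \<bullet> e))\<^sup>2) \<le>
              L2_sqdist \<Omega> (grad \<Omega> (x n)) G"
            by simp
        qed
      qed
      have c1: "L2_inner \<Omega> u (\<lambda>z. \<psi> z \<bullet> e) = (LINT z|lebesgue_on \<Omega>. u z *\<^sub>R \<psi> z) \<bullet> e"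
          if "u \<in> L2 \<Omega>" for u
        unfolding integral_inner_left[OF test_integrable[OF LL(2) that], symmetric]
            by (simp add: L2_inner_def)
      have c2: "L2_inner \<Omega> (\<lambda>z. F z \<bullet> e) \<phi> = (LINT z|lebesgue_on \<Omega>. \<phi> z *\<^sub>R F z) \<bullet> e"
          if "F \<in> L2 \<Omega>" for F
        unfolding integral_inner_left[OF test_integrable[OF that LL(1)], symmetric]
            by (simp add: L2_inner_def mult.commute)
      have "L2_inner \<Omega> (x n) (\<lambda>z. \<psi> z \<bullet> e) = - L2_inner \<Omega> (\<lambda>z. grad \<Omega> (x n) z \<bullet> e) \<phi>" for n
      proof -
        have "(LINT z|lebesgue_on \<Omega>. x n z *\<^sub>R \<psi> z) =
            - (LINT z|lebesgue_on \<Omega>. \<phi> z *\<^sub>R grad \<Omega> (x n) z)"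
          using t by (intro weak_gradientD[OF weak_gradient_grad[OF x]]) blast+
        then show ?thesis unfolding c1[OF H1_L2(1)[OF x]] c2[OF H1_L2(2)[OF x]]
            by (simp only: inner_minus_left)
      qed
      then have "(\<lambda>n. L2_inner \<Omega> (x n) (\<lambda>z. \<psi> z \<bullet> e)) \<longlonglongrightarrow> - L2_inner \<Omega> (\<lambda>z. G z \<bullet> e) \<phi>"
        using tendsto_minus[OF 2] by simp
      then have "L2_inner \<Omega> v (\<lambda>z. \<psi> z \<bullet> e) = - L2_inner \<Omega> (\<lambda>z. G z \<bullet> e) \<phi>" using 1 LIMSEQ_unique
          by blast
      then show "(LINT x|lebesgue_on \<Omega>. v x *\<^sub>R \<psi> x) \<bullet> e =
          (- (LINT x|lebesgue_on \<Omega>. \<phi> x *\<^sub>R G x)) \<bullet> e"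
        using c1[OF v(1)] c2[OF G(1)] by simp
    qed
  qed
  then have vH: "v \<in> H1 \<Omega>" by (auto simp: H1_def)
  have gv: "AE z in lebesgue_on \<Omega>. grad \<Omega> v z = G z"
    by (rule weak_gradient_unique[OF bdd op weak_gradient_grad[OF vH] W]) simp
  have "form_converges (H1_inner \<Omega>) x v"
    unfolding form_converges_def H1_inner_def L2d Dd[OF x vH G(1) gv]
    using tendsto_add[OF v(2) G(2)] by simp
  then show ?thesis using vH by blast
qed

end

section \<open>Compactness of the embedding into the square integrable functions\<close>

abbreviation ball_integral :: "(real^'n) set \<Rightarrow> real^'n \<Rightarrow> real \<Rightarrow> (real^'n \<Rightarrow> real) \<Rightarrow> real" where
  "ball_integral \<Omega> q r u \<equiv> L2_inner \<Omega> u (indicator (ball q r))"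

context bounded_open_set
begin

lemma nn_integral_eq_L2:
  fixes f :: "real^'n \<Rightarrow> 'b::euclidean_space"
  assumes f: "continuous_on UNIV f"
  shows "sq_norm_mass \<Omega> f = ennreal (L2_inner \<Omega> f f)"
proof -
  have c: "continuous_on UNIV (\<lambda>x. (norm (f x))\<^sup>2)" using f by (intro continuous_intros)
  have i: "set_integrable lborel \<Omega> (\<lambda>x. (norm (f x))\<^sup>2)"
    using op by (intro continuous_set_integrable_bounded[OF c bdd]) auto
  have "sq_norm_mass \<Omega> f = (\<integral>\<^sup>+x. ennreal (indicator \<Omega> x *\<^sub>R (norm (f x))\<^sup>2) \<partial>lborel)"
    by (intro nn_integral_cong) (auto split: split_indicator)
  also have "\<dots> = ennreal (LBINT x:\<Omega>. (norm (f x))\<^sup>2)"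
    unfolding set_lebesgue_integral_def using i unfolding set_integrable_def
        by (intro nn_integral_eq_integral) auto
  also have "(LBINT x:\<Omega>. (norm (f x))\<^sup>2) = L2_inner \<Omega> f f"
    unfolding L2_inner_self using op
        by (intro integral_lebesgue_on_borel[symmetric] borel_measurable_continuous_onI[OF c]) auto
  finally show ?thesis .
qed

lemma indicator_ball_L2: "(indicator (ball q r) :: real^'n \<Rightarrow> real) \<in> L2 \<Omega>"
proof -
  interpret finite_measure "lebesgue_on \<Omega>" by (rule finite_measure_lebesgue_on[OF bdd op])
  have m: "(indicator (ball q r) :: real^'n \<Rightarrow> real) \<in> borel_measurable (lebesgue_on \<Omega>)"
    by (intro borel_measurable_lebesgue_on borel_measurable_indicator) auto
  have "integrable (lebesgue_on \<Omega>) (\<lambda>x. (norm (indicator (ball q r) x :: real))\<^sup>2)"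
    by (rule integrable_const_bound[of _ 1]) (use m in \<open>auto split: split_indicator\<close>)
  then show ?thesis using m by (simp add: L2_def)
qed

lemma C1_ball_integral:
  assumes "C1_grad \<phi> \<psi>" "ball q r \<subseteq> \<Omega>"
  shows "(LBINT x:ball q r. \<phi> x) = ball_integral \<Omega> q r \<phi>"
proof -
  have m: "(\<lambda>x. \<phi> x * indicator (ball q r) x) \<in> borel_measurable borel"
    using C1_grad_measurable(1)[OF assms(1)]
        by (intro borel_measurable_times borel_measurable_indicator) auto
  have "ball_integral \<Omega> q r \<phi> = (LBINT x:\<Omega>. \<phi> x * indicator (ball q r) x)"
    unfolding L2_inner_def using integral_lebesgue_on_borel[OF op m] by simp
  also have "\<dots> = (LBINT x:ball q r. \<phi> x)"
    unfolding set_lebesgue_integral_def using assms(2)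
    by (intro Bochner_Integration.integral_cong) (auto split: split_indicator)
  finally show ?thesis ..
qed

text \<open>
  By the definition of the trace, elements of the space are limits in \<open>H\<^sup>1\<close> of \<open>C\<^sup>1\<close> functions;
  both sides of the estimate are continuous for this convergence.
\<close>

lemma finite_rank_V_estimate:
  assumes lip: "lipschitz_domain \<Omega>" and \<epsilon>: "\<epsilon> > 0"
  obtains D r C where "finite D" "0 \<le> C"
    "\<And>u. u \<in> V_space \<Omega> \<gamma> \<Longrightarrow> L2_inner \<Omega> u u \<le>
        \<epsilon> * Dirichlet \<Omega> u u + C * (\<Sum>q\<in>D. (ball_integral \<Omega> q r u)\<^sup>2)"
proof -
  obtain D r C where D0: "finite D" "r > 0" "0 \<le> C" "\<And>q. q \<in> D \<Longrightarrow> ball q r \<subseteq> \<Omega>"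
    and est: "\<And>\<phi> \<psi>. C1_grad \<phi> \<psi> \<Longrightarrow> sq_mass \<Omega> \<phi> \<le>
        ennreal \<epsilon> * sq_norm_mass \<Omega> \<psi> +
        ennreal (C * (\<Sum>q\<in>D. (LBINT x:ball q r. \<phi> x)\<^sup>2))"
    by (rule finite_rank_L2_estimate[OF lip \<epsilon>]) (rule that)
  note D = D0(1,3,4)
  have C1: "L2_inner \<Omega> \<phi> \<phi> \<le> \<epsilon> * Dirichlet \<Omega> \<phi> \<phi> + C * (\<Sum>q\<in>D. (ball_integral \<Omega> q r \<phi>)\<^sup>2)"
    if c: "C1_grad \<phi> \<psi>" for \<phi> \<psi>
  proof -
    note cont = C1_grad_continuous[OF c]
    have "Dirichlet \<Omega> \<phi> \<phi> = L2_inner \<Omega> \<psi> \<psi>"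
      unfolding Dirichlet_def using C1_in_H1[OF bdd op c]
      by (intro L2_inner_cong_AE H1_L2(2) continuous_in_L2[OF bdd op cont(2)]) auto
    moreover have "sq_mass \<Omega> \<phi> = ennreal (L2_inner \<Omega> \<phi> \<phi>)"
      using nn_integral_eq_L2[OF cont(1)] by simp
    moreover have "(\<Sum>q\<in>D. (LBINT x:ball q r. \<phi> x)\<^sup>2) = (\<Sum>q\<in>D. (ball_integral \<Omega> q r \<phi>)\<^sup>2)"
      using C1_ball_integral[OF c D(3)] by simp
    ultimately have "ennreal (L2_inner \<Omega> \<phi> \<phi>) \<le> ennreal \<epsilon> * ennreal (Dirichlet \<Omega> \<phi> \<phi>) +
        ennreal (C * (\<Sum>q\<in>D. (ball_integral \<Omega> q r \<phi>)\<^sup>2))"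
      using est[OF c] nn_integral_eq_L2[OF cont(2)] by simp
    also have "\<dots> = ennreal (\<epsilon> * Dirichlet \<Omega> \<phi> \<phi> + C * (\<Sum>q\<in>D. (ball_integral \<Omega> q r \<phi>)\<^sup>2))"
      using \<epsilon> D(2) by (simp add: ennreal_mult ennreal_plus Dirichlet_def L2_inner_nonneg sum_nonneg)
    finally show ?thesis
      using \<epsilon> D(2) by (subst (asm) ennreal_le_iff) (auto intro!: add_nonneg_nonneg
          mult_nonneg_nonneg sum_nonneg simp: Dirichlet_def L2_inner_nonneg)
  qed
  show ?thesis
  proof (rule that[OF D(1,2)])
    fix u assume "u \<in> V_space \<Omega> \<gamma>"
    then obtain \<phi> where uH: "u \<in> H1 \<Omega>" and \<phi>: "\<forall>k. \<exists>\<psi>. C1_grad (\<phi> k) \<psi>" "(\<lambda>k::nat.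
        H1_norm \<Omega> (fdiff (\<phi> k) u)) \<longlonglongrightarrow> 0"
      unfolding V_space_iff by blast
    have \<phi>H: "\<phi> k \<in> H1 \<Omega>" for k using C1_in_H1(1)[OF bdd op] \<phi>(1) by blast
    have conv: "form_converges (H1_inner \<Omega>) \<phi> u" using \<phi>(2) by (simp only: H1_norm_tendsto_iff)
    have cL: "form_converges (L2_inner \<Omega>) \<phi> u" unfolding form_converges_def
      by (rule Lim_null_comparison[OF _ conv[unfolded form_converges_def]])
        (simp add: L2_le_H1 L2_inner_nonneg)
    have cD: "form_converges (Dirichlet \<Omega>) \<phi> u" unfolding form_converges_def
      by (rule Lim_null_comparison[OF _ conv[unfolded form_converges_def]])
        (use Dirichlet_le_H1 in \<open>simp add: Dirichlet_def L2_inner_nonneg\<close>)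
    have l1: "(\<lambda>k. L2_inner \<Omega> (\<phi> k) (\<phi> k)) \<longlonglongrightarrow> L2_inner \<Omega> u u"
      by (rule L.form_converges_square[OF L2_inner_sym_form _ H1_L2(1)[OF \<phi>H] H1_L2(1)[OF uH] cL])
          (rule L2_inner_nonneg)
    have l2: "(\<lambda>k. Dirichlet \<Omega> (\<phi> k) (\<phi> k)) \<longlonglongrightarrow> Dirichlet \<Omega> u u"
      by (rule H.form_converges_square[OF Dirichlet_sym_form[OF bdd op] _ \<phi>H uH cD]) (simp add:
          Dirichlet_def L2_inner_nonneg)
    have l3: "(\<lambda>k. ball_integral \<Omega> q r (\<phi> k)) \<longlonglongrightarrow> ball_integral \<Omega> q r u" for q
      by (rule L.form_converges_left[OF L2_inner_sym_form _ H1_L2(1)[OF \<phi>H] H1_L2(1)[OF uH]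
          indicator_ball_L2 cL]) (rule L2_inner_nonneg)
    show "L2_inner \<Omega> u u \<le> \<epsilon> * Dirichlet \<Omega> u u + C * (\<Sum>q\<in>D. (ball_integral \<Omega> q r u)\<^sup>2)"
    proof (rule LIMSEQ_le[OF l1])
      show "(\<lambda>k. \<epsilon> * Dirichlet \<Omega> (\<phi> k) (\<phi> k) + C * (\<Sum>q\<in>D. (ball_integral \<Omega> q r (\<phi> k))\<^sup>2))
          \<longlonglongrightarrow> \<epsilon> * Dirichlet \<Omega> u u + C * (\<Sum>q\<in>D. (ball_integral \<Omega> q r u)\<^sup>2)"
        by (intro tendsto_intros l2 l3)
      show "\<exists>N. \<forall>n\<ge>N. L2_inner \<Omega> (\<phi> n) (\<phi> n) \<le> \<epsilon> * Dirichlet \<Omega> (\<phi> n) (\<phi> n) +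
          C * (\<Sum>q\<in>D. (ball_integral \<Omega> q r (\<phi> n))\<^sup>2)"
        using C1 \<phi>(1) by blast
    qed
  qed
qed

text \<open>
  The estimates for the constants \<open>1 / (j + 1)\<close> involve countably many balls altogether. A
  diagonal subsequence makes the integrals over all of them converge, and then the estimates make
  it Cauchy in \<open>L\<^sup>2\<close>.
\<close>

lemma Rellich:
  assumes lip: "lipschitz_domain \<Omega>" and \<gamma>: "\<gamma> \<in> sets borel"
    and x: "\<And>n. x n \<in> V_space \<Omega> \<gamma>" and bd: "\<And>n. H1_inner \<Omega> (x n) (x n) \<le> R"
  shows "\<exists>s. strict_mono (s :: nat \<Rightarrow> nat) \<and> form_Cauchy (L2_inner \<Omega>) (x \<circ> s)"
proof -
  have xH: "x n \<in> H1 \<Omega>" for n using x by (auto simp: V_space_iff)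
  note xL = H1_L2(1)[OF xH]
  have R0: "0 \<le> R" using bd[of 0] H.A_nonneg[OF xH[of 0]] by linarith
  have "\<exists>D r C. finite D \<and> 0 \<le> C \<and> (\<forall>u\<in>V_space \<Omega> \<gamma>. L2_inner \<Omega> u u \<le>
        inverse (real (Suc j)) * Dirichlet \<Omega> u u + C * (\<Sum>q\<in>D. (ball_integral \<Omega> q r u)\<^sup>2))" for j
    by (rule finite_rank_V_estimate[OF lip, of "inverse (real (Suc j))" \<gamma>]) (simp, blast)
  then have "\<forall>j. \<exists>p. finite (fst p) \<and> 0 \<le> snd (snd p) \<and> (\<forall>u\<in>V_space \<Omega> \<gamma>. L2_inner \<Omega> u u \<le>
        inverse (real (Suc j)) * Dirichlet \<Omega> u u + snd (snd p) * (\<Sum>q\<in>fst p. (ball_integral \<Omega> q (fst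
            (snd p)) u)\<^sup>2))"
    by (simp add: split_paired_Ex)
  from choice[OF this] obtain p where p: "\<forall>j. finite (fst (p j)) \<and> 0 \<le> snd (snd (p j)) \<and>
      (\<forall>u\<in>V_space \<Omega> \<gamma>. L2_inner \<Omega> u u \<le>
        inverse (real (Suc j)) * Dirichlet \<Omega> u u + snd (snd (p j)) * (\<Sum>q\<in>fst (p j). (L2_inner \<Omega> u
            (indicator (ball q (fst (snd (p j))))))\<^sup>2))"
    by blast
  define D where "D j = fst (p j)" for j
  define r where "r j = fst (snd (p j))" for j
  define C where "C j = snd (snd (p j))" for j
  have fD: "finite (D j)" and C0: "0 \<le> C j" for j using p by (auto simp: D_def C_def)
  have est: "L2_inner \<Omega> u u \<le> inverse (real (Suc j)) * Dirichlet \<Omega> u u + C j * (\<Sum>q\<in>D j.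
      (ball_integral \<Omega> q (r j) u)\<^sup>2)"
    if "u \<in> V_space \<Omega> \<gamma>" for j u using p that unfolding D_def C_def r_def by blast
  define ind :: "nat \<Rightarrow> real^'n \<Rightarrow> real" where
    "ind n = indicator (ball (from_nat_into (D (fst (prod_decode n))) (snd (prod_decode n))) (r (fst
        (prod_decode n))))" for n
  have indL: "ind n \<in> L2 \<Omega>" for n unfolding ind_def by (rule indicator_ball_L2)
  have "\<bar>L2_inner \<Omega> (x k) (ind n)\<bar> \<le> sqrt (R * L2_inner \<Omega> (ind n) (ind n))" for n k
  proof (rule real_le_rsqrt)
    have "(L2_inner \<Omega> (x k) (ind n))\<^sup>2 \<le> L2_inner \<Omega> (x k) (x k) * L2_inner \<Omega> (ind n) (ind n)"
      by (rule L.Cauchy_Schwarz_form[OF L2_inner_sym_form _ xL indL]) (rule L2_inner_nonneg)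
    also have "\<dots> \<le> R * L2_inner \<Omega> (ind n) (ind n)"
      using order.trans[OF L2_le_H1 bd[of k]] by (intro mult_right_mono L2_inner_nonneg)
    finally show "\<bar>L2_inner \<Omega> (x k) (ind n)\<bar>\<^sup>2 \<le> R * L2_inner \<Omega> (ind n) (ind n)" by simp
  qed
  then obtain s where s: "strict_mono (s :: nat \<Rightarrow> nat)" "\<And>n. convergent (\<lambda>k.
      L2_inner \<Omega> (x (s k)) (ind n))"
    by (rule bounded_sequences_common_subsequence[of "\<lambda>n k. L2_inner \<Omega> (x k) (ind n)"]) blast
  define y where "y = x \<circ> s"
  have yV: "y k \<in> V_space \<Omega> \<gamma>" and yH: "y k \<in> H1 \<Omega>" and yR: "H1_inner \<Omega> (y k) (y k) \<le> R" for k
    using x xH bd by (simp_all add: y_def)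
  have ballC: "Cauchy (\<lambda>k. ball_integral \<Omega> q (r j) (y k))" if "q \<in> D j" for q j
  proof -
    define n where "n = prod_encode (j, to_nat_on (D j) q)"
    have "ind n = indicator (ball q (r j))"
      using that by (simp add: ind_def n_def from_nat_into_to_nat_on countable_finite fD)
    then show ?thesis using s(2)[of n] by (simp add: y_def convergent_Cauchy)
  qed
  have "form_Cauchy (L2_inner \<Omega>) y"
    unfolding form_Cauchy_def
  proof (intro allI impI)
    fix \<epsilon> :: real assume \<epsilon>: "\<epsilon> > 0"
    obtain j where j: "inverse (real (Suc j)) < \<epsilon> / (2 * (4 * R + 1))"
      using reals_Archimedean[of "\<epsilon> / (2 * (4 * R + 1))"] \<epsilon> R0 by auto
    define c where "c = C j * real (card (D j)) + 1"
    have c: "c > 0" using C0[of j] by (simp add: c_def add_nonneg_pos)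
    define \<eta> where "\<eta> = sqrt (\<epsilon> / (2 * c))"
    have \<eta>: "\<eta> > 0" "\<eta>\<^sup>2 = \<epsilon> / (2 * c)" using \<epsilon> c by (auto simp: \<eta>_def)
    have "\<forall>q\<in>D j. eventually (\<lambda>N. \<forall>m\<ge>N. \<forall>n\<ge>N. \<bar>ball_integral \<Omega> q (r j) (y m) -
        ball_integral \<Omega> q (r j) (y n)\<bar> < \<eta>) sequentially"
    proof
      fix q assume "q \<in> D j"
      from CauchyD[OF ballC[OF this] \<eta>(1)] obtain N0 where
        "\<forall>m\<ge>N0. \<forall>n\<ge>N0. norm (ball_integral \<Omega> q (r j) (y m) - ball_integral \<Omega> q (r j) (y n)) < \<eta>"
            by blast
      then show "eventually (\<lambda>N. \<forall>m\<ge>N. \<forall>n\<ge>N. \<bar>ball_integral \<Omega> q (r j) (y m) -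
          ball_integral \<Omega> q (r j) (y n)\<bar> < \<eta>) sequentially"
        unfolding eventually_sequentially real_norm_def by (meson order.trans)
    qed
    then have "eventually (\<lambda>N. \<forall>q\<in>D j. \<forall>m\<ge>N. \<forall>n\<ge>N. \<bar>ball_integral \<Omega> q (r j) (y m) -
        ball_integral \<Omega> q (r j) (y n)\<bar> < \<eta>) sequentially"
      by (rule eventually_ball_finite[OF fD])
    then obtain N where N: "\<forall>q\<in>D j. \<forall>m\<ge>N. \<forall>n\<ge>N. \<bar>ball_integral \<Omega> q (r j) (y m) -
        ball_integral \<Omega> q (r j) (y n)\<bar> < \<eta>"
      using eventually_happens'[OF sequentially_bot] by blast
    have "sqdist (L2_inner \<Omega>) (y m) (y n) < \<epsilon>" if mn: "m \<ge> N" "n \<ge> N" for m n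
    proof -
      define w where "w = fdiff (y m) (y n)"
      have wV: "w \<in> V_space \<Omega> \<gamma>" unfolding w_def by (rule V_lincomb[OF \<gamma> yV yV])
      have "Dirichlet \<Omega> w w \<le> H1_inner \<Omega> w w" by (rule Dirichlet_le_H1)
      also have "\<dots> \<le> 4 * R"
      proof -
        have "0 \<le> H1_inner \<Omega> (lincomb 1 (y m) 1 (y n)) (lincomb 1 (y m) 1 (y n))"
          by (rule H.A_nonneg) (simp add: yH)
        then show ?thesis using yR[of m] yR[of n]
          unfolding w_def by (simp add: H.sym_form_square[OF H.A_form] yH)
      qed
      finally have "inverse (real (Suc j)) * Dirichlet \<Omega> w w \<le> inverse (real (Suc j)) * (4 * R)"
        by (intro mult_left_mono) auto
      also have "\<dots> \<le> \<epsilon> / (2 * (4 * R + 1)) * (4 * R)" using j R0 by (intro mult_right_mono) auto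
      also have "\<dots> < \<epsilon> / 2"
      proof -
        have "\<epsilon> / (2 * k) * (k - 1) < \<epsilon> / 2" if "k > 0" for k using that \<epsilon>
            by (simp add: field_simps)
        from this[of "4 * R + 1"] R0 show ?thesis by simp
      qed
      finally have t1: "inverse (real (Suc j)) * Dirichlet \<Omega> w w < \<epsilon> / 2" .
      have "(ball_integral \<Omega> q (r j) w)\<^sup>2 \<le> \<eta>\<^sup>2" if "q \<in> D j" for q
      proof -
        have "ball_integral \<Omega> q (r j) w = ball_integral \<Omega> q (r j) (y m) -
            ball_integral \<Omega> q (r j) (y n)"
          unfolding w_def by (simp add: L.sym_form_left[OF L2_inner_sym_form] H1_L2(1)[OF yH]
              indicator_ball_L2)
        moreover have "\<bar>ball_integral \<Omega> q (r j) (y m) - ball_integral \<Omega> q (r j) (y n)\<bar> < \<eta>"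
          using N that mn by blast
        ultimately have "\<bar>ball_integral \<Omega> q (r j) w\<bar> \<le> \<eta>" by simp
        then have "\<bar>ball_integral \<Omega> q (r j) w\<bar>\<^sup>2 \<le> \<eta>\<^sup>2" by (intro power_mono) auto
        then show ?thesis by simp
      qed
      then have "(\<Sum>q\<in>D j. (ball_integral \<Omega> q (r j) w)\<^sup>2) \<le> real (card (D j)) * \<eta>\<^sup>2"
        by (rule sum_bounded_above)
      then have "C j * (\<Sum>q\<in>D j. (ball_integral \<Omega> q (r j) w)\<^sup>2) \<le> C j * (real (card (D j)) * \<eta>\<^sup>2)"
        using C0 by (intro mult_left_mono)
      also have "\<dots> \<le> c * \<eta>\<^sup>2" unfolding c_def by (simp add: distrib_right)
      also have "\<dots> = \<epsilon> / 2" using \<eta> c by simp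
      finally show ?thesis using est[OF wV, of j] t1 unfolding w_def by linarith
    qed
    then show "\<exists>N. \<forall>m\<ge>N. \<forall>n\<ge>N. sqdist (L2_inner \<Omega>) (y m) (y n) < \<epsilon>" by blast
  qed
  then show ?thesis using s(1) unfolding y_def by blast
qed

end

section \<open>The coefficients of a conformal family\<close>

lemma vec_component2_bound: "\<bar>(A :: real^'n^'m) $ i $ j\<bar> \<le> norm A"
  using Finite_Cartesian_Product.norm_nth_le[of "A $ i" j] Finite_Cartesian_Product.norm_nth_le[of A
      i]
  by simp

lemma vec_component2_derivative:
  fixes M :: "real \<Rightarrow> real^'n^'m"
  assumes "(M has_vector_derivative D) (at t)"
  shows "((\<lambda>s. M s $ i $ j) has_real_derivative D $ i $ j) (at t)"
proof -
  have "bounded_linear (\<lambda>A :: real^'n^'m. A $ i $ j)"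
    by (rule bounded_linear_compose[OF bounded_linear_vec_nth bounded_linear_vec_nth])
  from bounded_linear.has_vector_derivative[OF this assms] show ?thesis
    by (simp add: has_real_derivative_iff_has_vector_derivative)
qed

lemma vec_component2_measurable:
  fixes M :: "'a \<Rightarrow> real^'n^'m"
  assumes "M \<in> borel_measurable N"
  shows "(\<lambda>x. M x $ i $ j) \<in> borel_measurable N"
proof -
  have "(\<lambda>A :: real^'n^'m. A $ i $ j) \<in> borel_measurable borel"
    by (intro borel_measurable_continuous_onI continuous_intros)
  from measurable_compose[OF assms this] show ?thesis .
qed

text \<open>
  The Jacobi determinant inherits the regularity of the entries of the Jacobi matrix, because it
  is a polynomial in them; \<open>a1\<close> and \<open>a2\<close> are its formal derivatives.
\<close>

lemma jacobian_C2:
  fixes \<Omega> :: "(real^2) set"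
  assumes C2: "C2_Linfty I \<Omega> (DT T)"
  obtains a1 a2 C where "0 \<le> C"
    "AE x in lebesgue_on \<Omega>. \<forall>s\<in>I. \<bar>a_coeff T s x\<bar> \<le> C \<and> \<bar>a1 s x\<bar> \<le> C \<and> \<bar>a2 s x\<bar> \<le> C \<and>
       ((\<lambda>s. a_coeff T s x) has_real_derivative a1 s x) (at s) \<and>
       ((\<lambda>s. a1 s x) has_real_derivative a2 s x) (at s)"
    "\<And>s. s \<in> I \<Longrightarrow> a_coeff T s \<in> borel_measurable (lebesgue_on \<Omega>)"
    "\<And>s. s \<in> I \<Longrightarrow> a1 s \<in> borel_measurable (lebesgue_on \<Omega>)"
    "\<And>s. s \<in> I \<Longrightarrow> a2 s \<in> borel_measurable (lebesgue_on \<Omega>)"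
proof -
  define M where "M = DT T"
  obtain M1 M2 where der: "AE x in lebesgue_on \<Omega>. \<forall>t\<in>I.
           ((\<lambda>s. M s x) has_vector_derivative M1 t x) (at t) \<and>
           ((\<lambda>s. M1 s x) has_vector_derivative M2 t x) (at t)"
    and bnds: "\<forall>N\<in>{M, M1, M2}. bounded_Linfty I \<Omega> N \<and> continuous_Linfty I \<Omega> N"
    using C2 unfolding C2_Linfty_def M_def by blast
  have m: "M t \<in> borel_measurable (lebesgue_on \<Omega>)" "M1 t \<in> borel_measurable (lebesgue_on \<Omega>)"
    "M2 t \<in> borel_measurable (lebesgue_on \<Omega>)" if "t \<in> I" for t
    using bnds that unfolding continuous_Linfty_def by blast+
  note mc = vec_component2_measurable[OF m(1)] vec_component2_measurable[OF m(2)]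
      vec_component2_measurable[OF m(3)]
  obtain c0 c1 c2 where b: "AE x in lebesgue_on \<Omega>. \<forall>t\<in>I. norm (M t x) \<le> c0"
    "AE x in lebesgue_on \<Omega>. \<forall>t\<in>I. norm (M1 t x) \<le> c1" "AE x in lebesgue_on \<Omega>. \<forall>t\<in>I. norm (M2 t x) \<le>
        c2"
    using bnds unfolding bounded_Linfty_def by blast
  define c where "c = \<bar>c0\<bar> + \<bar>c1\<bar> + \<bar>c2\<bar>"
  \<comment> \<open>The constant \<open>8\<close> counts the products of two entries in \<open>a2\<close>.\<close>
  define a1 where "a1 s x = M1 s x $ 1 $ 1 * M s x $ 2 $ 2 + M s x $ 1 $ 1 * M1 s x $ 2 $ 2
      - (M1 s x $ 1 $ 2 * M s x $ 2 $ 1 + M s x $ 1 $ 2 * M1 s x $ 2 $ 1)" for s x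
  define a2 where "a2 s x = M2 s x $ 1 $ 1 * M s x $ 2 $ 2 + 2 * (M1 s x $ 1 $ 1 * M1 s x $ 2 $ 2) +
      M s x $ 1 $ 1 * M2 s x $ 2 $ 2
      - (M2 s x $ 1 $ 2 * M s x $ 2 $ 1 + 2 * (M1 s x $ 1 $ 2 * M1 s x $ 2 $ 1) + M s x $ 1 $ 2 * M2
          s x $ 2 $ 1)" for s x
  have a: "a_coeff T s x = M s x $ 1 $ 1 * M s x $ 2 $ 2 - M s x $ 1 $ 2 * M s x $ 2 $ 1" for s x
    by (simp add: a_coeff_def M_def det_2)
  have "AE x in lebesgue_on \<Omega>. \<forall>s\<in>I. \<bar>a_coeff T s x\<bar> \<le> 8 * c\<^sup>2 \<and> \<bar>a1 s x\<bar> \<le> 8 * c\<^sup>2 \<and> \<bar>a2 s x\<bar> \<le>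
      8 * c\<^sup>2 \<and>
       ((\<lambda>s. a_coeff T s x) has_real_derivative a1 s x) (at s) \<and>
       ((\<lambda>s. a1 s x) has_real_derivative a2 s x) (at s)"
    using der b
  proof eventually_elim
    case (elim x)
    show ?case
    proof
      fix s assume s: "s \<in> I"
      have B: "\<bar>M s x $ i $ j\<bar> \<le> c" "\<bar>M1 s x $ i $ j\<bar> \<le> c" "\<bar>M2 s x $ i $ j\<bar> \<le> c" for i j
      proof -
        have "norm (M s x) \<le> c0" "norm (M1 s x) \<le> c1" "norm (M2 s x) \<le> c2" using elim s by blast+
        then show "\<bar>M s x $ i $ j\<bar> \<le> c" "\<bar>M1 s x $ i $ j\<bar> \<le> c" "\<bar>M2 s x $ i $ j\<bar> \<le> c"
          using vec_component2_bound[of "M s x" i j] vec_component2_bound[of "M1 s x" i j]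
              vec_component2_bound[of "M2 s x" i j]
          unfolding c_def by linarith+
      qed
      have P: "\<bar>p * q\<bar> \<le> c\<^sup>2" if "\<bar>p\<bar> \<le> c" "\<bar>q\<bar> \<le> c" for p q
        unfolding abs_mult power2_eq_square using that by (intro mult_mono) auto
      have c2: "0 \<le> c\<^sup>2" by simp
      have D: "((\<lambda>s. M s x $ i $ j) has_real_derivative M1 s x $ i $ j) (at s)"
        "((\<lambda>s. M1 s x $ i $ j) has_real_derivative M2 s x $ i $ j) (at s)" for i j
        using elim s vec_component2_derivative by blast+
      have "\<bar>a_coeff T s x\<bar> \<le> 8 * c\<^sup>2"
        unfolding a using P[OF B(1)[of 1 1] B(1)[of 2 2]] P[OF B(1)[of 1 2] B(1)[of 2 1]] c2
            by linarith
      moreover have "\<bar>a1 s x\<bar> \<le> 8 * c\<^sup>2"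
        unfolding a1_def using P[OF B(2)[of 1 1] B(1)[of 2 2]] P[OF B(1)[of 1 1] B(2)[of 2 2]]
          P[OF B(2)[of 1 2] B(1)[of 2 1]] P[OF B(1)[of 1 2] B(2)[of 2 1]] c2 by linarith
      moreover have "\<bar>a2 s x\<bar> \<le> 8 * c\<^sup>2"
        unfolding a2_def using P[OF B(3)[of 1 1] B(1)[of 2 2]] P[OF B(1)[of 1 1] B(3)[of 2 2]]
          P[OF B(3)[of 1 2] B(1)[of 2 1]] P[OF B(1)[of 1 2] B(3)[of 2 1]]
          P[OF B(2)[of 1 1] B(2)[of 2 2]] P[OF B(2)[of 1 2] B(2)[of 2 1]] c2 by linarith
      moreover have "((\<lambda>s. a_coeff T s x) has_real_derivative a1 s x) (at s)"
        unfolding a a1_def by (rule derivative_eq_intros D refl)+ (simp add: algebra_simps)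
      moreover have "((\<lambda>s. a1 s x) has_real_derivative a2 s x) (at s)"
        unfolding a1_def a2_def by (rule derivative_eq_intros D refl)+ (simp add: algebra_simps)
      ultimately show "\<bar>a_coeff T s x\<bar> \<le> 8 * c\<^sup>2 \<and> \<bar>a1 s x\<bar> \<le> 8 * c\<^sup>2 \<and> \<bar>a2 s x\<bar> \<le> 8 * c\<^sup>2 \<and>
       ((\<lambda>s. a_coeff T s x) has_real_derivative a1 s x) (at s) \<and>
       ((\<lambda>s. a1 s x) has_real_derivative a2 s x) (at s)" by blast
    qed
  qed
  moreover have "a_coeff T s \<in> borel_measurable (lebesgue_on \<Omega>)" if "s \<in> I" for s
    unfolding a[abs_def] using that by (intro borel_measurable_diff borel_measurable_times mc)
  moreover have "a1 s \<in> borel_measurable (lebesgue_on \<Omega>)" if "s \<in> I" for s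
    unfolding a1_def[abs_def] using that
        by (intro borel_measurable_diff borel_measurable_add borel_measurable_times mc)
  moreover have "a2 s \<in> borel_measurable (lebesgue_on \<Omega>)" if "s \<in> I" for s
    unfolding a2_def[abs_def] using that
        by (intro borel_measurable_diff borel_measurable_add borel_measurable_times
        borel_measurable_const mc)
  ultimately show ?thesis by (intro that[of "8 * c\<^sup>2" a1 a2]) simp_all
qed

lemma taylor_bounds:
  fixes f :: "real \<Rightarrow> real"
  assumes "convex I" "s \<in> I" "r \<in> I"
    and f: "\<And>t. t \<in> I \<Longrightarrow> (f has_real_derivative f1 t) (at t)"
    and f1: "\<And>t. t \<in> I \<Longrightarrow> (f1 has_real_derivative f2 t) (at t)"
    and f2: "\<And>t. t \<in> I \<Longrightarrow> \<bar>f2 t\<bar> \<le> C"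
  shows "\<bar>f1 r - f1 s\<bar> \<le> C * \<bar>r - s\<bar>" "\<bar>f r - f s - (r - s) * f1 s\<bar> \<le> C * (r - s)\<^sup>2"
proof -
  have lip: "\<bar>f1 q - f1 p\<bar> \<le> C * \<bar>q - p\<bar>" if "p \<in> I" "q \<in> I" for p q
    using field_differentiable_bound[OF assms(1), of f1 f2 C q p] f1 f2 that
    by (simp add: has_field_derivative_at_within)
  show "\<bar>f1 r - f1 s\<bar> \<le> C * \<bar>r - s\<bar>" by (rule lip[OF assms(2,3)])
  have C0: "0 \<le> C" using f2[OF assms(2)] by linarith
  have sub: "closed_segment s r \<subseteq> I" using assms(1-3) by (rule closed_segment_subset[rotated 2])
  have "norm ((f r - r * f1 s) - (f s - s * f1 s)) \<le> (C * \<bar>r - s\<bar>) * norm (r - s)"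
  proof (rule field_differentiable_bound[OF convex_closed_segment[of s r]])
    fix z assume z: "z \<in> closed_segment s r"
    then have zI: "z \<in> I" using sub by blast
    have "((\<lambda>z. f z - z * f1 s) has_real_derivative f1 z - f1 s) (at z)"
      by (rule derivative_eq_intros f[OF zI] refl)+ simp
    then show "((\<lambda>z. f z - z * f1 s) has_real_derivative f1 z -
        f1 s) (at z within closed_segment s r)"
      by (rule has_field_derivative_at_within)
    have "\<bar>z - s\<bar> \<le> \<bar>r - s\<bar>" using z by (auto simp: closed_segment_eq_real_ivl split: if_splits)
    then have "C * \<bar>z - s\<bar> \<le> C * \<bar>r - s\<bar>" using C0 by (rule mult_left_mono)
    then show "norm (f1 z - f1 s) \<le> C * \<bar>r - s\<bar>" using lip[OF assms(2) zI] by simp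
  qed auto
  then show "\<bar>f r - f s - (r - s) * f1 s\<bar> \<le> C * (r - s)\<^sup>2"
      by (simp add: power2_eq_square algebra_simps)
qed

text \<open>
  In dimension two the determinant of \<open>\<alpha> powr (- 1 / 2) *\<^sub>R DT\<close> is \<open>a / \<alpha>\<close>, so the normalisation
  to determinant \<open>1\<close> says \<open>a = \<alpha>\<close>.
\<close>

lemma conformal_coefficients:
  fixes \<Omega> :: "(real^2) set"
  assumes conf: "conformal_at \<Omega> T s"
  shows "AE x in lebesgue_on \<Omega>. a_coeff T s x > 0 \<and> Q_coeff T s x = (1 / a_coeff T s x) *\<^sub>R mat 1"
proof -
  obtain \<alpha> where \<alpha>: "AE x in lebesgue_on \<Omega>. \<alpha> x > 0 \<and> Q_coeff T s x = (1 / \<alpha> x) *\<^sub>R mat 1 \<and>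
        det ((\<alpha> x powr (- 1 / 2)) *\<^sub>R DT T s x) = 1" using conf unfolding conformal_at_def by blast
  have det: "a_coeff T s x = \<alpha> x" if "\<alpha> x > 0" "det ((\<alpha> x powr (- 1 / 2)) *\<^sub>R DT T s x) = 1" for x
  proof -
    have d: "((\<alpha> x powr (- 1 / 2)) * (\<alpha> x powr (- 1 / 2))) * det (DT T s x) = 1"
      using that(2) by (simp add: det_2 algebra_simps)
    have "(\<alpha> x powr (- 1 / 2)) * (\<alpha> x powr (- 1 / 2)) = 1 / \<alpha> x"
      using that(1) by (simp add: powr_add[symmetric] powr_minus_divide)
    from d[unfolded this] show ?thesis using that(1) by (simp add: a_coeff_def)
  qed
  show ?thesis using \<alpha> by eventually_elim (use det in auto)
qed

text \<open>
  Conformal invariance of the Dirichlet integral in the plane.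
\<close>

lemma conformal_A_form:
  fixes \<Omega> :: "(real^2) set"
  assumes conf: "conformal_at \<Omega> T s"
    and m: "a_coeff T s \<in> borel_measurable (lebesgue_on \<Omega>)"
        "DTinv T s \<in> borel_measurable (lebesgue_on \<Omega>)"
    and u: "u \<in> H1 \<Omega>" and v: "v \<in> H1 \<Omega>"
  shows "A_form \<Omega> T s u v = Dirichlet \<Omega> u v"
proof -
  have [measurable]: "a_coeff T s \<in> borel_measurable (lebesgue_on \<Omega>)" by fact
  have [measurable]: "(\<lambda>x. DTinv T s x $ i $ j) \<in> borel_measurable (lebesgue_on \<Omega>)" for i j
    by (rule vec_component2_measurable[OF m(2)])
  have gm: "(\<lambda>x. grad \<Omega> z x $ i) \<in> borel_measurable (lebesgue_on \<Omega>)" if "z \<in> H1 \<Omega>" for z i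
  proof -
    have "grad \<Omega> z \<in> borel_measurable (lebesgue_on \<Omega>)" using H1_L2(2)[OF that] by (simp add: L2_def)
    moreover have "(\<lambda>y :: real^2. y $ i) \<in> borel_measurable borel"
      by (intro borel_measurable_continuous_onI continuous_intros)
    ultimately show ?thesis by (rule measurable_compose)
  qed
  note [measurable] = gm[OF u] gm[OF v]
  show "A_form \<Omega> T s u v = Dirichlet \<Omega> u v"
    unfolding A_form_def Dirichlet_def L2_inner_def
  proof (rule integral_cong_AE)
    show "(\<lambda>x. (grad \<Omega> u x \<bullet> (Q_coeff T s x *v grad \<Omega> v x)) * a_coeff T s x) \<in> borel_measurable
        (lebesgue_on \<Omega>)"
      unfolding inner_vec_def matrix_vector_mult_def Q_coeff_def matrix_matrix_mult_def
          transpose_def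
      by simp
    show "(\<lambda>x. grad \<Omega> u x \<bullet> grad \<Omega> v x) \<in> borel_measurable (lebesgue_on \<Omega>)"
      unfolding inner_vec_def by simp
    show "AE x in lebesgue_on \<Omega>. (grad \<Omega> u x \<bullet> (Q_coeff T s x *v grad \<Omega> v x)) * a_coeff T s x =
        grad \<Omega> u x \<bullet> grad \<Omega> v x"
      using conformal_coefficients[OF conf]
    proof eventually_elim
      case (elim x)
      have "Q_coeff T s x *v grad \<Omega> v x = (1 / a_coeff T s x) *\<^sub>R grad \<Omega> v x"
        using elim by (simp add: scaleR_matrix_vector_assoc[symmetric])
      then show ?case using elim by simp
    qed
  qed
qed

section \<open>Weighted mass forms\<close>

definition weighted :: "(real^'n) set \<Rightarrow> (real^'n \<Rightarrow> real) \<Rightarrow> (real^'n \<Rightarrow> real) \<Rightarrow> (real^'n \<Rightarrow> real) \<Rightarrow>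
    real" where
  "weighted \<Omega> w u v = (LINT x|lebesgue_on \<Omega>. u x * v x * w x)"

lemma L2_abs: "u \<in> L2 \<Omega> \<Longrightarrow> (\<lambda>x. \<bar>u x :: real\<bar>) \<in> L2 \<Omega>"
  by (auto simp: L2_def)

lemma weighted_integrable:
  fixes u v w :: "real^'n \<Rightarrow> real"
  assumes u: "u \<in> L2 \<Omega>" and v: "v \<in> L2 \<Omega>" and w: "w \<in> borel_measurable (lebesgue_on \<Omega>)"
    and b: "AE x in lebesgue_on \<Omega>. \<bar>w x\<bar> \<le> C"
  shows "integrable (lebesgue_on \<Omega>) (\<lambda>x. u x * v x * w x)"
proof (rule Bochner_Integration.integrable_bound)
  show "integrable (lebesgue_on \<Omega>) (\<lambda>x. C * (\<bar>u x\<bar> * \<bar>v x\<bar>))"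
    using L2_integrable_inner[OF L2_abs[OF u] L2_abs[OF v]] by simp
  show "(\<lambda>x. u x * v x * w x) \<in> borel_measurable (lebesgue_on \<Omega>)" using u v w by (auto simp: L2_def)
  show "AE x in lebesgue_on \<Omega>. norm (u x * v x * w x) \<le> norm (C * (\<bar>u x\<bar> * \<bar>v x\<bar>))"
    using b
  proof eventually_elim
    case (elim x)
    then have "\<bar>w x\<bar> * (\<bar>u x\<bar> * \<bar>v x\<bar>) \<le> C * (\<bar>u x\<bar> * \<bar>v x\<bar>)" by (intro mult_right_mono) auto
    moreover have "\<bar>C\<bar> = C" using elim by simp
    ultimately show ?case by (simp add: abs_mult mult_ac)
  qed
qed

lemma weighted_bound:
  fixes u v w :: "real^'n \<Rightarrow> real"
  assumes u: "u \<in> L2 \<Omega>" and v: "v \<in> L2 \<Omega>" and w: "w \<in> borel_measurable (lebesgue_on \<Omega>)"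
    and b: "AE x in lebesgue_on \<Omega>. \<bar>w x\<bar> \<le> C" and C: "0 \<le> C"
  shows "\<bar>weighted \<Omega> w u v\<bar> \<le> C * (sqrt (L2_inner \<Omega> u u) * sqrt (L2_inner \<Omega> v v))"
proof -
  note au = L2_abs[OF u] and av = L2_abs[OF v]
  have "\<bar>weighted \<Omega> w u v\<bar> \<le> (LINT x|lebesgue_on \<Omega>. norm (u x * v x * w x))"
    unfolding weighted_def using integral_norm_bound[of "lebesgue_on \<Omega>" "\<lambda>x. u x * v x * w x"]
        by simp
  also have "\<dots> \<le> (LINT x|lebesgue_on \<Omega>. C * (\<bar>u x\<bar> * \<bar>v x\<bar>))"
  proof (rule integral_mono_AE)
    show "integrable (lebesgue_on \<Omega>) (\<lambda>x. norm (u x * v x * w x))"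
        using weighted_integrable[OF u v w b] by (rule integrable_norm)
    show "integrable (lebesgue_on \<Omega>) (\<lambda>x. C * (\<bar>u x\<bar> * \<bar>v x\<bar>))" using L2_integrable_inner[OF au av]
        by simp
    show "AE x in lebesgue_on \<Omega>. norm (u x * v x * w x) \<le> C * (\<bar>u x\<bar> * \<bar>v x\<bar>)"
      using b
    proof eventually_elim
      case (elim x)
      then have "\<bar>w x\<bar> * (\<bar>u x\<bar> * \<bar>v x\<bar>) \<le> C * (\<bar>u x\<bar> * \<bar>v x\<bar>)" by (intro mult_right_mono) auto
      then show ?case by (simp add: abs_mult mult_ac)
    qed
  qed
  also have "\<dots> = C * L2_inner \<Omega> (\<lambda>x. \<bar>u x\<bar>) (\<lambda>x. \<bar>v x\<bar>)" by (simp add: L2_inner_def)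
  also have "\<dots> \<le> C * (sqrt (L2_inner \<Omega> u u) * sqrt (L2_inner \<Omega> v v))"
  proof (rule mult_left_mono[OF _ C])
    interpret function_space "L2 \<Omega> :: (real^'n \<Rightarrow> real) set" by (rule L2_function_space)
    have "(L2_inner \<Omega> (\<lambda>x. \<bar>u x\<bar>) (\<lambda>x. \<bar>v x\<bar>))\<^sup>2 \<le> L2_inner \<Omega> u u * L2_inner \<Omega> v v"
      using Cauchy_Schwarz_form[OF L2_inner_sym_form _ au av] L2_inner_nonneg
          by (simp add: L2_inner_self)
    then show "L2_inner \<Omega> (\<lambda>x. \<bar>u x\<bar>) (\<lambda>x. \<bar>v x\<bar>) \<le> sqrt (L2_inner \<Omega> u u) * sqrt (L2_inner \<Omega> v v)"
      unfolding real_sqrt_mult[symmetric] by (rule real_le_rsqrt)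
  qed
  finally show ?thesis .
qed

lemma weighted_sym_form:
  fixes w :: "real^'n \<Rightarrow> real"
  assumes w: "w \<in> borel_measurable (lebesgue_on \<Omega>)" "AE x in lebesgue_on \<Omega>. \<bar>w x\<bar> \<le> C"
  shows "sym_form (L2 \<Omega>) (weighted \<Omega> w)"
  unfolding sym_form_def
proof (intro conjI ballI allI)
  fix u v z :: "real^'n \<Rightarrow> real" and a b assume L: "u \<in> L2 \<Omega>" "v \<in> L2 \<Omega>" "z \<in> L2 \<Omega>"
  have "weighted \<Omega> w (lincomb a u b v) z = (LINT x|lebesgue_on \<Omega>. a * (u x * z x * w x) +
      b * (v x * z x * w x))"
    by (simp add: weighted_def lincomb_def algebra_simps)
  also have "\<dots> = a * weighted \<Omega> w u z + b * weighted \<Omega> w v z"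
    using weighted_integrable[OF L(1,3) w] weighted_integrable[OF L(2,3) w]
        by (simp add: weighted_def)
  finally show "weighted \<Omega> w (lincomb a u b v) z = a * weighted \<Omega> w u z + b * weighted \<Omega> w v z" .
qed (simp add: weighted_def mult.commute)

text \<open>
  Dominated convergence: by the mean value theorem the difference quotients of the weight are
  bounded by \<open>C\<close>.
\<close>

lemma weighted_has_derivative:
  fixes a1 a2 :: "real \<Rightarrow> real^'n \<Rightarrow> real"
  assumes I: "open I" "convex I" "t \<in> I" and u: "u \<in> L2 \<Omega>"
    and AE: "AE x in lebesgue_on \<Omega>. \<forall>s\<in>I. \<bar>a1 s x\<bar> \<le> C \<and> \<bar>a2 s x\<bar> \<le> C \<and>
        ((\<lambda>s. a1 s x) has_real_derivative a2 s x) (at s)"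
    and m: "\<And>s. s \<in> I \<Longrightarrow> a1 s \<in> borel_measurable (lebesgue_on \<Omega>)"
        "a2 t \<in> borel_measurable (lebesgue_on \<Omega>)"
  shows "((\<lambda>r. weighted \<Omega> (a1 r) u u) has_real_derivative weighted \<Omega> (a2 t) u u) (at t)"
proof -
  have b1: "AE x in lebesgue_on \<Omega>. \<bar>a1 s x\<bar> \<le> C" if "s \<in> I" for s using AE that
      by (auto elim: eventually_mono)
  have i1: "integrable (lebesgue_on \<Omega>) (\<lambda>x. u x * u x * a1 s x)" if "s \<in> I" for s
    using weighted_integrable[OF u u m(1)[OF that] b1[OF that]] .
  have "((\<lambda>r. (weighted \<Omega> (a1 r) u u - weighted \<Omega> (a1 t) u u) / (r -
      t)) \<longlongrightarrow> weighted \<Omega> (a2 t) u u) (at t within I)"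
    unfolding tendsto_at_iff_sequentially
  proof (intro allI impI)
    fix X :: "nat \<Rightarrow> real" assume X: "\<forall>i. X i \<in> I - {t}" "X \<longlonglongrightarrow> t"
    have XI: "X i \<in> I" "X i \<noteq> t" for i using X(1) by auto
    define q where "q i x = u x * u x * ((a1 (X i) x - a1 t x) / (X i - t))" for i x
    have "(\<lambda>i. LINT x|lebesgue_on \<Omega>. q i x) \<longlonglongrightarrow> (LINT x|lebesgue_on \<Omega>. u x * u x * a2 t x)"
    proof (rule integral_dominated_convergence)
      have mu: "u \<in> borel_measurable (lebesgue_on \<Omega>)" using u by (simp add: L2_def)
      show "(\<lambda>x. u x * u x * a2 t x) \<in> borel_measurable (lebesgue_on \<Omega>)" using mu m(2) by simp
      show "q i \<in> borel_measurable (lebesgue_on \<Omega>)" for i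
        unfolding q_def[abs_def] using mu m(1)[OF XI(1)] m(1)[OF I(3)] by simp
      show "integrable (lebesgue_on \<Omega>) (\<lambda>x. C * (u x * u x))" using L2_integrable_inner[OF u u]
          by simp
      show "AE x in lebesgue_on \<Omega>. (\<lambda>i. q i x) \<longlonglongrightarrow> u x * u x * a2 t x"
        using AE
      proof eventually_elim
        case (elim x)
        then have "((\<lambda>r. (a1 r x - a1 t x) / (r - t)) \<longlongrightarrow> a2 t x) (at t)" using I(3)
            by (simp add: has_field_derivative_iff)
        moreover have "filterlim X (at t) sequentially" using X(2) XI(2) by (simp add: filterlim_at)
        ultimately have "(\<lambda>i. (a1 (X i) x - a1 t x) / (X i - t)) \<longlonglongrightarrow> a2 t x"
            by (rule filterlim_compose)
        then show ?case unfolding q_def by (intro tendsto_mult tendsto_const)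
      qed
      show "AE x in lebesgue_on \<Omega>. norm (q i x) \<le> C * (u x * u x)" for i
        using AE
      proof eventually_elim
        case (elim x)
        have "\<bar>a1 (X i) x - a1 t x\<bar> \<le> C * \<bar>X i - t\<bar>"
          using field_differentiable_bound[OF I(2), of "\<lambda>s. a1 s x" "\<lambda>s. a2 s x" C "X i" t] elim
              XI(1) I(3)
          by (simp add: has_field_derivative_at_within)
        then have "\<bar>(a1 (X i) x - a1 t x) / (X i - t)\<bar> \<le> C" using XI(2)[of i]
            by (simp add: abs_divide divide_le_eq)
        then have "(u x * u x) * \<bar>(a1 (X i) x - a1 t x) / (X i - t)\<bar> \<le> (u x * u x) * C"
            by (intro mult_left_mono) auto
        then show ?case by (simp add: q_def abs_mult mult_ac)
      qed
    qed
    moreover have "(LINT x|lebesgue_on \<Omega>. q i x) = (weighted \<Omega> (a1 (X i)) u u -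
        weighted \<Omega> (a1 t) u u) / (X i - t)" for i
    proof -
      have "q i x = (u x * u x * a1 (X i) x - u x * u x * a1 t x) / (X i - t)" for x
        by (simp add: q_def right_diff_distrib)
      then have "(LINT x|lebesgue_on \<Omega>. q i x) = (LINT x|lebesgue_on \<Omega>. (u x * u x * a1 (X i) x -
          u x * u x * a1 t x) / (X i - t))" by simp
      also have "\<dots> = (LINT x|lebesgue_on \<Omega>. u x * u x * a1 (X i) x - u x * u x * a1 t x) / (X i -
          t)" by (rule integral_divide_zero)
      also have "(LINT x|lebesgue_on \<Omega>. u x * u x * a1 (X i) x - u x * u x * a1 t x) =
          weighted \<Omega> (a1 (X i)) u u - weighted \<Omega> (a1 t) u u"
        unfolding weighted_def by (rule Bochner_Integration.integral_diff[OF i1[OF XI(1)] i1[OF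
            I(3)]])
      finally show ?thesis .
    qed
    ultimately show "((\<lambda>r. (weighted \<Omega> (a1 r) u u - weighted \<Omega> (a1 t) u u) / (r - t)) \<circ> X) \<longlonglongrightarrow>
        weighted \<Omega> (a2 t) u u"
      by (simp add: o_def weighted_def)
  qed
  then show ?thesis using at_within_open[OF I(3,1)] by (simp add: has_field_derivative_iff)
qed

locale coercive_domain = bounded_open_set \<Omega> for \<Omega> :: "(real^'n) set" +
  fixes \<gamma> :: "(real^'n) set" and \<delta> :: real
  assumes lip: "lipschitz_domain \<Omega>" and \<gamma>_borel: "\<gamma> \<in> sets borel" and \<delta>: "\<delta> > 0"
    and coercive: "u \<in> V_space \<Omega> \<gamma> \<Longrightarrow> \<delta> * H1_inner \<Omega> u u \<le> Dirichlet \<Omega> u u"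
begin

lemma V_H1: "u \<in> V_space \<Omega> \<gamma> \<Longrightarrow> u \<in> H1 \<Omega>" "u \<in> V_space \<Omega> \<gamma> \<Longrightarrow> u \<in> L2 \<Omega>"
  using H1_L2(1) by (auto simp: V_space_iff)

lemma H1_le_Dirichlet: "u \<in> V_space \<Omega> \<gamma> \<Longrightarrow> H1_inner \<Omega> u u \<le> Dirichlet \<Omega> u u / \<delta>"
  using coercive[of u] \<delta> by (simp add: le_divide_eq mult.commute)

lemma V_energy_space: "energy_space (V_space \<Omega> \<gamma>) (Dirichlet \<Omega>)"
proof
  show "lincomb a u b v \<in> V_space \<Omega> \<gamma>" if "u \<in> V_space \<Omega> \<gamma>" "v \<in> V_space \<Omega> \<gamma>" for u v a b
    using V_lincomb[OF \<gamma>_borel that] .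
  show "sym_form (V_space \<Omega> \<gamma>) (Dirichlet \<Omega>)"
    by (rule sym_form_subset[OF Dirichlet_sym_form[OF bdd op]]) (auto simp: V_H1)
  show "0 \<le> Dirichlet \<Omega> u u" for u by (simp add: Dirichlet_def L2_inner_nonneg)
qed

end

sublocale coercive_domain \<subseteq> V: energy_space "V_space \<Omega> \<gamma>" "Dirichlet \<Omega>"
  by (rule V_energy_space)

context coercive_domain
begin

lemma weighted_le:
  assumes u: "u \<in> V_space \<Omega> \<gamma>" and v: "v \<in> V_space \<Omega> \<gamma>"
      and w: "w \<in> borel_measurable (lebesgue_on \<Omega>)"
    and b: "AE x in lebesgue_on \<Omega>. \<bar>w x\<bar> \<le> C" and C: "0 \<le> C"
  shows "\<bar>weighted \<Omega> w u v\<bar> \<le> C / \<delta> * V.enorm u * V.enorm v"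
proof -
  have s: "sqrt (L2_inner \<Omega> z z) \<le> V.enorm z / sqrt \<delta>" if "z \<in> V_space \<Omega> \<gamma>" for z
  proof -
    have "L2_inner \<Omega> z z \<le> Dirichlet \<Omega> z z / \<delta>" using L2_le_H1[of z] H1_le_Dirichlet[OF that]
        by linarith
    then have "sqrt (L2_inner \<Omega> z z) \<le> sqrt (Dirichlet \<Omega> z z / \<delta>)" by (rule real_sqrt_le_mono)
    then show ?thesis by (simp add: V.enorm_def real_sqrt_divide)
  qed
  have "\<bar>weighted \<Omega> w u v\<bar> \<le> C * (sqrt (L2_inner \<Omega> u u) * sqrt (L2_inner \<Omega> v v))"
    by (rule weighted_bound[OF V_H1(2)[OF u] V_H1(2)[OF v] w b C])
  also have "\<dots> \<le> C * (V.enorm u / sqrt \<delta> * (V.enorm v / sqrt \<delta>))"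
    using C u v \<delta> by (intro mult_left_mono mult_mono s) (auto simp: L2_inner_nonneg)
  also have "\<dots> = C / \<delta> * V.enorm u * V.enorm v" using \<delta> by (simp add: field_simps)
  finally show ?thesis .
qed

text \<open>
  By coercivity the Dirichlet norm is equivalent to the \<open>H\<^sup>1\<close> norm. Completeness is then that of a
  closed subspace of \<open>H\<^sup>1\<close>, and compactness is Rellich's theorem, as \<open>weighted \<Omega> w\<close> is bounded on
  \<open>L\<^sup>2\<close>.
\<close>

lemma weighted_compact_form:
  assumes w: "w \<in> borel_measurable (lebesgue_on \<Omega>)" and b: "AE x in lebesgue_on \<Omega>. \<bar>w x\<bar> \<le> C"
      and C: "0 \<le> C"
    and pos: "AE x in lebesgue_on \<Omega>. 0 < w x"
  shows "compact_form (V_space \<Omega> \<gamma>) (Dirichlet \<Omega>) (weighted \<Omega> w) (C / \<delta>)"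
proof
  show "sym_form (V_space \<Omega> \<gamma>) (weighted \<Omega> w)"
    by (rule sym_form_subset[OF weighted_sym_form[OF w b]]) (auto simp: V_H1)
  show nn: "0 \<le> weighted \<Omega> w u u" for u
    unfolding weighted_def by (rule integral_nonneg_AE) (use pos in \<open>auto elim: eventually_mono\<close>)
  show "weighted \<Omega> w u u \<le> C / \<delta> * Dirichlet \<Omega> u u" if u: "u \<in> V_space \<Omega> \<gamma>" for u
    using weighted_le[OF u u w b C] V.enorm_square[OF u] by (simp add: power2_eq_square mult.assoc)
  show "\<exists>v\<in>V_space \<Omega> \<gamma>. form_converges (Dirichlet \<Omega>) x v"
    if x: "\<And>n. x n \<in> V_space \<Omega> \<gamma>" and Cauchy: "form_Cauchy (Dirichlet \<Omega>) x" for x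
  proof -
    have "form_Cauchy (H1_inner \<Omega>) x"
      unfolding form_Cauchy_def
    proof (intro allI impI)
      fix \<epsilon> :: real assume "\<epsilon> > 0"
      then have "\<delta> * \<epsilon> > 0" using \<delta> by simp
      then obtain N where N: "\<And>m n. m \<ge> N \<Longrightarrow> n \<ge> N \<Longrightarrow> sqdist (Dirichlet \<Omega>) (x m) (x n) < \<delta> * \<epsilon>"
        using Cauchy unfolding form_Cauchy_def by blast
      have "sqdist (H1_inner \<Omega>) (x m) (x n) < \<epsilon>" if "m \<ge> N" "n \<ge> N" for m n
      proof -
        have "\<delta> * sqdist (H1_inner \<Omega>) (x m) (x n) < \<delta> * \<epsilon>"
          using N[OF that] coercive[of "fdiff (x m) (x n)"] V.lincomb_in[OF x x] by fastforce
        then show ?thesis using \<delta> by simp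
      qed
      then show "\<exists>N. \<forall>m\<ge>N. \<forall>n\<ge>N. sqdist (H1_inner \<Omega>) (x m) (x n) < \<epsilon>" by blast
    qed
    then obtain v where v: "v \<in> H1 \<Omega>" "form_converges (H1_inner \<Omega>) x v"
      using H1_complete[of x] x V_H1(1) by blast
    have "v \<in> V_space \<Omega> \<gamma>" using V_closed[OF x v] .
    moreover have "form_converges (Dirichlet \<Omega>) x v" unfolding form_converges_def
      by (rule Lim_null_comparison[OF _ v(2)[unfolded form_converges_def]])
        (use Dirichlet_le_H1 in \<open>simp add: Dirichlet_def L2_inner_nonneg\<close>)
    ultimately show ?thesis by blast
  qed
  show "\<exists>r. strict_mono (r :: nat \<Rightarrow> nat) \<and> form_Cauchy (weighted \<Omega> w) (x \<circ> r)"
    if x: "\<And>n. x n \<in> V_space \<Omega> \<gamma>" and bd: "\<And>n. Dirichlet \<Omega> (x n) (x n) \<le> 1" for x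
  proof -
    have "H1_inner \<Omega> (x n) (x n) \<le> 1 / \<delta>" for n
      using order.trans[OF H1_le_Dirichlet[OF x[of n]] divide_right_mono[OF bd[of n]]] \<delta> by simp
    from Rellich[where x = x, OF lip \<gamma>_borel x this] obtain r
      where r: "strict_mono (r :: nat \<Rightarrow> nat)" "form_Cauchy (L2_inner \<Omega>) (x \<circ> r)" by blast
    have le: "weighted \<Omega> w u u \<le> (C + 1) * L2_inner \<Omega> u u" if "u \<in> V_space \<Omega> \<gamma>" for u
    proof -
      have "weighted \<Omega> w u u \<le> C * (sqrt (L2_inner \<Omega> u u) * sqrt (L2_inner \<Omega> u u))"
        using weighted_bound[OF V_H1(2)[OF that] V_H1(2)[OF that] w b C] by linarith
      also have "\<dots> \<le> (C + 1) * L2_inner \<Omega> u u" by (simp add: L2_inner_nonneg distrib_right)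
      finally show ?thesis .
    qed
    have "form_Cauchy (weighted \<Omega> w) (x \<circ> r)"
      unfolding form_Cauchy_def
    proof (intro allI impI)
      fix \<epsilon> :: real assume "\<epsilon> > 0"
      then have "\<epsilon> / (C + 1) > 0" using C by simp
      then obtain N where N: "\<And>m n. m \<ge> N \<Longrightarrow> n \<ge> N \<Longrightarrow> sqdist (L2_inner \<Omega>) ((x \<circ> r) m) ((x \<circ> r) n) <
          \<epsilon> / (C + 1)"
        using r(2) unfolding form_Cauchy_def by blast
      have "sqdist (weighted \<Omega> w) ((x \<circ> r) m) ((x \<circ> r) n) < \<epsilon>" if "m \<ge> N" "n \<ge> N" for m n
      proof -
        have "sqdist (weighted \<Omega> w) ((x \<circ> r) m) ((x \<circ> r) n) \<le>
            (C + 1) * sqdist (L2_inner \<Omega>) ((x \<circ> r) m) ((x \<circ> r) n)"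
          by (rule le) (simp add: x)
        also have "\<dots> < (C + 1) * (\<epsilon> / (C + 1))" using N[OF that] C
            by (intro mult_strict_left_mono) auto
        also have "\<dots> = \<epsilon>" using C by simp
        finally show ?thesis .
      qed
      then show "\<exists>N. \<forall>m\<ge>N. \<forall>n\<ge>N. sqdist (weighted \<Omega> w) ((x \<circ> r) m) ((x \<circ> r) n) < \<epsilon>" by blast
    qed
    then show ?thesis using r(1) by blast
  qed
qed

end

section \<open>The first eigenvalue\<close>

abbreviation principal_eigenfunction ::
    "(real^'n) set \<Rightarrow> (real^'n) set \<Rightarrow> (real \<Rightarrow> real^'n \<Rightarrow> real^'n) \<Rightarrow> real \<Rightarrow> (real^'n \<Rightarrow> real) \<Rightarrow> bool"
        where
  "principal_eigenfunction \<Omega> \<gamma> T s e \<equiv> (e \<in> V_space \<Omega> \<gamma> \<and> Dirichlet \<Omega> e e = 1 \<and>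
      (\<forall>v\<in>V_space \<Omega> \<gamma>. B_form \<Omega> T s e v = 1 / eigenval \<Omega> \<gamma> T 1 s * Dirichlet \<Omega> e v) \<and>
      (\<forall>v\<in>V_space \<Omega> \<gamma>. B_form \<Omega> T s v v \<le> 1 / eigenval \<Omega> \<gamma> T 1 s * Dirichlet \<Omega> v v) \<and>
      (\<exists>g>0. \<forall>v\<in>V_space \<Omega> \<gamma>. Dirichlet \<Omega> e v = 0 \<longrightarrow> B_form \<Omega> T s v v \<le> (1 / eigenval \<Omega> \<gamma> T 1 s - g) *
          Dirichlet \<Omega> v v))"

lemma AE_dim_ge:
  assumes "\<And>i. i < k \<Longrightarrow> u i \<in> E"
    and "\<And>c :: nat \<Rightarrow> real. AE x in lebesgue_on \<Omega>. (\<Sum>i<k. c i * u i x) = 0 \<Longrightarrow> \<forall>i<k. c i = 0"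
  shows "enat k \<le> AE_dim \<Omega> E"
  unfolding AE_dim_def by (rule Sup_upper) (use assms in blast)

lemma B_form_null:
  assumes "AE x in lebesgue_on \<Omega>. u x = 0"
  shows "B_form \<Omega> T s u v = 0"
  unfolding B_form_def by (rule integral_eq_zero_AE) (use assms in \<open>auto elim: eventually_mono\<close>)

text \<open>
  Without an eigenvalue the conditions that define the first and the second one are both
  unsatisfiable, and the two least numbers coincide. So some \<open>u\<close> has positive mass, and the
  maximum \<open>M\<close> of \<open>B\<close> relative to \<open>A\<close> is attained. Its inverse is the least eigenvalue, because an
  eigenfunction for \<open>\<nu>\<close> with \<open>B u u = 1\<close> has \<open>A u u = \<nu>\<close>. A second eigenvector for \<open>M\<close> would give
  the eigenspace dimension two and make the second eigenvalue equal to the first.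
\<close>

lemma simple_principal_eigenvalue:
  fixes \<Omega> :: "(real^'n) set"
  assumes cf: "compact_form (V_space \<Omega> \<gamma>) A (B_form \<Omega> T s) C"
    and Aeq: "\<And>u v. u \<in> V_space \<Omega> \<gamma> \<Longrightarrow> v \<in> V_space \<Omega> \<gamma> \<Longrightarrow> A_form \<Omega> T s u v = A u v"
    and lt: "eigenval \<Omega> \<gamma> T 1 s < eigenval \<Omega> \<gamma> T 2 s"
  obtains e where "e \<in> V_space \<Omega> \<gamma>" "A e e = 1"
    "\<And>v. v \<in> V_space \<Omega> \<gamma> \<Longrightarrow> B_form \<Omega> T s e v = 1 / eigenval \<Omega> \<gamma> T 1 s * A e v"
    "\<And>v. v \<in> V_space \<Omega> \<gamma> \<Longrightarrow> B_form \<Omega> T s v v \<le> 1 / eigenval \<Omega> \<gamma> T 1 s * A v v"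
    "\<exists>g>0. \<forall>v\<in>V_space \<Omega> \<gamma>. A e v = 0 \<longrightarrow> B_form \<Omega> T s v v \<le> (1 / eigenval \<Omega> \<gamma> T 1 s - g) * A v v"
proof -
  define S where "S = V_space \<Omega> \<gamma>"
  define B where "B = B_form \<Omega> T s"
  define ES where "ES = eigenspace \<Omega> \<gamma> T s"
  define P where "P j \<mu> \<longleftrightarrow> (\<exists>F. finite F \<and> F \<subseteq> {\<nu>. is_eigenvalue \<Omega> \<gamma> T s \<nu> \<and> \<nu> \<le> \<mu>} \<and>
        enat j \<le> (\<Sum>\<nu>\<in>F. AE_dim \<Omega> (ES \<nu>)))" for j \<mu>
  have ev: "eigenval \<Omega> \<gamma> T j s = (LEAST \<mu>. P j \<mu>)" for j
    by (simp add: eigenval_def P_def ES_def)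
  interpret compact_form S A B C using cf by (simp add: S_def B_def)
  have ESiff: "u \<in> ES \<nu> \<longleftrightarrow> u \<in> S \<and> (\<forall>v\<in>S. A u v = \<nu> * B u v)" for u \<nu>
    by (auto simp: ES_def eigenspace_def S_def B_def Aeq)
  have isev: "is_eigenvalue \<Omega> \<gamma> T s \<nu> \<longleftrightarrow> (\<exists>u\<in>ES \<nu>. B u u = 1)" for \<nu>
    by (simp add: is_eigenvalue_def ES_def B_def)
  have dim1: "enat 1 \<le> AE_dim \<Omega> (ES \<nu>)" if ev\<nu>: "is_eigenvalue \<Omega> \<gamma> T s \<nu>" for \<nu>
  proof -
    obtain u where u: "u \<in> ES \<nu>" "B u u = 1" using ev\<nu> unfolding isev by blast
    show ?thesis
    proof (rule AE_dim_ge[where u = "\<lambda>i. u"])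
      fix c :: "nat \<Rightarrow> real" assume "AE x in lebesgue_on \<Omega>. (\<Sum>i<1. c i * u x) = 0"
      then have z: "AE x in lebesgue_on \<Omega>. c 0 * u x = 0" by simp
      have "c 0 = 0"
      proof (rule ccontr)
        assume "c 0 \<noteq> 0"
        then have "AE x in lebesgue_on \<Omega>. u x = 0" using z by simp
        then have "B u u = 0" unfolding B_def by (rule B_form_null)
        then show False using u by simp
      qed
      then show "\<forall>i<1. c i = 0" by simp
    qed (use u in simp)
  qed
  have "\<exists>u\<in>S. B u u > 0"
  proof (rule ccontr)
    assume "\<not> ?thesis"
    then have "\<not> is_eigenvalue \<Omega> \<gamma> T s \<nu>" for \<nu> by (force simp: isev ESiff)
    then have "P j \<mu> \<longleftrightarrow> enat j \<le> 0" for j \<mu> unfolding P_def by auto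
    then have "P 1 = P 2" by (intro ext) (simp add: enat_0_iff zero_enat_def)
    then show False using lt by (simp add: ev)
  qed
  then obtain u0 where u0: "u0 \<in> S" "B u0 u0 > 0" by blast
  obtain M v where M: "M > 0" and v: "v \<in> S" "A v v = 1" and eig: "\<And>w. w \<in> S \<Longrightarrow> B v w = M * A v w"
    and top: "\<And>w. w \<in> S \<Longrightarrow> B w w \<le> M * A w w"
    by (rule top_eigenvalue[OF u0]) (rule that)
  have vES: "w \<in> ES (1 / M)" if "w \<in> S" "\<And>z. z \<in> S \<Longrightarrow> B w z = M * A w z" for w
    unfolding ESiff using that M by simp
  have Mev: "is_eigenvalue \<Omega> \<gamma> T s (1 / M)"
  proof -
    define e where "e = lincomb (1 / sqrt M) v 0 v"
    have e: "e \<in> S" using v by (simp add: e_def)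
    have "B e z = M * A e z" if "z \<in> S" for z
      using that v eig by (simp add: e_def sym_form_left[OF A_form] sym_form_left[OF B_form])
    moreover have "B e e = 1" using v eig[OF v(1)] M
      by (simp add: e_def sym_form_square[OF B_form] power_divide)
    ultimately show ?thesis unfolding isev using vES[OF e] by blast
  qed
  have low: "1 / M \<le> \<nu>" if ev\<nu>: "is_eigenvalue \<Omega> \<gamma> T s \<nu>" for \<nu>
  proof -
    obtain u where u: "u \<in> S" "A u u = \<nu> * B u u" "B u u = 1" using ev\<nu> unfolding isev
        by (auto simp: ESiff)
    then show ?thesis using top[of u] M by (simp add: divide_le_eq mult.commute)
  qed
  have P1low: "1 / M \<le> \<mu>" if P: "P j \<mu>" "j \<ge> 1" for j \<mu>
  proof -
    obtain F where F: "F \<subseteq> {\<nu>. is_eigenvalue \<Omega> \<gamma> T s \<nu> \<and> \<nu> \<le> \<mu>}" "enat j \<le> (\<Sum>\<nu>\<in>F. AE_dim \<Omega> (ES \<nu>))"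
      using P(1) unfolding P_def by blast
    have "F \<noteq> {}"
    proof
      assume "F = {}"
      then have "enat j \<le> 0" using F(2) by simp
      then show False using P(2) by (simp add: zero_enat_def)
    qed
    then obtain \<nu> where "is_eigenvalue \<Omega> \<gamma> T s \<nu>" "\<nu> \<le> \<mu>" using F(1) by blast
    then show ?thesis using low by fastforce
  qed
  have Pj: "P j (1 / M)" if "enat j \<le> AE_dim \<Omega> (ES (1 / M))" for j
    unfolding P_def using that Mev by (intro exI[of _ "{1 / M}"]) simp
  have l1: "eigenval \<Omega> \<gamma> T 1 s = 1 / M"
    unfolding ev by (rule Least_equality) (use Pj[OF dim1[OF Mev]] P1low in auto)
  have "\<not> (\<exists>w\<in>S. A w w = 1 \<and> A v w = 0 \<and> (\<forall>z\<in>S. B w z = M * A w z))"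
  proof
    assume "\<exists>w\<in>S. A w w = 1 \<and> A v w = 0 \<and> (\<forall>z\<in>S. B w z = M * A w z)"
    then obtain w where w: "w \<in> S" "A w w = 1" "A v w = 0" "\<And>z. z \<in> S \<Longrightarrow> B w z = M * A w z" by blast
    have "enat 2 \<le> AE_dim \<Omega> (ES (1 / M))"
    proof (rule AE_dim_ge[where u = "\<lambda>i. if i = 0 then v else w"])
      show "(if i = 0 then v else w) \<in> ES (1 / M)" for i :: nat using vES v eig w by auto
      fix c :: "nat \<Rightarrow> real"
      assume "AE x in lebesgue_on \<Omega>. (\<Sum>i<2. c i * (if i = 0 then v else w) x) = 0"
      then have z: "AE x in lebesgue_on \<Omega>. lincomb (c 0) v (c 1) w x = 0"
        by (simp add: lincomb_def numeral_2_eq_2)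
      have B0: "B (lincomb (c 0) v (c 1) w) y = 0" for y unfolding B_def by (rule B_form_null[OF z])
      have "A w v = 0" using w(3) sym_form_commute[OF A_form w(1) v(1)] by simp
      then have "c 0 * M = 0" using B0[of v] v w eig[OF v(1)] w(4)[OF v(1)]
          by (simp add: sym_form_left[OF B_form])
      moreover have "c 1 * M = 0" using B0[of w] v w eig[OF w(1)] w(4)[OF w(1)]
          by (simp add: sym_form_left[OF B_form])
      ultimately have "c 0 = 0" "c 1 = 0" using M by auto
      then show "\<forall>i<2. c i = 0" by (auto simp: less_2_cases_iff)
    qed
    then have "eigenval \<Omega> \<gamma> T 2 s = 1 / M"
      unfolding ev by (intro Least_equality Pj P1low) auto
    then show False using lt l1 by simp
  qed
  then have gap: "\<exists>g>0. \<forall>w\<in>S. A v w = 0 \<longrightarrow> B w w \<le> (M - g) * A w w"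
    using simple_or_second_eigenvector[OF M top v(1)] by blast
  have M1: "1 / eigenval \<Omega> \<gamma> T 1 s = M" using l1 M by simp
  show ?thesis
    by (rule that[folded S_def B_def, unfolded M1, OF v eig top gap])
qed

theorem theorem7:
  fixes \<Omega> \<gamma>0 \<gamma>1 :: "(real^2) set"
    and T :: "real \<Rightarrow> real^2 \<Rightarrow> real^2"
    and \<epsilon>0 t :: real
    and I :: "real set"
  assumes "\<epsilon>0 > 0" and "I = {-\<epsilon>0<..<\<epsilon>0}"
    and "lipschitz_domain \<Omega>" and "boundary_partition \<Omega> \<gamma>0 \<gamma>1"
    and "C2_bilipschitz_family I \<Omega> T"
    and "coercive_family I \<Omega> \<gamma>0 T"
    and "\<And>s. s \<in> I \<Longrightarrow> eigenval \<Omega> \<gamma>0 T 1 s < eigenval \<Omega> \<gamma>0 T 2 s"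
    and "\<And>s. s \<in> I \<Longrightarrow> conformal_at \<Omega> T s"
    and "t \<in> I"
    and "AE x in lebesgue_on \<Omega>. (deriv ^^ 2) (\<lambda>s. a_coeff T s x) t \<ge> 0"
  shows "(\<forall>s\<in>I. (\<lambda>r. 1 / eigenval \<Omega> \<gamma>0 T 1 r) field_differentiable (at s)) \<and>
         deriv (\<lambda>r. 1 / eigenval \<Omega> \<gamma>0 T 1 r) field_differentiable (at t) \<and>
         (deriv ^^ 2) (\<lambda>r. 1 / eigenval \<Omega> \<gamma>0 T 1 r) t \<ge> 0"
proof -
  have I: "open I" "convex I" "t \<in> I" using assms(2,9) by auto
  have op: "open \<Omega>" and bd: "bounded \<Omega>" using assms(3) by (auto simp: lipschitz_domain_def)
  obtain a1 a2 C where C: "0 \<le> C"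
    and aAE: "AE x in lebesgue_on \<Omega>. \<forall>s\<in>I. \<bar>a_coeff T s x\<bar> \<le> C \<and> \<bar>a1 s x\<bar> \<le> C \<and> \<bar>a2 s x\<bar> \<le> C \<and>
       ((\<lambda>s. a_coeff T s x) has_real_derivative a1 s x) (at s) \<and>
       ((\<lambda>s. a1 s x) has_real_derivative a2 s x) (at s)"
    and am: "\<And>s. s \<in> I \<Longrightarrow> a_coeff T s \<in> borel_measurable (lebesgue_on \<Omega>)"
    "\<And>s. s \<in> I \<Longrightarrow> a1 s \<in> borel_measurable (lebesgue_on \<Omega>)"
    "\<And>s. s \<in> I \<Longrightarrow> a2 s \<in> borel_measurable (lebesgue_on \<Omega>)"
    by (rule jacobian_C2[of I \<Omega> T]) (use assms(5) that in \<open>simp_all add: C2_bilipschitz_family_def\<close>)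
  have DTm: "DTinv T s \<in> borel_measurable (lebesgue_on \<Omega>)" if "s \<in> I" for s
    using assms(5) that unfolding C2_bilipschitz_family_def C2_Linfty_def continuous_Linfty_def
        by blast
  have ab: "AE x in lebesgue_on \<Omega>. \<bar>a_coeff T s x\<bar> \<le> C" "AE x in lebesgue_on \<Omega>. \<bar>a1 s x\<bar> \<le> C"
      if "s \<in> I" for s
    using aAE that by (auto elim!: eventually_mono)
  have V1: "u \<in> H1 \<Omega>" if "u \<in> V_space \<Omega> \<gamma>0" for u using that by (simp add: V_space_iff)
  have Aeq: "A_form \<Omega> T s u v = Dirichlet \<Omega> u v" if "s \<in> I" "u \<in> V_space \<Omega> \<gamma>0" "v \<in> V_space \<Omega> \<gamma>0"
      for s u v
    using conformal_A_form[OF assms(8)[OF that(1)] am(1)[OF that(1)] DTm[OF that(1)] V1[OF that(2)]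
        V1[OF that(3)]] .
  have apos: "AE x in lebesgue_on \<Omega>. 0 < a_coeff T s x" if "s \<in> I" for s
    using conformal_coefficients[OF assms(8)[OF that]] by eventually_elim blast
  obtain \<delta> where \<delta>: "\<delta> > 0" "\<And>u. u \<in> V_space \<Omega> \<gamma>0 \<Longrightarrow> A_form \<Omega> T t u u \<ge> \<delta> * (H1_norm \<Omega> u)\<^sup>2"
    using assms(6) I(3) unfolding coercive_family_def by blast
  have H1sq: "(H1_norm \<Omega> u)\<^sup>2 = H1_inner \<Omega> u u" for u
    by (simp add: H1_norm_eq H1_inner_def Dirichlet_def L2_inner_nonneg)
  interpret coercive_domain \<Omega> \<gamma>0 \<delta>
  proof
    show "\<gamma>0 \<in> sets borel"
    proof -
      have "openin (top_of_set (frontier \<Omega>)) \<gamma>0" using assms(4)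
          by (simp add: boundary_partition_def)
      then obtain U where "open U" "\<gamma>0 = frontier \<Omega> \<inter> U" by (auto simp: openin_open)
      then show ?thesis by auto
    qed
    show "\<delta> * H1_inner \<Omega> u u \<le> Dirichlet \<Omega> u u" if "u \<in> V_space \<Omega> \<gamma>0" for u
      using \<delta>(2)[OF that] Aeq[OF I(3) that that] H1sq by simp
  qed fact+
  have Bw: "B_form \<Omega> T s = weighted \<Omega> (a_coeff T s)" for s
    by (simp add: B_form_def weighted_def fun_eq_iff)
  have "\<exists>e. principal_eigenfunction \<Omega> \<gamma>0 T s e"
    if s: "s \<in> I" for s
  proof (rule simple_principal_eigenvalue)
    show "compact_form (V_space \<Omega> \<gamma>0) (Dirichlet \<Omega>) (B_form \<Omega> T s) (C / \<delta>)"
      unfolding Bw by (rule weighted_compact_form[OF am(1)[OF s] ab(1)[OF s] C apos[OF s]])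
    show "eigenval \<Omega> \<gamma>0 T 1 s < eigenval \<Omega> \<gamma>0 T 2 s" by (rule assms(7)[OF s])
  qed (use Aeq[OF s] in blast)+
  then have "\<forall>s. \<exists>e. s \<in> I \<longrightarrow> (principal_eigenfunction \<Omega> \<gamma>0 T s e)"
    by blast
  from choice[OF this] obtain e where e: "\<And>s. s \<in> I \<Longrightarrow> principal_eigenfunction \<Omega> \<gamma>0 T s (e s)"
    by blast
  define \<mu> where "\<mu> s = 1 / eigenval \<Omega> \<gamma>0 T 1 s" for s
  have diffw: "integrable (lebesgue_on \<Omega>) (\<lambda>x. u x * v x * a_coeff T s x)"
      "integrable (lebesgue_on \<Omega>) (\<lambda>x. u x * v x * a1 s x)"
    if "s \<in> I" "u \<in> V_space \<Omega> \<gamma>0" "v \<in> V_space \<Omega> \<gamma>0" for s u v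
    using weighted_integrable[OF V_H1(2)[OF that(2)] V_H1(2)[OF that(3)]] am(1,2)[OF that(1)] ab[OF
        that(1)] by blast+
  interpret E: eigenvalue_family "V_space \<Omega> \<gamma>0" "Dirichlet \<Omega>" I "B_form \<Omega> T" "\<lambda>s. weighted \<Omega> (a1 s)"
      "C / \<delta>" \<mu> e
  proof
    show "open I" by fact
    show "sym_form (V_space \<Omega> \<gamma>0) (B_form \<Omega> T s)" "sym_form (V_space \<Omega> \<gamma>0) (weighted \<Omega> (a1 s))"
        if "s \<in> I" for s
      unfolding Bw using weighted_sym_form[OF am(1)[OF that] ab(1)[OF that]] weighted_sym_form[OF
          am(2)[OF that] ab(2)[OF that]]
      by (auto intro: sym_form_subset simp: V_H1 subset_iff)
    show "0 \<le> C / \<delta>" using C \<delta> by simp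
    show "\<bar>weighted \<Omega> (a1 s) u v\<bar> \<le> C / \<delta> * V.enorm u * V.enorm v"
      if "s \<in> I" "u \<in> V_space \<Omega> \<gamma>0" "v \<in> V_space \<Omega> \<gamma>0" for s u v
      by (rule weighted_le[OF that(2,3) am(2)[OF that(1)] ab(2)[OF that(1)] C])
    show "\<bar>weighted \<Omega> (a1 r) u v - weighted \<Omega> (a1 s) u v\<bar> \<le> C / \<delta> * \<bar>r - s\<bar> * V.enorm u * V.enorm v"
      if s: "s \<in> I" and r: "r \<in> I" and u: "u \<in> V_space \<Omega> \<gamma>0" and v: "v \<in> V_space \<Omega> \<gamma>0" for s r u v
    proof -
      have "weighted \<Omega> (a1 r) u v - weighted \<Omega> (a1 s) u v = weighted \<Omega> (\<lambda>x. a1 r x - a1 s x) u v"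
        using diffw(2)[OF s u v] diffw(2)[OF r u v] by (simp add: weighted_def right_diff_distrib)
      also have "\<bar>\<dots>\<bar> \<le> C * \<bar>r - s\<bar> / \<delta> * V.enorm u * V.enorm v"
      proof (rule weighted_le[OF u v])
        show "(\<lambda>x. a1 r x - a1 s x) \<in> borel_measurable (lebesgue_on \<Omega>)"
            using am(2)[OF r] am(2)[OF s] by simp
        show "AE x in lebesgue_on \<Omega>. \<bar>a1 r x - a1 s x\<bar> \<le> C * \<bar>r - s\<bar>"
          using aAE
        proof eventually_elim
          case (elim x)
          show ?case by (rule taylor_bounds(1)[OF I(2) s r, of "\<lambda>s. a_coeff T s x" "\<lambda>s. a1 s x"
              "\<lambda>s. a2 s x"]) (use elim in blast)+
        qed
      qed (use C in simp)
      finally show ?thesis by (simp add: mult_ac)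
    qed
    show "\<bar>B_form \<Omega> T r u v - B_form \<Omega> T s u v - (r - s) * weighted \<Omega> (a1 s) u v\<bar> \<le>
        C / \<delta> * (r - s)\<^sup>2 * V.enorm u * V.enorm v"
      if s: "s \<in> I" and r: "r \<in> I" and u: "u \<in> V_space \<Omega> \<gamma>0" and v: "v \<in> V_space \<Omega> \<gamma>0" for s r u v
    proof -
      have "B_form \<Omega> T r u v - B_form \<Omega> T s u v - (r - s) * weighted \<Omega> (a1 s) u v =
          (LINT x|lebesgue_on \<Omega>. u x * v x * a_coeff T r x - u x * v x * a_coeff T s x - (r - s) *
              (u x * v x * a1 s x))"
        using diffw(1)[OF s u v] diffw(1)[OF r u v] diffw(2)[OF s u v]
            by (simp add: B_form_def weighted_def)
      also have "\<dots> = weighted \<Omega> (\<lambda>x. a_coeff T r x - a_coeff T s x - (r - s) * a1 s x) u v"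
        unfolding weighted_def by (intro Bochner_Integration.integral_cong) (simp_all add:
            algebra_simps)
      also have "\<bar>\<dots>\<bar> \<le> C * (r - s)\<^sup>2 / \<delta> * V.enorm u * V.enorm v"
      proof (rule weighted_le[OF u v])
        show "(\<lambda>x. a_coeff T r x - a_coeff T s x - (r -
            s) * a1 s x) \<in> borel_measurable (lebesgue_on \<Omega>)"
          using am(1)[OF r] am(1)[OF s] am(2)[OF s] by simp
        show "AE x in lebesgue_on \<Omega>. \<bar>a_coeff T r x - a_coeff T s x - (r - s) * a1 s x\<bar> \<le>
            C * (r - s)\<^sup>2"
          using aAE
        proof eventually_elim
          case (elim x)
          show ?case by (rule taylor_bounds(2)[OF I(2) s r, of "\<lambda>s. a_coeff T s x" "\<lambda>s. a1 s x"
              "\<lambda>s. a2 s x"]) (use elim in blast)+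
        qed
      qed (use C in simp)
      finally show ?thesis by (simp add: mult_ac)
    qed
  qed (use e in \<open>auto simp: \<mu>_def\<close>)
  have d1: "(\<mu> has_real_derivative weighted \<Omega> (a1 s) (e s) (e s)) (at s)" if "s \<in> I" for s
    by (rule E.eigenvalue_has_derivative[OF that])
  have b2: "((\<lambda>r. weighted \<Omega> (a1 r) (e t) (e t)) has_real_derivative weighted \<Omega> (a2 t) (e t) (e t))
      (at t)"
  proof (rule weighted_has_derivative[OF I])
    show "AE x in lebesgue_on \<Omega>. \<forall>s\<in>I. \<bar>a1 s x\<bar> \<le> C \<and> \<bar>a2 s x\<bar> \<le> C \<and>
        ((\<lambda>s. a1 s x) has_real_derivative a2 s x) (at s)"
      using aAE by eventually_elim blast
    show "e t \<in> L2 \<Omega>" using e[OF I(3)] V_H1(2) by blast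
  qed (use am I in auto)
  \<comment> \<open>The function \<open>a1\<close> is the derivative of the coefficient for all parameters near \<open>t\<close>, so its
      derivative at \<open>t\<close> is the iterated derivative of the hypothesis.\<close>
  have a2pos: "AE x in lebesgue_on \<Omega>. 0 \<le> a2 t x"
    using aAE assms(10)
  proof eventually_elim
    case (elim x)
    have "deriv (deriv (\<lambda>s. a_coeff T s x)) t = a2 t x"
    proof (rule DERIV_imp_deriv)
      show "(deriv (\<lambda>s. a_coeff T s x) has_real_derivative a2 t x) (at t)"
      proof (rule has_field_derivative_transform_within_open[OF _ I(1,3)])
        show "((\<lambda>s. a1 s x) has_real_derivative a2 t x) (at t)" using elim(1) I(3) by blast
        show "a1 s x = deriv (\<lambda>s. a_coeff T s x) s" if "s \<in> I" for s
          using elim(1) that DERIV_imp_deriv by metis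
      qed
    qed
    then show ?case using elim(2) by (simp add: numeral_2_eq_2)
  qed
  have d0: "0 \<le> weighted \<Omega> (a2 t) (e t) (e t)"
    unfolding weighted_def by (rule integral_nonneg_AE) (use a2pos in \<open>auto elim: eventually_mono\<close>)
  obtain L where L: "L \<ge> 0" "((\<lambda>r. weighted \<Omega> (a1 r) (e r) (e r)) has_real_derivative weighted \<Omega> (a2
      t) (e t) (e t) + 2 * L) (at t)"
    using E.second_order[OF I(3) b2] by blast
  have d2: "(deriv \<mu> has_real_derivative weighted \<Omega> (a2 t) (e t) (e t) + 2 * L) (at t)"
    by (rule has_field_derivative_transform_within_open[OF L(2) I(1,3)])
      (use d1 DERIV_imp_deriv in metis)
  have \<mu>: "\<mu> = (\<lambda>r. 1 / eigenval \<Omega> \<gamma>0 T 1 r)" by (simp add: \<mu>_def fun_eq_iff)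
  have "(deriv ^^ 2) \<mu> t = weighted \<Omega> (a2 t) (e t) (e t) + 2 * L"
    using DERIV_imp_deriv[OF d2] by (simp add: numeral_2_eq_2)
  then have "0 \<le> (deriv ^^ 2) \<mu> t" using d0 L(1) by simp
  moreover have "\<forall>s\<in>I. \<mu> field_differentiable (at s)" using d1 unfolding field_differentiable_def
      by blast
  moreover have "deriv \<mu> field_differentiable (at t)" using d2 unfolding field_differentiable_def
      by blast
  ultimately show ?thesis unfolding \<mu> by blast
qed

end
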